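(* Let $A$ be a simple AH-algebra with diagonal maps. Then $A$ can be locally approximated by homogeneous C*-algebras with dimension ratio no more than its mean dimension. In particular, if this AH-algebra has mean dimension zero, it has local slow dimension growth.
   Context: **AH-algebras with diagonal maps.** $A=\varinjlim(A_i,\varphi_i)$ is the inductive limit of a sequence of unital C*-algebras $A_i=\bigoplus_{l=1}^{h_i}A_{i,l}$, $A_{i,l}=p_{i,l}\mathrm{M}_{r_{i,l}}(\mathrm{C}(X_{i,l}))p_{i,l}$, with unital connecting maps $\varphi_{i,j}:A_i\to A_j$, where each $X_{i,l}$ is a connected compact Hausdorff space and $p_{i,l}$ is a projection of rank $n_{i,l}$. It has diagonal maps if for all $i<j$ there is a unitary $U\in A_j$ such that for all $l,k$ the component $A_{i,l}\to A_{j,k}$ of $\mathrm{ad}(U)\circ\varphi_{i,j}$ has the form $f\mapsto\mathrm{diag}(f\circ\lambda_{i,j}^{l,k}(1),\dots,f\circ\lambda_{i,j}^{l,k}(m_{i,j}^{l,k}))$ for continuous maps $\lambda_{i,j}^{l,k}(m):X_{j,k}\to X_{i,l}$. **Mean dimension.** For a finite open cover $\alpha$ of a space $X$ let $\mathrm{ord}(\alpha)=\max_{x\in X}\big(\sum_{U\in\alpha}1_U(x)\big)-1$ and $\mathcal D(\alpha)=\min\{\mathrm{ord}(\beta):\beta\text{ a finite open cover refining }\alpha\}$. The cover $\alpha\vee\beta$ consists of the sets $U\cap V$, $U\in\alpha$, $V\in\beta$. Let $X_i=\bigsqcup_lX_{i,l}$. Let $\alpha$ be a finite open cover of $X_i$,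 each member of which is contained in a connected component, inducing covers $\alpha_l$ of $X_{i,l}$; put $$\varphi_{i,j}^k(\alpha)=\bigvee_{l=1}^{h_i}\bigvee_{m=1}^{m_{i,j}^{l,k}}(\lambda_{i,j}^{l,k}(m))^{-1}(\alpha_l),$$ an open cover of $X_{j,k}$. Set $\gamma_i(A)=\sup_{\alpha}\lim_{j\to\infty}\max_{1\le k\le h_j}\mathcal D(\varphi_{i,j}^k(\alpha))/n_{j,k}$, where $\alpha$ ranges over such covers of $X_i$ (the limit exists since the sequence is decreasing in $j$). The sequence $(\gamma_i(A))$ is increasing, and the mean dimension of $A$ (with respect to the given decomposition) is $\gamma(A)=\lim_i\gamma_i(A)$. **Local approximation.** That $A$ can be locally approximated by homogeneous C*-algebras with dimension ratio no more than $\gamma$ means: for any finite subset $\mathcal F\subseteq A$ and any $\varepsilon_1,\varepsilon_2>0$ there is a unital sub-C*-algebra $C\subseteq A$, isomorphic to a finite direct sum $\bigoplus_i p_i\mathrm{M}_{r_i}(\mathrm{C}(\Omega_i))p_i$ with $\Omega_i$ compact Hausdorff and $p_i$ projections in $\mathrm{M}_{r_i}(\mathrm{C}(\Omega_i))$, such that every element of $\mathcal F$ is within $\varepsilon_1$ of an element of $C$ and $\dim(\Omega_i)/\mathrm{rank}(p_i)<\gamma+\varepsilon_2$ for all $i$, where $\dim$ is covering dimension. Local slow dimension growth is this property with $\gamma=0$. *)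

theory Defs
  imports
    "HOL-Analysis.T1_Spaces"
    "HOL-Library.Extended_Real"
    "HOL-Library.Extended_Nat"
    "HOL-Library.Liminf_Limsup"
    "HOL-Algebra.Ideal"
    "HOL-Algebra.Subrings"
    "Jordan_Normal_Form.DL_Rank"
    "Jordan_Normal_Form.Schur_Decomposition"
begin

section \<open>Unital C*-algebras\<close>

text \<open>A C*-algebra is a HOL-Algebra ring on a carrier set, with complex scalar multiplication
  \<open>smult\<close> (inherited from the record \<open>module\<close>), an involution and a norm.\<close>

record 'a cstar_algebra = "(complex, 'a) module" +
  adj :: "'a \<Rightarrow> 'a"
  cnorm :: "'a \<Rightarrow> real"

definition cdist :: "'a cstar_algebra \<Rightarrow> 'a \<Rightarrow> 'a \<Rightarrow> real" where
  "cdist A x y = cnorm A (x \<ominus>\<^bsub>A\<^esub> y)"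

locale unital_cstar_algebra =
  fixes A :: "'a cstar_algebra" (structure)
  assumes ring: "ring A"
    and module: "Module.module (class_ring :: complex ring) A"
    and smult_mult_left: "\<lbrakk>x \<in> carrier A; y \<in> carrier A\<rbrakk> \<Longrightarrow> (c \<odot> x) \<otimes> y = c \<odot> (x \<otimes> y)"
    and smult_mult_right: "\<lbrakk>x \<in> carrier A; y \<in> carrier A\<rbrakk> \<Longrightarrow> x \<otimes> (c \<odot> y) = c \<odot> (x \<otimes> y)"
    and adj_closed: "x \<in> carrier A \<Longrightarrow> adj A x \<in> carrier A"
    and adj_adj: "x \<in> carrier A \<Longrightarrow> adj A (adj A x) = x"
    and adj_add: "\<lbrakk>x \<in> carrier A; y \<in> carrier A\<rbrakk> \<Longrightarrow> adj A (x \<oplus> y) = adj A x \<oplus> adj A y"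
    and adj_smult: "x \<in> carrier A \<Longrightarrow> adj A (c \<odot> x) = cnj c \<odot> adj A x"
    and adj_mult: "\<lbrakk>x \<in> carrier A; y \<in> carrier A\<rbrakk> \<Longrightarrow> adj A (x \<otimes> y) = adj A y \<otimes> adj A x"
    and cnorm_nonneg: "x \<in> carrier A \<Longrightarrow> 0 \<le> cnorm A x"
    and cnorm_eq_0: "x \<in> carrier A \<Longrightarrow> cnorm A x = 0 \<longleftrightarrow> x = \<zero>"
    and cnorm_triangle:
      "\<lbrakk>x \<in> carrier A; y \<in> carrier A\<rbrakk> \<Longrightarrow> cnorm A (x \<oplus> y) \<le> cnorm A x + cnorm A y"
    and cnorm_smult: "x \<in> carrier A \<Longrightarrow> cnorm A (c \<odot> x) = cmod c * cnorm A x"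
    and cnorm_mult:
      "\<lbrakk>x \<in> carrier A; y \<in> carrier A\<rbrakk> \<Longrightarrow> cnorm A (x \<otimes> y) \<le> cnorm A x * cnorm A y"
    and cstar_identity: "x \<in> carrier A \<Longrightarrow> cnorm A (adj A x \<otimes> x) = (cnorm A x)\<^sup>2"
    and complete:
      "\<lbrakk>range s \<subseteq> carrier A;
        \<forall>e>0. \<exists>N. \<forall>a\<ge>N. \<forall>b\<ge>N. cdist A (s a) (s b) < e\<rbrakk>
       \<Longrightarrow> \<exists>x\<in>carrier A. (\<lambda>a. cdist A (s a) x) \<longlonglongrightarrow> 0"

text \<open>Homomorphisms are unital, since \<open>Ring.ring_hom\<close> includes preservation of the unit.\<close>

definition star_hom :: "'a cstar_algebra \<Rightarrow> 'b cstar_algebra \<Rightarrow> ('a \<Rightarrow> 'b) set" where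
  "star_hom A B = {f \<in> Ring.ring_hom A B. \<forall>x\<in>carrier A.
     (\<forall>c. f (c \<odot>\<^bsub>A\<^esub> x) = c \<odot>\<^bsub>B\<^esub> f x) \<and> f (adj A x) = adj B (f x)}"

definition star_isomorphic :: "'a cstar_algebra \<Rightarrow> 'b cstar_algebra \<Rightarrow> bool" where
  "star_isomorphic A B \<longleftrightarrow> (\<exists>f\<in>star_hom A B. bij_betw f (carrier A) (carrier B))"

definition norm_closed :: "'a cstar_algebra \<Rightarrow> 'a set \<Rightarrow> bool" where
  "norm_closed A S \<longleftrightarrow>
     (\<forall>x\<in>carrier A. (\<forall>e>0. \<exists>y\<in>S. cdist A x y < e) \<longrightarrow> x \<in> S)"

text \<open>\<open>subring\<close> includes \<open>\<one> \<in> C\<close>.\<close>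

definition unital_sub_cstar :: "'a set \<Rightarrow> 'a cstar_algebra \<Rightarrow> bool" where
  "unital_sub_cstar C A \<longleftrightarrow>
     subring C A \<and> (\<forall>x\<in>C. (\<forall>c. c \<odot>\<^bsub>A\<^esub> x \<in> C) \<and> adj A x \<in> C) \<and> norm_closed A C"

definition simple_cstar :: "'a cstar_algebra \<Rightarrow> bool" where
  "simple_cstar A \<longleftrightarrow> carrier A \<noteq> {\<zero>\<^bsub>A\<^esub>} \<and>
     (\<forall>I. ideal I A \<and> norm_closed A I \<longrightarrow> I = {\<zero>\<^bsub>A\<^esub>} \<or> I = carrier A)"

definition unitary_elements :: "'a cstar_algebra \<Rightarrow> 'a set" where
  "unitary_elements A = {u \<in> carrier A.
     adj A u \<otimes>\<^bsub>A\<^esub> u = \<one>\<^bsub>A\<^esub> \<and> u \<otimes>\<^bsub>A\<^esub> adj A u = \<one>\<^bsub>A\<^esub>}"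

section \<open>Homogeneous C*-algebras\<close>

definition vec_l2 :: "complex vec \<Rightarrow> real" where
  "vec_l2 v = sqrt (\<Sum>a<dim_vec v. (cmod (v $ a))\<^sup>2)"

definition mat_opnorm :: "complex mat \<Rightarrow> real" where
  "mat_opnorm M = (SUP v\<in>{v \<in> carrier_vec (dim_col M). vec_l2 v \<le> 1}. vec_l2 (M *\<^sub>v v))"

definition cont_mat :: "'x topology \<Rightarrow> nat \<Rightarrow> nat \<Rightarrow> ('x \<Rightarrow> complex mat) \<Rightarrow> bool" where
  "cont_mat X a b f \<longleftrightarrow> (\<forall>x\<in>topspace X. f x \<in> carrier_mat a b) \<and>
     (\<forall>s<a. \<forall>t<b. continuous_map X euclidean (\<lambda>x. f x $$ (s, t)))"

definition mat_projection :: "'x topology \<Rightarrow> nat \<Rightarrow> ('x \<Rightarrow> complex mat) \<Rightarrow> bool" where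
  "mat_projection X r p \<longleftrightarrow> cont_mat X r r p \<and>
     (\<forall>x\<in>topspace X. p x * p x = p x \<and> mat_adjoint (p x) = p x)"

text \<open>The corner \<open>p M\<^sub>r(C(X)) p\<close>; its elements are functions on \<open>topspace X\<close>, made
  \<open>undefined\<close> outside of it so that equality in the algebra is equality in HOL.\<close>

definition corner_algebra ::
  "'x topology \<Rightarrow> nat \<Rightarrow> ('x \<Rightarrow> complex mat) \<Rightarrow> ('x \<Rightarrow> complex mat) cstar_algebra" where
  "corner_algebra X r p =
    \<lparr> carrier = {f \<in> extensional (topspace X). cont_mat X r r f \<and>
                  (\<forall>x\<in>topspace X. p x * f x * p x = f x)},
      monoid.mult = (\<lambda>f g. \<lambda>x\<in>topspace X. f x * g x),
      one = restrict p (topspace X),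
      zero = (\<lambda>x\<in>topspace X. 0\<^sub>m r r),
      add = (\<lambda>f g. \<lambda>x\<in>topspace X. f x + g x),
      module.smult = (\<lambda>c f. \<lambda>x\<in>topspace X. c \<cdot>\<^sub>m f x),
      adj = (\<lambda>f. \<lambda>x\<in>topspace X. mat_adjoint (f x)),
      cnorm = (\<lambda>f. SUP x\<in>topspace X. mat_opnorm (f x)) \<rparr>"

definition direct_sum_algebra ::
  "nat \<Rightarrow> (nat \<Rightarrow> 'b cstar_algebra) \<Rightarrow> (nat \<Rightarrow> 'b) cstar_algebra" where
  "direct_sum_algebra h B =
    \<lparr> carrier = (\<Pi>\<^sub>E l\<in>{..<h}. carrier (B l)),
      monoid.mult = (\<lambda>f g. \<lambda>l\<in>{..<h}. f l \<otimes>\<^bsub>B l\<^esub> g l),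
      one = (\<lambda>l\<in>{..<h}. \<one>\<^bsub>B l\<^esub>),
      zero = (\<lambda>l\<in>{..<h}. \<zero>\<^bsub>B l\<^esub>),
      add = (\<lambda>f g. \<lambda>l\<in>{..<h}. f l \<oplus>\<^bsub>B l\<^esub> g l),
      module.smult = (\<lambda>c f. \<lambda>l\<in>{..<h}. c \<odot>\<^bsub>B l\<^esub> f l),
      adj = (\<lambda>f. \<lambda>l\<in>{..<h}. adj (B l) (f l)),
      cnorm = (\<lambda>f. MAX l\<in>{..<h}. cnorm (B l) (f l)) \<rparr>"

record 'x homog_data =
  summands :: nat
  spc :: "nat \<Rightarrow> 'x topology"
  msize :: "nat \<Rightarrow> nat"
  prj :: "nat \<Rightarrow> 'x \<Rightarrow> complex mat"
  prank :: "nat \<Rightarrow> nat"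

text \<open>Zero summands are excluded (nonempty spaces, positive ranks), as one divides by the ranks.\<close>

definition homogeneous :: "'x homog_data \<Rightarrow> bool" where
  "homogeneous H \<longleftrightarrow> 0 < summands H \<and> (\<forall>l<summands H.
     topspace (spc H l) \<noteq> {} \<and> compact_space (spc H l) \<and> Hausdorff_space (spc H l) \<and>
     mat_projection (spc H l) (msize H l) (prj H l) \<and>
     0 < prank H l \<and>
     (\<forall>x\<in>topspace (spc H l). vec_space.rank (msize H l) (prj H l x) = prank H l))"

definition summand_algebra :: "'x homog_data \<Rightarrow> nat \<Rightarrow> ('x \<Rightarrow> complex mat) cstar_algebra" where
  "summand_algebra H l = corner_algebra (spc H l) (msize H l) (prj H l)"

definition homog_algebra :: "'x homog_data \<Rightarrow> (nat \<Rightarrow> 'x \<Rightarrow> complex mat) cstar_algebra" where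
  "homog_algebra H = direct_sum_algebra (summands H) (summand_algebra H)"

definition summand_embed ::
  "'x homog_data \<Rightarrow> nat \<Rightarrow> ('x \<Rightarrow> complex mat) \<Rightarrow> (nat \<Rightarrow> 'x \<Rightarrow> complex mat)" where
  "summand_embed H l f =
     (\<lambda>l'\<in>{..<summands H}. if l' = l then f else \<zero>\<^bsub>summand_algebra H l'\<^esub>)"

section \<open>Inductive limits, AH-algebras and diagonal maps\<close>

text \<open>\<open>A\<close>, with the canonical maps \<open>\<psi> i\<close>, is the inductive limit of \<open>(B i, \<phi> i j)\<close>: it is the
  completion of the algebraic direct limit with respect to the seminorm
  \<open>\<psi> i x \<mapsto> lim\<^sub>j \<parallel>\<phi> i j x\<parallel>\<close>, divided by its null space.\<close>

definition inductive_limit ::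
  "'a cstar_algebra \<Rightarrow> (nat \<Rightarrow> 'b cstar_algebra) \<Rightarrow> (nat \<Rightarrow> nat \<Rightarrow> 'b \<Rightarrow> 'b) \<Rightarrow>
    (nat \<Rightarrow> 'b \<Rightarrow> 'a) \<Rightarrow> bool" where
  "inductive_limit A B \<phi> \<psi> \<longleftrightarrow>
     unital_cstar_algebra A \<and>
     (\<forall>i j. i \<le> j \<longrightarrow> \<phi> i j \<in> star_hom (B i) (B j)) \<and>
     (\<forall>i. \<forall>x\<in>carrier (B i). \<phi> i i x = x) \<and>
     (\<forall>i j k. i \<le> j \<and> j \<le> k \<longrightarrow> (\<forall>x\<in>carrier (B i). \<phi> j k (\<phi> i j x) = \<phi> i k x)) \<and>
     (\<forall>i. \<psi> i \<in> star_hom (B i) A) \<and>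
     (\<forall>i j. i \<le> j \<longrightarrow> (\<forall>x\<in>carrier (B i). \<psi> j (\<phi> i j x) = \<psi> i x)) \<and>
     (\<forall>i. \<forall>x\<in>carrier (B i). (\<lambda>j. cnorm (B j) (\<phi> i j x)) \<longlonglongrightarrow> cnorm A (\<psi> i x)) \<and>
     (\<forall>a\<in>carrier A. \<forall>e>0. \<exists>i. \<exists>x\<in>carrier (B i). cdist A a (\<psi> i x) < e)"

definition AH_algebra ::
  "'a cstar_algebra \<Rightarrow> (nat \<Rightarrow> 'x homog_data) \<Rightarrow>
    (nat \<Rightarrow> nat \<Rightarrow> (nat \<Rightarrow> 'x \<Rightarrow> complex mat) \<Rightarrow> (nat \<Rightarrow> 'x \<Rightarrow> complex mat)) \<Rightarrow>
    (nat \<Rightarrow> (nat \<Rightarrow> 'x \<Rightarrow> complex mat) \<Rightarrow> 'a) \<Rightarrow> bool" where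
  "AH_algebra A S \<phi> \<psi> \<longleftrightarrow>
     (\<forall>i. homogeneous (S i) \<and> (\<forall>l<summands (S i). connected_space (spc (S i) l))) \<and>
     inductive_limit A (\<lambda>i. homog_algebra (S i)) \<phi> \<psi>"

text \<open>\<open>\<Phi>\<close> maps the \<open>l\<close>-th summand \<open>p M\<^sub>r(C(X)) p\<close> of \<open>S\<close> to the \<open>k\<close>-th summand
  \<open>q M\<^sub>t(C(Y)) q\<close> of \<open>T\<close> and has the form \<open>f \<mapsto> diag(f \<circ> L 0, \<dots>, f \<circ> L (M - 1))\<close>.
  The diagonal matrix lives in the corner of \<open>M\<^bsub>M r\<^esub>(C(Y))\<close> given by the projection
  \<open>diag(p \<circ> L 0, \<dots>, p \<circ> L (M - 1))\<close>, and \<open>M r\<close> need not equal \<open>t\<close>; as usual, this corner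
  is identified with the corner of \<open>M\<^sub>t(C(Y))\<close> in which \<open>\<Phi>\<close> takes its values by means of a
  continuous partial isometry \<open>v\<close>. When the target projection is itself block diagonal, \<open>v\<close> may
  be taken to be a constant coordinate inclusion cut down by \<open>diag(p \<circ> L 0, \<dots>)\<close>.\<close>

definition diagonal_form ::
  "'x homog_data \<Rightarrow> nat \<Rightarrow> 'x homog_data \<Rightarrow> nat \<Rightarrow> nat \<Rightarrow> (nat \<Rightarrow> 'x \<Rightarrow> 'x) \<Rightarrow>
    (('x \<Rightarrow> complex mat) \<Rightarrow> ('x \<Rightarrow> complex mat)) \<Rightarrow> bool" where
  "diagonal_form S l T k M L \<Phi> \<longleftrightarrow>
     (\<exists>v. cont_mat (spc T k) (M * msize S l) (msize T k) v \<and>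
        (\<forall>x\<in>topspace (spc T k).
           v x * mat_adjoint (v x) = diag_block_mat (map (\<lambda>s. prj S l (L s x)) [0..<M]) \<and>
           (\<forall>f\<in>carrier (summand_algebra S l).
              \<Phi> f x = mat_adjoint (v x) * diag_block_mat (map (\<lambda>s. f (L s x)) [0..<M]) * v x)))"

text \<open>\<open>m i j l k\<close> is the number of eigenvalue maps \<open>L i j l k s\<close>, \<open>s < m i j l k\<close>, from the
  \<open>k\<close>-th space of \<open>S j\<close> to the \<open>l\<close>-th space of \<open>S i\<close>.\<close>

definition diagonal_maps ::
  "(nat \<Rightarrow> 'x homog_data) \<Rightarrow>
    (nat \<Rightarrow> nat \<Rightarrow> (nat \<Rightarrow> 'x \<Rightarrow> complex mat) \<Rightarrow> (nat \<Rightarrow> 'x \<Rightarrow> complex mat)) \<Rightarrow>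
    (nat \<Rightarrow> nat \<Rightarrow> nat \<Rightarrow> nat \<Rightarrow> nat) \<Rightarrow>
    (nat \<Rightarrow> nat \<Rightarrow> nat \<Rightarrow> nat \<Rightarrow> nat \<Rightarrow> 'x \<Rightarrow> 'x) \<Rightarrow> bool" where
  "diagonal_maps S \<phi> m L \<longleftrightarrow>
     (\<forall>i j. i < j \<longrightarrow>
        (\<exists>U\<in>unitary_elements (homog_algebra (S j)).
           \<forall>l<summands (S i). \<forall>k<summands (S j).
             (\<forall>s<m i j l k. continuous_map (spc (S j) k) (spc (S i) l) (L i j l k s)) \<and>
             diagonal_form (S i) l (S j) k (m i j l k) (L i j l k)
               (\<lambda>f. (U \<otimes>\<^bsub>homog_algebra (S j)\<^esub> \<phi> i j (summand_embed (S i) l f)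
                       \<otimes>\<^bsub>homog_algebra (S j)\<^esub> adj (homog_algebra (S j)) U) k)))"

section \<open>Open covers and dimension\<close>

definition finite_open_cover :: "'x topology \<Rightarrow> 'x set set \<Rightarrow> bool" where
  "finite_open_cover X \<alpha> \<longleftrightarrow> finite \<alpha> \<and> (\<forall>U\<in>\<alpha>. openin X U) \<and> \<Union>\<alpha> = topspace X"

definition refines :: "'x set set \<Rightarrow> 'x set set \<Rightarrow> bool" where
  "refines \<beta> \<alpha> \<longleftrightarrow> (\<forall>V\<in>\<beta>. \<exists>U\<in>\<alpha>. V \<subseteq> U)"

text \<open>Only used for nonempty spaces, where the subtraction does not truncate.\<close>

definition cover_ord :: "'x topology \<Rightarrow> 'x set set \<Rightarrow> nat" where
  "cover_ord X \<alpha> = (MAX x\<in>topspace X. card {U \<in> \<alpha>. x \<in> U}) - 1"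

definition cover_D :: "'x topology \<Rightarrow> 'x set set \<Rightarrow> nat" where
  "cover_D X \<alpha> = (LEAST d. \<exists>\<beta>. finite_open_cover X \<beta> \<and> refines \<beta> \<alpha> \<and> d = cover_ord X \<beta>)"

definition covering_dim :: "'x topology \<Rightarrow> enat" where
  "covering_dim X = (SUP \<alpha>\<in>{\<alpha>. finite_open_cover X \<alpha>}. enat (cover_D X \<alpha>))"

text \<open>The join of the finitely many covers \<open>C t\<close>, \<open>t \<in> I\<close>.\<close>

definition cover_join :: "'x topology \<Rightarrow> 't set \<Rightarrow> ('t \<Rightarrow> 'x set set) \<Rightarrow> 'x set set" where
  "cover_join X I C = (\<lambda>V. topspace X \<inter> (\<Inter>t\<in>I. V t)) ` (\<Pi>\<^sub>E t\<in>I. C t)"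

definition cover_pullback :: "'y topology \<Rightarrow> ('y \<Rightarrow> 'x) \<Rightarrow> 'x set set \<Rightarrow> 'y set set" where
  "cover_pullback Y f \<alpha> = (\<lambda>U. {y \<in> topspace Y. f y \<in> U}) ` \<alpha>"

section \<open>Mean dimension\<close>

text \<open>An open cover of the disjoint union of the spaces of \<open>H\<close>, each member of which lies in one
  component, is given by the open covers \<open>\<alpha> l\<close> that it induces on the components.\<close>

definition component_covers :: "'x homog_data \<Rightarrow> (nat \<Rightarrow> 'x set set) set" where
  "component_covers H = {\<alpha>. \<forall>l<summands H. finite_open_cover (spc H l) (\<alpha> l)}"

definition pushed_cover ::
  "(nat \<Rightarrow> 'x homog_data) \<Rightarrow> (nat \<Rightarrow> nat \<Rightarrow> nat \<Rightarrow> nat \<Rightarrow> nat) \<Rightarrow>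
    (nat \<Rightarrow> nat \<Rightarrow> nat \<Rightarrow> nat \<Rightarrow> nat \<Rightarrow> 'x \<Rightarrow> 'x) \<Rightarrow>
    nat \<Rightarrow> nat \<Rightarrow> nat \<Rightarrow> (nat \<Rightarrow> 'x set set) \<Rightarrow> 'x set set" where
  "pushed_cover S m L i j k \<alpha> =
     cover_join (spc (S j) k) (SIGMA l:{..<summands (S i)}. {..<m i j l k})
       (\<lambda>(l, s). cover_pullback (spc (S j) k) (L i j l k s) (\<alpha> l))"

definition cover_ratio ::
  "(nat \<Rightarrow> 'x homog_data) \<Rightarrow> (nat \<Rightarrow> nat \<Rightarrow> nat \<Rightarrow> nat \<Rightarrow> nat) \<Rightarrow>
    (nat \<Rightarrow> nat \<Rightarrow> nat \<Rightarrow> nat \<Rightarrow> nat \<Rightarrow> 'x \<Rightarrow> 'x) \<Rightarrow>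
    nat \<Rightarrow> (nat \<Rightarrow> 'x set set) \<Rightarrow> nat \<Rightarrow> real" where
  "cover_ratio S m L i \<alpha> j =
     (MAX k\<in>{..<summands (S j)}.
        real (cover_D (spc (S j) k) (pushed_cover S m L i j k \<alpha>)) / real (prank (S j) k))"

text \<open>The limits defining the mean dimension are written as lower limits. They coincide with the
  limits when these exist (\<open>mean_dim_at_eq_lim\<close>, \<open>mean_dimension_eq_lim\<close>), which is the case when
  the families of eigenvalue maps are compatible with composition, so that the ratios decrease
  in \<open>j\<close>. For other choices of eigenvalue maps of the same algebra homomorphisms, the lower limit
  still makes sense and no compatibility has to be imposed.\<close>

definition mean_dim_at ::
  "(nat \<Rightarrow> 'x homog_data) \<Rightarrow> (nat \<Rightarrow> nat \<Rightarrow> nat \<Rightarrow> nat \<Rightarrow> nat) \<Rightarrow>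
    (nat \<Rightarrow> nat \<Rightarrow> nat \<Rightarrow> nat \<Rightarrow> nat \<Rightarrow> 'x \<Rightarrow> 'x) \<Rightarrow> nat \<Rightarrow> ereal" where
  "mean_dim_at S m L i =
     (SUP \<alpha>\<in>component_covers (S i). liminf (\<lambda>j. ereal (cover_ratio S m L i \<alpha> j)))"

definition mean_dimension ::
  "(nat \<Rightarrow> 'x homog_data) \<Rightarrow> (nat \<Rightarrow> nat \<Rightarrow> nat \<Rightarrow> nat \<Rightarrow> nat) \<Rightarrow>
    (nat \<Rightarrow> nat \<Rightarrow> nat \<Rightarrow> nat \<Rightarrow> nat \<Rightarrow> 'x \<Rightarrow> 'x) \<Rightarrow> ereal" where
  "mean_dimension S m L = liminf (mean_dim_at S m L)"

lemma mean_dim_at_eq_lim: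
  assumes "\<And>\<alpha>. \<alpha> \<in> component_covers (S i) \<Longrightarrow>
    convergent (\<lambda>j. ereal (cover_ratio S m L i \<alpha> j))"
  shows "mean_dim_at S m L i =
    (SUP \<alpha>\<in>component_covers (S i). lim (\<lambda>j. ereal (cover_ratio S m L i \<alpha> j)))"
  unfolding mean_dim_at_def
  by (intro SUP_cong refl) (metis assms convergent_LIMSEQ_iff lim_imp_Liminf
      trivial_limit_sequentially)

lemma mean_dimension_eq_lim:
  assumes "convergent (mean_dim_at S m L)"
  shows "mean_dimension S m L = lim (mean_dim_at S m L)"
  unfolding mean_dimension_def
  by (metis assms convergent_LIMSEQ_iff lim_imp_Liminf trivial_limit_sequentially)

section \<open>Local approximation\<close>

text \<open>The spaces \<open>\<Omega>\<^sub>l\<close> are taken in the type \<open>'a \<Rightarrow> complex\<close>, where \<open>'a\<close> is the element type of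
  \<open>A\<close>. This loses no generality: if \<open>C \<subseteq> A\<close> is isomorphic to a direct sum of algebras
  \<open>p\<^sub>l M(C(\<Omega>\<^sub>l)) p\<^sub>l\<close> with \<open>p\<^sub>l\<close> of positive rank, then \<open>\<Omega>\<^sub>l\<close> is homeomorphic to the space of
  characters of the centre of the \<open>l\<close>-th summand, and these are functions from elements of \<open>A\<close>
  to the complex numbers.\<close>

definition locally_approximable :: "'a cstar_algebra \<Rightarrow> ereal \<Rightarrow> bool" where
  "locally_approximable A \<gamma> \<longleftrightarrow>
     (\<forall>F \<epsilon>\<^sub>1 \<epsilon>\<^sub>2. finite F \<and> F \<subseteq> carrier A \<and> 0 < \<epsilon>\<^sub>1 \<and> 0 < \<epsilon>\<^sub>2 \<longrightarrow>
        (\<exists>C (H :: ('a \<Rightarrow> complex) homog_data).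
           unital_sub_cstar C A \<and>
           homogeneous H \<and>
           star_isomorphic (A\<lparr>carrier := C\<rparr>) (homog_algebra H) \<and>
           (\<forall>a\<in>F. \<exists>c\<in>C. cdist A a c < \<epsilon>\<^sub>1) \<and>
           (\<forall>l<summands H.
              ereal_of_enat (covering_dim (spc H l)) / ereal (real (prank H l))
                < \<gamma> + ereal \<epsilon>\<^sub>2)))"

definition local_slow_dimension_growth :: "'a cstar_algebra \<Rightarrow> bool" where
  "local_slow_dimension_growth A \<longleftrightarrow> locally_approximable A 0"

end

theory Submission
  imports Defs "HOL-Analysis.Urysohn"
begin

text \<open>Only finitely many elements of the limit algebra have to be approximated, so they may be taken to be images of
elements \<open>f\<close> of one building block \<open>A\<^sub>i\<close>. Cover the spectrum of \<open>A\<^sub>i\<close> by open sets on which these \<open>f\<close>, and also the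
unit, are nearly constant. Far enough to the right, in some \<open>A\<^sub>j\<close>, the pulled back cover of each spectrum \<open>X\<close> has
a refinement \<open>\<beta>\<close> whose order \<open>d\<close>, divided by the rank of the summand, is below the mean dimension plus \<open>\<epsilon>\<close>.
A partition of unity subordinate to \<open>\<beta>\<close> maps \<open>X\<close> onto a compact subset \<open>\<Omega>\<close> of a complex of dimension \<open>d\<close>, the
nerve of \<open>\<beta>\<close>. Up to a continuous partial isometry \<open>W\<close>, the connecting map sends \<open>f\<close> to the block diagonal matrix
\<open>D f\<close> with the blocks \<open>f \<circ> \<lambda>\<^sub>s\<close>, and \<open>D f\<close> varies little on each member of \<open>\<beta>\<close>. Hence \<open>D f\<close> is close to \<open>E f \<circ> \<xi>\<close>,
where \<open>\<xi> : X \<rightarrow> \<Omega>\<close> is the map to the nerve and \<open>E f\<close> interpolates affinely between the values of \<open>D f\<close> at chosen points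
of the members of \<open>\<beta>\<close> (\<open>nerve_model\<close>). So the images of all the \<open>f\<close> are nearly functions on \<open>\<Omega>\<close>.

The unit needs repair: \<open>D 1 = W W\<^sup>*\<close> is a projection, whereas \<open>E 1\<close> is only close to one. Both repairs use the Newton
iteration \<open>Z \<mapsto> (3 Z - Z Z\<^sup>* Z) / 2\<close>, which converges to the partial isometry in the polar decomposition and stays
continuous in parameters (\<open>polar_continuous\<close>). Applied to \<open>2 E 1 - 1\<close> it gives a symmetry, that is, a projection \<open>q\<close> over
\<open>\<Omega>\<close> close to \<open>E 1\<close>; applied to \<open>q W\<close> it gives \<open>w\<close> with \<open>w\<^sup>* w = W\<^sup>* W\<close> and \<open>w w\<^sup>* = q \<circ> \<xi>\<close>
(\<open>projection_perturbation\<close>). Then \<open>g \<mapsto> w\<^sup>* (g \<circ> \<xi>) w\<close> is a unital embedding of the corner of the matrix algebra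
over \<open>\<Omega>\<close> given by \<open>q\<close>, and its image nearly contains the images of the \<open>f\<close>.

The covering dimension of \<open>\<Omega>\<close> is at most \<open>d\<close> (\<open>covering_dim_barycentric\<close>) by a pigeonhole argument that replaces
subdivisions of the complex.

Finally, \<open>A\<^sub>j\<close> need not embed into the limit. Because the connecting maps are diagonal, the norm in the limit is the
supremum of the pointwise norm over the closed set \<open>Y\<close> of those points near which the eigenvalue maps of arbitrarily late
stages take values (\<open>limit_norm_le_iff\<close>). So everything above is done over \<open>Y\<close> instead of \<open>X\<close>, which does not increase
the order of \<open>\<beta>\<close>, and elements are lifted from \<open>Y\<close> to \<open>X\<close> by Tietze's theorem; this is the content of the locale
\<open>pullback_model\<close>. A simple algebra is nonzero, whence \<open>Y\<close> is nonempty for at least one summand.\<close>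

unbundle no vec_syntax

section \<open>A normed ring containing the matrices of all sizes\<close>

text \<open>Infinite matrices with finitely many nonzero entries. Embedding the rectangular matrices of all sizes into this one
 type, with zeros added, turns them into elements of a normed algebra in the sense of the type classes, so that identities
 and estimates need no bookkeeping of sizes. The size survives as the predicate \<open>fits\<close>; there is no common unit, and
 \<open>idm n\<close> plays the role of the identity matrix of size \<open>n\<close>.\<close>

typedef fmat = "{f :: nat \<Rightarrow> nat \<Rightarrow> complex. \<exists>n. \<forall>i j. n \<le> i \<or> n \<le> j \<longrightarrow> f i j = 0}"
  morphisms ent Abs_fmat
  by (rule exI[of _ "\<lambda>_ _. 0"]) auto

setup_lifting type_definition_fmat

definition fits :: "nat \<Rightarrow> nat \<Rightarrow> fmat \<Rightarrow> bool" where
  "fits a b F \<longleftrightarrow> (\<forall>i j. a \<le> i \<or> b \<le> j \<longrightarrow> ent F i j = 0)"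

lemma fitsD: "fits a b F \<Longrightarrow> a \<le> i \<or> b \<le> j \<Longrightarrow> ent F i j = 0"
  by (auto simp: fits_def)

lemma fits_less: "fits a b F \<Longrightarrow> ent F i j \<noteq> 0 \<Longrightarrow> i < a \<and> j < b"
  unfolding fits_def by (meson not_less)

lemma fits_mono: "fits a b F \<Longrightarrow> a \<le> a' \<Longrightarrow> b \<le> b' \<Longrightarrow> fits a' b' F"
  unfolding fits_def by (meson order_trans)

lemma ex_fits: "\<exists>n. fits n n F"
  using ent[of F] by (auto simp: fits_def)

lemma fmat_eqI: "(\<And>i j. ent F i j = ent G i j) \<Longrightarrow> F = G"
  by (metis ent_inject ext)

lift_definition scl :: "complex \<Rightarrow> fmat \<Rightarrow> fmat" is "\<lambda>c f i j. c * f i j"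
  by auto

lift_definition star :: "fmat \<Rightarrow> fmat" is "\<lambda>f i j. cnj (f j i)"
  by auto

lift_definition idm :: "nat \<Rightarrow> fmat" is "\<lambda>n i j. if i = j \<and> i < n then 1 else 0"
  by (metis not_less)

instantiation fmat :: ring
begin

lift_definition zero_fmat :: fmat is "\<lambda>_ _. 0" by simp

lift_definition plus_fmat :: "fmat \<Rightarrow> fmat \<Rightarrow> fmat" is "\<lambda>f g i j. f i j + g i j"
proof -
  fix f g :: "nat \<Rightarrow> nat \<Rightarrow> complex"
  assume "\<exists>n. \<forall>i j. n \<le> i \<or> n \<le> j \<longrightarrow> f i j = 0" "\<exists>n. \<forall>i j. n \<le> i \<or> n \<le> j \<longrightarrow> g i j = 0"
  then obtain n m where "\<forall>i j. n \<le> i \<or> n \<le> j \<longrightarrow> f i j = 0" "\<forall>i j. m \<le> i \<or> m \<le> j \<longrightarrow> g i j = 0"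
    by blast
  then show "\<exists>n. \<forall>i j. n \<le> i \<or> n \<le> j \<longrightarrow> f i j + g i j = 0"
    by (intro exI[of _ "max n m"]) auto
qed

lift_definition uminus_fmat :: "fmat \<Rightarrow> fmat" is "\<lambda>f i j. - f i j" by auto

definition minus_fmat :: "fmat \<Rightarrow> fmat \<Rightarrow> fmat" where "F - G = F + (- G :: fmat)"

lift_definition times_fmat :: "fmat \<Rightarrow> fmat \<Rightarrow> fmat" is "\<lambda>f g i j. \<Sum>k | f i k \<noteq> 0. f i k * g k j"
proof -
  fix f g :: "nat \<Rightarrow> nat \<Rightarrow> complex"
  assume "\<exists>n. \<forall>i j. n \<le> i \<or> n \<le> j \<longrightarrow> f i j = 0" "\<exists>n. \<forall>i j. n \<le> i \<or> n \<le> j \<longrightarrow> g i j = 0"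
  then obtain n m where "\<forall>i j. n \<le> i \<or> n \<le> j \<longrightarrow> f i j = 0" "\<forall>i j. m \<le> i \<or> m \<le> j \<longrightarrow> g i j = 0"
    by blast
  then show "\<exists>n. \<forall>i j. n \<le> i \<or> n \<le> j \<longrightarrow> (\<Sum>k | f i k \<noteq> 0. f i k * g k j) = 0"
    by (intro exI[of _ "max n m"]) auto
qed

lemma ent_ring_ops: "ent 0 i j = 0" "ent (F + G) i j = ent F i j + ent G i j" "ent (- F) i j = - ent F i j"
  by (transfer; simp)+

lemma ent_times: assumes "fits a b F" shows "ent (F * G) i j = (\<Sum>k<b. ent F i k * ent G k j)"
proof -
  have "ent (F * G) i j = (\<Sum>k | ent F i k \<noteq> 0. ent F i k * ent G k j)"
    by transfer simp
  also have "\<dots> = (\<Sum>k<b. ent F i k * ent G k j)"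
    using assms by (intro sum.mono_neutral_left) (auto dest: fits_less)
  finally show ?thesis .
qed

instance
proof
  fix a b c :: fmat
  show "a + b + c = a + (b + c)" "a + b = b + a" "0 + a = a" "- a + a = 0" "a - b = a + - b"
    by (auto intro!: fmat_eqI simp: ent_ring_ops minus_fmat_def[of a b])
  obtain n where n: "fits n n a" using ex_fits by blast
  obtain m where m: "fits m m b" using ex_fits by blast
  define N where "N = max n m"
  have a: "fits N N a" and b: "fits N N b" using n m fits_mono N_def by (meson max.cobounded1 max.cobounded2)+
  have ab: "fits N N (a + b)" using a b by (auto simp: fits_def ent_ring_ops)
  have ab2: "fits N N (a * b)"
    unfolding fits_def by (simp only: ent_times[OF a]) (use a b in \<open>auto simp: fits_def\<close>)
  show "(a + b) * c = a * c + b * c"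
    by (rule fmat_eqI) (simp add: ent_times[OF ab] ent_times[OF a] ent_times[OF b] ent_ring_ops distrib_right sum.distrib)
  show "a * (b + c) = a * b + a * c"
    by (rule fmat_eqI) (simp add: ent_times[OF a] ent_ring_ops distrib_left sum.distrib)
  show "a * b * c = a * (b * c)"
  proof (rule fmat_eqI)
    fix i j
    have "ent (a * b * c) i j = (\<Sum>k<N. \<Sum>l<N. ent a i l * ent b l k * ent c k j)"
      by (simp add: ent_times[OF ab2] ent_times[OF a] sum_distrib_right)
    also have "\<dots> = (\<Sum>l<N. \<Sum>k<N. ent a i l * ent b l k * ent c k j)" by (rule sum.swap)
    also have "\<dots> = ent (a * (b * c)) i j"
      by (simp add: ent_times[OF a] ent_times[OF b] sum_distrib_left mult.assoc)
    finally show "ent (a * b * c) i j = ent (a * (b * c)) i j" .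
  qed
qed
end

lemma ent_simps [simp]: "ent 0 i j = 0" "ent (F + G) i j = ent F i j + ent G i j"
    "ent (- F) i j = - ent F i j" "ent (F - G) i j = ent F i j - ent G i j"
    "ent (scl c F) i j = c * ent F i j" "ent (star F) i j = cnj (ent F j i)"
    "ent (idm n) i j = (if i = j \<and> i < n then 1 else 0)"
proof -
  show "ent (F - G) i j = ent F i j - ent G i j"
    unfolding minus_fmat_def by (simp only: ent_ring_ops diff_conv_add_uminus)
qed (simp_all only: ent_ring_ops, (transfer; simp)+)

lemma ent_times': assumes "fits b c G" shows "ent (F * G) i j = (\<Sum>k<b. ent F i k * ent G k j)"
proof -
  obtain n where n: "fits n n F" using ex_fits by blast
  then have "ent (F * G) i j = (\<Sum>k<max n b. ent F i k * ent G k j)"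
    by (intro ent_times[OF fits_mono]) auto
  also have "\<dots> = (\<Sum>k<b. ent F i k * ent G k j)"
    using assms by (intro sum.mono_neutral_right) (auto simp: fits_def)
  finally show ?thesis .
qed

lemma ent_sum [simp]: "ent (sum F I) i j = (\<Sum>x\<in>I. ent (F x) i j)"
  by (induction I rule: infinite_finite_induct) auto

lemma star_star [simp]: "star (star F) = F"
  and star_add [simp]: "star (F + G) = star F + star G"
  and star_minus [simp]: "star (F - G) = star F - star G"
  and star_uminus [simp]: "star (- F) = - star F"
  and star_zero [simp]: "star 0 = 0"
  and star_scl [simp]: "star (scl c F) = scl (cnj c) (star F)"
  and star_idm [simp]: "star (idm n) = idm n"
  by (auto intro!: fmat_eqI)

lemma star_sum [simp]: "star (sum F I) = (\<Sum>x\<in>I. star (F x))"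
  by (rule fmat_eqI) simp

lemma fits_simps [simp]: "fits a b 0" "fits a b F \<Longrightarrow> fits a b G \<Longrightarrow> fits a b (F + G)"
  "fits a b F \<Longrightarrow> fits a b G \<Longrightarrow> fits a b (F - G)" "fits a b F \<Longrightarrow> fits a b (- F)"
  "fits a b F \<Longrightarrow> fits a b (scl c F)" "fits b a F \<Longrightarrow> fits a b (star F)"
  "fits n n (idm n)"
  by (auto simp: fits_def)

lemma fits_sum: "(\<And>x. x \<in> I \<Longrightarrow> fits a b (F x)) \<Longrightarrow> fits a b (sum F I)"
  by (auto simp: fits_def)

lemma fits_times: assumes "fits a b F" "fits b c G" shows "fits a c (F * G)"
  unfolding fits_def ent_times[OF assms(1)] using assms by (auto simp: fits_def)

lemma star_times [simp]: "star (F * G) = star G * star F"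
proof (rule fmat_eqI)
  fix i j
  obtain n where n: "fits n n F" using ex_fits by blast
  have "fits n n (star F)" using n by simp
  then show "ent (star (F * G)) i j = ent (star G * star F) i j"
    by (simp add: ent_times[OF n] ent_times'[of n n] mult.commute)
qed

lemma scl_mult: "scl c F * G = scl c (F * G)" "F * scl c G = scl c (F * G)"
proof -
  obtain n where n: "fits n n F" using ex_fits by blast
  have n': "fits n n (scl c F)" using n by simp
  show "scl c F * G = scl c (F * G)" "F * scl c G = scl c (F * G)"
    by (rule fmat_eqI, simp add: ent_times[OF n] ent_times[OF n'] sum_distrib_left mult_ac)+
qed

lemma idm_left: assumes "fits a b F" "a \<le> n" shows "idm n * F = F"
proof (rule fmat_eqI)
  fix i j
  have "ent (idm n * F) i j = (\<Sum>k<n. if k = i then ent F i j else 0)"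
    unfolding ent_times[of n n "idm n", simplified] by (intro sum.cong) auto
  then show "ent (idm n * F) i j = ent F i j" using assms by (auto simp: fits_def)
qed

lemma idm_right: assumes "fits a b F" "b \<le> n" shows "F * idm n = F"
proof -
  have "star (F * idm n) = star F" using idm_left[of b a "star F" n] assms by simp
  then show ?thesis by (metis star_star)
qed

definition vnorm :: "nat \<Rightarrow> (nat \<Rightarrow> complex) \<Rightarrow> real" where
  "vnorm n u = L2_set (\<lambda>i. cmod (u i)) {..<n}"

definition act :: "fmat \<Rightarrow> (nat \<Rightarrow> complex) \<Rightarrow> nat \<Rightarrow> complex" where
  "act F u i = (\<Sum>k | ent F i k \<noteq> 0. ent F i k * u k)"

lemma act_eq: assumes "fits a b F" shows "act F u i = (\<Sum>k<b. ent F i k * u k)"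
  unfolding act_def
  using assms by (intro sum.mono_neutral_left) (auto dest: fits_less)

lemma vnorm_nonneg [simp]: "0 \<le> vnorm n u" by (simp add: vnorm_def)

lemma vnorm_supp_le: assumes "\<And>i. a \<le> i \<Longrightarrow> v i = 0" shows "vnorm n v \<le> vnorm a v"
proof -
  have "(\<Sum>i<n. (cmod (v i))\<^sup>2) = (\<Sum>i\<in>{..<n} \<inter> {..<a}. (cmod (v i))\<^sup>2)"
    using assms by (intro sum.mono_neutral_right) (auto, meson not_less)
  also have "\<dots> \<le> (\<Sum>i<a. (cmod (v i))\<^sup>2)" by (intro sum_mono2) auto
  finally show ?thesis by (simp add: vnorm_def L2_set_def)
qed

lemma vnorm_cong: "(\<And>i. i < n \<Longrightarrow> u i = v i) \<Longrightarrow> vnorm n u = vnorm n v"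
  unfolding vnorm_def by (intro L2_set_cong) auto

text \<open>An operator bound does not depend on the frame in which the matrix is placed: rows and columns outside of the
 support contribute nothing. This makes the operator norm below independent of the size.\<close>

lemma act_bound_transfer:
  assumes F: "fits a b F" "fits n m F" and c: "0 \<le> c"
    and le: "\<And>u. vnorm a (act F u) \<le> c * vnorm b u"
  shows "vnorm n (act F u) \<le> c * vnorm m u"
proof -
  define u' where "u' i = (if i < m then u i else 0)" for i
  have act: "act F u' = act F u" by (rule ext) (simp add: act_eq[OF F(2)] u'_def)
  have "vnorm n (act F u') \<le> vnorm a (act F u')"
    using F by (intro vnorm_supp_le) (simp add: act_eq[OF F(1)] fitsD[OF F(1)])
  also have "\<dots> \<le> c * vnorm b u'" by (rule le)
  also have "\<dots> \<le> c * vnorm m u'" using c by (intro mult_left_mono vnorm_supp_le) (auto simp: u'_def)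
  also have "vnorm m u' = vnorm m u" by (rule vnorm_cong) (simp add: u'_def)
  finally show ?thesis by (simp add: act)
qed

lemma act_bound_sum: assumes "fits a b F"
  shows "vnorm a (act F u) \<le> (\<Sum>i<a. \<Sum>j<b. cmod (ent F i j)) * vnorm b u"
proof -
  have "vnorm a (act F u) \<le> (\<Sum>i<a. cmod (act F u i))" unfolding vnorm_def by (intro L2_set_le_sum) auto
  also have "\<dots> \<le> (\<Sum>i<a. \<Sum>j<b. cmod (ent F i j) * vnorm b u)"
  proof (rule sum_mono)
    fix i
    have "cmod (act F u i) \<le> (\<Sum>j<b. cmod (ent F i j) * cmod (u j))"
      unfolding act_eq[OF assms] by (rule order_trans[OF norm_sum]) (simp add: norm_mult)
    also have "\<dots> \<le> (\<Sum>j<b. cmod (ent F i j) * vnorm b u)"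
      unfolding vnorm_def by (intro sum_mono mult_left_mono member_le_L2_set) auto
    finally show "cmod (act F u i) \<le> \<dots>" .
  qed
  finally show ?thesis by (simp add: sum_distrib_right)
qed

instantiation fmat :: scaleR
begin
definition scaleR_fmat :: "real \<Rightarrow> fmat \<Rightarrow> fmat" where "scaleR_fmat r F = scl (of_real r) F"
instance ..
end

instantiation fmat :: real_normed_algebra
begin

definition norm_fmat :: "fmat \<Rightarrow> real" where
  "norm_fmat F = Inf {c. 0 \<le> c \<and> (\<forall>n u. fits n n F \<longrightarrow> vnorm n (act F u) \<le> c * vnorm n u)}"

definition dist_fmat :: "fmat \<Rightarrow> fmat \<Rightarrow> real" where "dist_fmat F G = norm (F - G)"
definition sgn_fmat :: "fmat \<Rightarrow> fmat" where "sgn_fmat F = F /\<^sub>R norm F"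
definition uniformity_fmat :: "(fmat \<times> fmat) filter" where
  "uniformity_fmat = (INF e\<in>{0 <..}. principal {(x, y). dist x y < e})"
definition open_fmat :: "fmat set \<Rightarrow> bool" where
  "open_fmat U \<longleftrightarrow> (\<forall>x\<in>U. eventually (\<lambda>(x', y). x' = x \<longrightarrow> y \<in> U) uniformity)"

lemma norm_set_nonempty: "{c. 0 \<le> c \<and> (\<forall>n u. fits n n F \<longrightarrow> vnorm n (act F u) \<le> c * vnorm n u)} \<noteq> {}"
proof -
  obtain m where m: "fits m m F" using ex_fits by blast
  have "0 \<le> (\<Sum>i<m. \<Sum>j<m. cmod (ent F i j))" by (intro sum_nonneg) auto
  then show ?thesis using act_bound_transfer[OF m _ _ act_bound_sum[OF m]] by blast
qed

lemma fmat_normI: assumes "0 \<le> c" "fits a b F" "\<And>u. vnorm a (act F u) \<le> c * vnorm b u"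
  shows "norm F \<le> c"
  unfolding norm_fmat_def using assms act_bound_transfer[OF assms(2) _ assms(1,3)]
  by (intro cInf_lower) (auto intro!: bdd_belowI[of _ 0])

lemma fmat_norm_nonneg: "0 \<le> norm (F :: fmat)"
  unfolding norm_fmat_def by (intro cInf_greatest norm_set_nonempty) auto

lemma fmat_normD: assumes "fits a b F" shows "vnorm a (act F u) \<le> norm F * vnorm b u"
proof -
  obtain n where n: "fits n n F" using ex_fits by blast
  have "vnorm n (act F u) \<le> norm F * vnorm n u" for u
  proof (cases "vnorm n u = 0")
    case True
    obtain c where "c \<in> {c. 0 \<le> c \<and> (\<forall>n u. fits n n F \<longrightarrow> vnorm n (act F u) \<le> c * vnorm n u)}"
      using norm_set_nonempty by blast
    then have "vnorm n (act F u) \<le> c * vnorm n u" using n by auto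
    then show ?thesis using True by simp
  next
    case False
    then have pos: "0 < vnorm n u" by (metis vnorm_nonneg less_eq_real_def)
    have "vnorm n (act F u) / vnorm n u \<le> norm F"
      unfolding norm_fmat_def using n pos
      by (intro cInf_greatest norm_set_nonempty) (auto simp: field_simps)
    then show ?thesis using pos by (simp add: field_simps)
  qed
  then show ?thesis by (rule act_bound_transfer[OF n assms fmat_norm_nonneg])
qed

lemma cmod_ent_le: "cmod (ent F i j) \<le> norm F"
proof -
  obtain n where "fits n n F" using ex_fits by blast
  define N where "N = max n (max (Suc i) (Suc j))"
  have N: "fits N N F" by (rule fits_mono[OF \<open>fits n n F\<close>]) (auto simp: N_def)
  have ij: "i < N" "j < N" by (auto simp: N_def)
  define u where "u k = (if k = j then 1 else 0 :: complex)" for k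
  have "act F u i = (\<Sum>k<N. if k = j then ent F i j else 0)"
    unfolding act_eq[OF N] u_def by (intro sum.cong) auto
  then have "ent F i j = act F u i" using ij by simp
  also have "cmod \<dots> \<le> vnorm N (act F u)" unfolding vnorm_def using ij by (intro member_le_L2_set) auto
  also have "\<dots> \<le> norm F * vnorm N u" by (rule fmat_normD[OF N])
  also have "vnorm N u \<le> 1"
  proof -
    have "(\<Sum>k<N. (cmod (u k))\<^sup>2) = (\<Sum>k<N. if k = j then 1 else 0)"
      unfolding u_def by (intro sum.cong) auto
    then show ?thesis using ij by (simp add: vnorm_def L2_set_def)
  qed
  then have "norm F * vnorm N u \<le> norm F" using fmat_norm_nonneg by (simp add: mult_left_le)
  finally show ?thesis .
qed

lemma vnorm_triangle: "vnorm n (\<lambda>i. u i + v i) \<le> vnorm n u + vnorm n v"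
proof -
  have "vnorm n (\<lambda>i. u i + v i) \<le> L2_set (\<lambda>i. cmod (u i) + cmod (v i)) {..<n}"
    unfolding vnorm_def by (intro L2_set_mono norm_triangle_ineq) auto
  also have "\<dots> \<le> vnorm n u + vnorm n v" unfolding vnorm_def by (rule L2_set_triangle_ineq)
  finally show ?thesis .
qed

lemma vnorm_scale: "vnorm n (\<lambda>i. c * u i) = cmod c * vnorm n u"
  unfolding vnorm_def by (simp add: norm_mult L2_set_right_distrib)

lemma norm_scl: "norm (scl c F) = cmod c * norm F"
proof -
  have le: "norm (scl c F) \<le> cmod c * norm F" for c F
  proof -
    obtain n where n: "fits n n F" using ex_fits by blast
    then have n': "fits n n (scl c F)" by simp
    have "vnorm n (act (scl c F) u) \<le> cmod c * norm F * vnorm n u" for u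
    proof -
      have "act (scl c F) u = (\<lambda>i. c * act F u i)"
        by (rule ext) (simp add: act_eq[OF n] act_eq[OF n'] sum_distrib_left mult.assoc)
      then show ?thesis using fmat_normD[OF n, of u] by (simp add: vnorm_scale mult_left_mono mult.assoc)
    qed
    then show ?thesis by (intro fmat_normI[OF _ n']) (simp_all add: fmat_norm_nonneg)
  qed
  show ?thesis
  proof (cases "c = 0")
    case True then show ?thesis using le[of c F] fmat_norm_nonneg[of "scl c F"] by simp
  next
    case False
    have "F = scl (inverse c) (scl c F)" using False by (auto intro!: fmat_eqI)
    then have "norm F \<le> cmod (inverse c) * norm (scl c F)" using le by metis
    then have "cmod c * norm F \<le> norm (scl c F)" using False by (simp add: norm_divide field_simps)
    with le[of c F] show ?thesis by simp
  qed
qed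

instance
proof
  fix F G H :: fmat and r s :: real
  show "dist F G = norm (F - G)" by (rule dist_fmat_def)
  show "sgn F = F /\<^sub>R norm F" by (rule sgn_fmat_def)
  show "uniformity = (INF e\<in>{0 <..}. principal {(x, y :: fmat). dist x y < e})"
    by (rule uniformity_fmat_def)
  show "open U \<longleftrightarrow> (\<forall>x\<in>U. eventually (\<lambda>(x', y). x' = x \<longrightarrow> y \<in> U) uniformity)" for U :: "fmat set"
    by (rule open_fmat_def)
  show "r *\<^sub>R (F + G) = r *\<^sub>R F + r *\<^sub>R G" "(r + s) *\<^sub>R F = r *\<^sub>R F + s *\<^sub>R F"
    "r *\<^sub>R s *\<^sub>R F = (r * s) *\<^sub>R F" "1 *\<^sub>R F = F"
    by (auto intro!: fmat_eqI simp: scaleR_fmat_def algebra_simps)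
  show "r *\<^sub>R F * G = r *\<^sub>R (F * G)" "F * r *\<^sub>R G = r *\<^sub>R (F * G)"
    by (auto simp: scaleR_fmat_def scl_mult)
  show "norm (r *\<^sub>R F) = \<bar>r\<bar> * norm F" by (simp add: scaleR_fmat_def norm_scl)
  obtain n where n: "fits n n F" using ex_fits by blast
  obtain m where m: "fits m m G" using ex_fits by blast
  define N where "N = max n m"
  have F: "fits N N F" and G: "fits N N G" using n m fits_mono N_def by (meson max.cobounded1 max.cobounded2)+
  have FG: "fits N N (F + G)" "fits N N (F * G)" using F G fits_times by auto
  have "vnorm N (act (F + G) u) \<le> (norm F + norm G) * vnorm N u" for u
  proof -
    have "act (F + G) u = (\<lambda>i. act F u i + act G u i)"
      by (rule ext) (simp add: act_eq[OF F] act_eq[OF G] act_eq[OF FG(1)] algebra_simps sum.distrib)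
    then show ?thesis using vnorm_triangle[of N "act F u" "act G u"] fmat_normD[OF F, of u] fmat_normD[OF G, of u]
      by (simp add: algebra_simps)
  qed
  then show "norm (F + G) \<le> norm F + norm G"
    by (intro fmat_normI[OF _ FG(1)]) (auto simp: fmat_norm_nonneg)
  have "vnorm N (act (F * G) u) \<le> (norm F * norm G) * vnorm N u" for u
  proof -
    have "act (F * G) u i = act F (act G u) i" for i
    proof -
      have "act (F * G) u i = (\<Sum>k<N. \<Sum>l<N. ent F i l * ent G l k * u k)"
        by (simp add: act_eq[OF FG(2)] ent_times[OF F] sum_distrib_right)
      also have "\<dots> = (\<Sum>l<N. \<Sum>k<N. ent F i l * ent G l k * u k)" by (rule sum.swap)
      also have "\<dots> = act F (act G u) i" by (simp add: act_eq[OF F] act_eq[OF G] sum_distrib_left mult.assoc)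
      finally show ?thesis .
    qed
    then have "vnorm N (act (F * G) u) = vnorm N (act F (act G u))" by presburger
    also have "\<dots> \<le> norm F * (norm G * vnorm N u)"
      using fmat_normD[OF F, of "act G u"] fmat_normD[OF G, of u] fmat_norm_nonneg[of F]
      by (meson mult_left_mono order_trans)
    finally show ?thesis by (simp add: mult.assoc)
  qed
  then show "norm (F * G) \<le> norm F * norm G"
    by (intro fmat_normI[OF _ FG(2)]) (auto simp: fmat_norm_nonneg)
  show "norm F = 0 \<longleftrightarrow> F = 0"
  proof
    assume "norm F = 0"
    then show "F = 0" using cmod_ent_le[of F] by (auto intro!: fmat_eqI)
  next
    assume "F = 0"
    then have "F = scl 0 F" by (auto intro!: fmat_eqI)
    then show "norm F = 0" using norm_scl[of 0 F] by simp
  qed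
qed
end

lemma ent_scaleR [simp]: "ent (r *\<^sub>R F) i j = of_real r * ent F i j" by (simp add: scaleR_fmat_def)

lemma star_scaleR [simp]: "star (r *\<^sub>R F) = r *\<^sub>R star F" by (simp add: scaleR_fmat_def)

lemma fits_scaleR [simp]: "fits a b F \<Longrightarrow> fits a b (r *\<^sub>R F)" by (simp add: scaleR_fmat_def)

lemma norm_le_sum_ent: assumes "fits a b F"
  shows "norm F \<le> (\<Sum>i<a. \<Sum>j<b. cmod (ent F i j))"
  by (intro fmat_normI[OF _ assms act_bound_sum[OF assms]] sum_nonneg) auto

text \<open>\<open>\<parallel>F u\<parallel>\<^sup>2 = \<langle>u, F\<^sup>* F u\<rangle> \<le> \<parallel>F\<^sup>* F\<parallel> \<parallel>u\<parallel>\<^sup>2\<close> by the Cauchy-Schwarz inequality. The isometry of \<open>star\<close> and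
 the C*-identity follow from this inequality alone.\<close>

lemma cstar_le: "(norm F)\<^sup>2 \<le> norm (star F * F)"
proof -
  obtain n where F: "fits n n F" using ex_fits by blast
  have F': "fits n n (star F)" "fits n n (star F * F)" using F fits_times[of n n "star F" n F] by auto
  have key: "(vnorm n (act F u))\<^sup>2 \<le> norm (star F * F) * (vnorm n u)\<^sup>2" for u
  proof -
    have "complex_of_real ((vnorm n (act F u))\<^sup>2) = (\<Sum>i<n. cnj (act F u i) * act F u i)"
      by (simp add: vnorm_def L2_set_def sum_nonneg complex_norm_square mult.commute del: of_real_power)
    also have "\<dots> = (\<Sum>i<n. \<Sum>j<n. cnj (ent F i j) * cnj (u j) * act F u i)"
      by (subst (1) act_eq[OF F]) (simp add: sum_distrib_right)
    also have "\<dots> = (\<Sum>j<n. \<Sum>i<n. cnj (ent F i j) * cnj (u j) * act F u i)" by (rule sum.swap)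
    also have "\<dots> = (\<Sum>j<n. cnj (u j) * act (star F * F) u j)"
    proof (rule sum.cong[OF refl])
      fix j
      have "act (star F * F) u j = (\<Sum>k<n. \<Sum>i<n. cnj (ent F i j) * ent F i k * u k)"
        by (simp add: act_eq[OF F'(2)] ent_times[OF F'(1)] sum_distrib_right)
      also have "\<dots> = (\<Sum>i<n. \<Sum>k<n. cnj (ent F i j) * ent F i k * u k)" by (rule sum.swap)
      also have "\<dots> = (\<Sum>i<n. cnj (ent F i j) * act F u i)"
        by (simp add: act_eq[OF F] sum_distrib_left mult.assoc)
      finally show "(\<Sum>i<n. cnj (ent F i j) * cnj (u j) * act F u i) = cnj (u j) * act (star F * F) u j"
        by (simp add: sum_distrib_left mult_ac)
    qed
    finally have "(vnorm n (act F u))\<^sup>2 = cmod (\<Sum>j<n. cnj (u j) * act (star F * F) u j)"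
      by (metis norm_of_real abs_of_nonneg zero_le_power2)
    also have "\<dots> \<le> (\<Sum>j<n. \<bar>cmod (u j)\<bar> * \<bar>cmod (act (star F * F) u j)\<bar>)"
      by (rule order_trans[OF norm_sum]) (simp add: norm_mult)
    also have "\<dots> \<le> vnorm n u * vnorm n (act (star F * F) u)"
      unfolding vnorm_def by (rule L2_set_mult_ineq)
    also have "\<dots> \<le> vnorm n u * (norm (star F * F) * vnorm n u)"
      by (intro mult_left_mono fmat_normD F') auto
    finally show ?thesis by (simp add: power2_eq_square mult_ac)
  qed
  have "vnorm n (act F u) \<le> sqrt (norm (star F * F)) * vnorm n u" for u
    using real_sqrt_le_mono[OF key[of u]] by (simp add: real_sqrt_mult)
  then have "norm F \<le> sqrt (norm (star F * F))" by (intro fmat_normI[OF _ F]) auto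
  then show ?thesis by (metis norm_ge_zero power_mono real_sqrt_pow2)
qed

lemma norm_star_le: "norm F \<le> norm (star F)"
proof (cases "norm F = 0")
  case False
  then have "norm F > 0" by simp
  have "(norm F)\<^sup>2 \<le> norm (star F) * norm F" using cstar_le[of F] norm_mult_ineq order_trans by blast
  then show ?thesis using \<open>norm F > 0\<close> by (simp add: power2_eq_square)
qed simp

lemma norm_star [simp]: "norm (star F) = norm F"
  using norm_star_le[of F] norm_star_le[of "star F"] by simp

lemma norm_star_times: "norm (star F * F) = (norm F)\<^sup>2"
  using cstar_le[of F] norm_mult_ineq[of "star F" F] by (simp add: power2_eq_square)

lemma norm_proj_le_1: assumes "e * e = e" "star e = e" shows "norm e \<le> 1"
proof -
  have "(norm e)\<^sup>2 = norm e" using norm_star_times[of e] assms by simp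
  then show ?thesis by (auto simp: power2_eq_square)
qed

lemma norm_partial_isometry_le_1: assumes "e * e = e" "star e = e" "star v * v = e" shows "norm v \<le> 1"
proof -
  have "(norm v)\<^sup>2 \<le> 1" using norm_star_times[of v] norm_proj_le_1[OF assms(1,2)] assms(3) by simp
  then show ?thesis by (simp add: abs_square_le_1)
qed

lemma cstar_zero: "star X * X = 0 \<Longrightarrow> X = 0"
  using norm_star_times[of X] by simp

text \<open>\<open>\<parallel>W e - W\<parallel>\<^sup>2 = \<parallel>(W e - W)\<^sup>* (W e - W)\<parallel> = 0\<close> for the projection \<open>e = W\<^sup>* W\<close>.\<close>

lemma partial_isometry_absorb:
  assumes "star W * W * (star W * W) = star W * W"
  shows "W * (star W * W) = W"
proof -
  define e where "e = star W * W"
  have ee: "e * e = e" "star e = e" using assms by (simp_all add: e_def)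
  have "star (W * e - W) * (W * e - W) = e * e * e - e * e - e * e + e"
    using ee(2) by (simp add: algebra_simps) (simp add: e_def mult.assoc)
  also have "\<dots> = 0" using ee(1) by simp
  finally have "W * e - W = 0" by (rule cstar_zero)
  then show ?thesis by (simp add: e_def)
qed

section \<open>Complex matrices as elements of this ring\<close>

lift_definition to_fm :: "complex mat \<Rightarrow> fmat" is
  "\<lambda>M i j. if i < dim_row M \<and> j < dim_col M then M $$ (i, j) else 0"
proof -
  fix M :: "complex mat"
  show "\<exists>n. \<forall>i j. n \<le> i \<or> n \<le> j \<longrightarrow> (if i < dim_row M \<and> j < dim_col M then M $$ (i, j) else 0) = 0"
    by (intro exI[of _ "max (dim_row M) (dim_col M)"]) auto
qed

definition of_fm :: "nat \<Rightarrow> nat \<Rightarrow> fmat \<Rightarrow> complex mat" where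
  "of_fm a b F = Matrix.mat a b (\<lambda>(i, j). ent F i j)"

lemma ent_to_fm: "ent (to_fm M) i j = (if i < dim_row M \<and> j < dim_col M then M $$ (i, j) else 0)"
  by (simp add: to_fm.rep_eq)

lemma ent_to_fm' [simp]: "M \<in> carrier_mat a b \<Longrightarrow> ent (to_fm M) i j = (if i < a \<and> j < b then M $$ (i, j) else 0)"
  using carrier_matD[of M a b] by (simp add: ent_to_fm)

lemma fits_to_fm: "M \<in> carrier_mat a b \<Longrightarrow> fits a b (to_fm M)"
  by (auto simp: fits_def)

lemma of_fm_carrier [simp]: "of_fm a b F \<in> carrier_mat a b" by (simp add: of_fm_def)

lemma of_fm_index [simp]: "i < a \<Longrightarrow> j < b \<Longrightarrow> of_fm a b F $$ (i, j) = ent F i j" by (simp add: of_fm_def)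

lemma to_fm_of_fm [simp]: "fits a b F \<Longrightarrow> to_fm (of_fm a b F) = F"
  by (rule fmat_eqI) (auto simp: ent_to_fm'[OF of_fm_carrier] fits_def not_less)

lemma of_fm_to_fm: "A \<in> carrier_mat a b \<Longrightarrow> of_fm a b (to_fm A) = A"
  by (intro eq_matI) (auto simp: of_fm_def)

lemma to_fm_inject: "A \<in> carrier_mat a b \<Longrightarrow> B \<in> carrier_mat a b \<Longrightarrow> to_fm A = to_fm B \<longleftrightarrow> A = B"
  by (metis of_fm_to_fm)

lemma to_fm_mult: assumes "A \<in> carrier_mat a b" "B \<in> carrier_mat b c"
  shows "to_fm (A * B) = to_fm A * to_fm B"
proof (rule fmat_eqI)
  fix i j
  have AB: "A * B \<in> carrier_mat a c" using assms by simp
  show "ent (to_fm (A * B)) i j = ent (to_fm A * to_fm B) i j"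
    unfolding ent_times[OF fits_to_fm[OF assms(1)]] ent_to_fm'[OF AB]
    using assms by (auto simp: scalar_prod_def atLeast0LessThan intro!: sum.cong)
qed

lemma to_fm_add: "A \<in> carrier_mat a b \<Longrightarrow> B \<in> carrier_mat a b \<Longrightarrow> to_fm (A + B) = to_fm A + to_fm B"
  by (rule fmat_eqI) (auto simp: ent_to_fm)

lemma to_fm_smult: "to_fm (c \<cdot>\<^sub>m A) = scl c (to_fm A)"
  by (rule fmat_eqI) (auto simp: ent_to_fm)

lemma to_fm_zero [simp]: "to_fm (0\<^sub>m a b) = 0"
  by (rule fmat_eqI) (auto simp: ent_to_fm)

lemma mat_adjoint_index: assumes "A \<in> carrier_mat a b" "i < b" "j < a"
  shows "mat_adjoint A $$ (i, j) = cnj (A $$ (j, i))"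
  using assms unfolding mat_adjoint_def by (simp add: mat_of_rows_def)

lemma mat_adjoint_carrier: assumes "A \<in> carrier_mat a b" shows "mat_adjoint A \<in> carrier_mat b a"
  using assms unfolding mat_adjoint_def by auto

lemma to_fm_adjoint: "A \<in> carrier_mat a b \<Longrightarrow> to_fm (mat_adjoint A) = star (to_fm A)"
  using mat_adjoint_carrier[of A a b]
  by (intro fmat_eqI) (auto simp: mat_adjoint_index ent_to_fm'[of "mat_adjoint A" b a])

lemma vec_l2_eq_nv: "vec_l2 v = vnorm (dim_vec v) (\<lambda>i. v $ i)"
  by (simp add: vec_l2_def vnorm_def L2_set_def)

lemma mult_mat_vec_act: assumes "M \<in> carrier_mat a b" "v \<in> carrier_vec b"
  shows "vec_l2 (M *\<^sub>v v) = vnorm a (act (to_fm M) (\<lambda>i. v $ i))"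
proof -
  have "vec_l2 (M *\<^sub>v v) = vnorm a (\<lambda>i. (M *\<^sub>v v) $ i)" using assms by (simp add: vec_l2_eq_nv)
  also have "\<dots> = vnorm a (act (to_fm M) (\<lambda>i. v $ i))"
    using assms by (intro vnorm_cong)
      (auto simp: act_eq[OF fits_to_fm[OF assms(1)]] scalar_prod_def atLeast0LessThan intro!: sum.cong)
  finally show ?thesis .
qed

lemma mat_opnorm_eq: "mat_opnorm M = norm (to_fm M)"
proof -
  define a b where "a = dim_row M" and "b = dim_col M"
  have M: "M \<in> carrier_mat a b" by (auto simp: a_def b_def)
  let ?S = "{v \<in> carrier_vec (dim_col M). vec_l2 v \<le> 1}"
  have le: "vec_l2 (M *\<^sub>v v) \<le> norm (to_fm M)" if "v \<in> ?S" for v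
  proof -
    have v: "v \<in> carrier_vec b" "vec_l2 v \<le> 1" using that by (auto simp: b_def)
    have "vec_l2 (M *\<^sub>v v) \<le> norm (to_fm M) * vnorm b (\<lambda>i. v $ i)"
      unfolding mult_mat_vec_act[OF M v(1)] by (rule fmat_normD[OF fits_to_fm[OF M]])
    also have "\<dots> \<le> norm (to_fm M)" using v by (simp add: vec_l2_eq_nv mult_left_le)
    finally show ?thesis .
  qed
  have ne: "0\<^sub>v b \<in> ?S" by (auto simp: b_def vec_l2_def)
  have bdd: "bdd_above ((\<lambda>v. vec_l2 (M *\<^sub>v v)) ` ?S)" using le by (intro bdd_aboveI2)
  have "mat_opnorm M \<le> norm (to_fm M)" unfolding mat_opnorm_def using ne le by (intro cSUP_least) blast+
  moreover have "norm (to_fm M) \<le> mat_opnorm M"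
  proof (rule fmat_normI[OF _ fits_to_fm[OF M]])
    have "0 \<le> vec_l2 (M *\<^sub>v 0\<^sub>v b)" by (simp add: vec_l2_eq_nv)
    also have "\<dots> \<le> mat_opnorm M" unfolding mat_opnorm_def by (rule cSUP_upper[OF ne bdd])
    finally show "0 \<le> mat_opnorm M" .
    fix u
    show "vnorm a (act (to_fm M) u) \<le> mat_opnorm M * vnorm b u"
    proof (cases "vnorm b u = 0")
      case True then show ?thesis using fmat_normD[OF fits_to_fm[OF M], of u] by simp
    next
      case False
      then have pos: "0 < vnorm b u" by (metis vnorm_nonneg less_eq_real_def)
      define v where "v = Matrix.vec b (\<lambda>k. of_real (inverse (vnorm b u)) * u k)"
      have v: "v \<in> carrier_vec b" by (simp add: v_def)
      have vv: "vnorm b (\<lambda>i. v $ i) = vnorm b (\<lambda>k. of_real (inverse (vnorm b u)) * u k)"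
        by (rule vnorm_cong) (simp add: v_def)
      then have "vec_l2 v = 1" using pos v by (simp add: vec_l2_eq_nv vnorm_scale norm_inverse)
      then have "v \<in> ?S" using v by (simp add: b_def)
      then have "vec_l2 (M *\<^sub>v v) \<le> mat_opnorm M" unfolding mat_opnorm_def by (rule cSUP_upper[OF _ bdd])
      moreover have "act (to_fm M) (\<lambda>i. v $ i) = (\<lambda>i. of_real (inverse (vnorm b u)) * act (to_fm M) u i)"
        by (rule ext) (simp add: act_eq[OF fits_to_fm[OF M]] v_def sum_distrib_left mult_ac)
      ultimately have "inverse (vnorm b u) * vnorm a (act (to_fm M) u) \<le> mat_opnorm M"
        using pos by (simp add: mult_mat_vec_act[OF M v] vnorm_scale norm_inverse)
      then show ?thesis using pos by (simp add: field_simps)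
    qed
  qed
  ultimately show ?thesis by simp
qed

section \<open>Coordinate inclusions and block diagonal matrices\<close>

text \<open>The isometry that includes \<open>\<complex>\<^sup>r\<close> as the coordinates \<open>s, \<dots>, s + r - 1\<close>.\<close>

lift_definition blk :: "nat \<Rightarrow> nat \<Rightarrow> fmat" is "\<lambda>r s i j. if j < r \<and> i = s + j then 1 else 0"
proof -
  fix r s :: nat
  show "\<exists>n. \<forall>i j. n \<le> i \<or> n \<le> j \<longrightarrow> (if j < r \<and> i = s + j then 1 else 0 :: complex) = 0"
    by (intro exI[of _ "s + r"]) auto
qed

lemma ent_blk [simp]: "ent (blk r s) i j = (if j < r \<and> i = s + j then 1 else 0)" by transfer simp

lemma fits_blk: "s + r \<le> R \<Longrightarrow> fits R r (blk r s)" by (auto simp: fits_def)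

lemma star_blk_blk: "star (blk r s) * blk r s = idm r"
proof (rule fmat_eqI)
  fix i j
  have "fits r (s + r) (star (blk r s))" by (simp add: fits_blk)
  then have "ent (star (blk r s) * blk r s) i j = (\<Sum>k<s+r. if k = s + i then (if i = j \<and> i < r then 1 else 0) else 0)"
    unfolding ent_times[OF \<open>fits r (s + r) (star (blk r s))\<close>] by (intro sum.cong) auto
  then show "ent (star (blk r s) * blk r s) i j = ent (idm r) i j" by auto
qed

lemma star_blk_blk_disjoint: assumes "s + r \<le> s' \<or> s' + r' \<le> s"
  shows "star (blk r s) * blk r' s' = 0"
proof (rule fmat_eqI)
  fix i j
  have F: "fits r (s + r) (star (blk r s))" by (simp add: fits_blk)
  show "ent (star (blk r s) * blk r' s') i j = ent 0 i j"
    unfolding ent_times[OF F] using assms by (auto intro!: sum.neutral)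
qed

lemma ent_blk_conj: assumes "fits r r F"
  shows "ent (blk r s * F * star (blk r s)) i j = (if s \<le> i \<and> s \<le> j then ent F (i - s) (j - s) else 0)"
proof -
  have B: "fits (s + r) r (blk r s)" by (simp add: fits_blk)
  have B': "fits r (s + r) (star (blk r s))" by (simp add: fits_blk)
  have 1: "ent (blk r s * F) i j = (if s \<le> i then ent F (i - s) j else 0)" for i j
  proof -
    have "ent (blk r s * F) i j = (\<Sum>k<r. if k = i - s then (if s \<le> i then ent F (i - s) j else 0) else 0)"
      unfolding ent_times[OF B] by (intro sum.cong) auto
    then show ?thesis using assms by (auto simp: fits_def)
  qed
  have 2: "fits (s + r) r (blk r s * F)" by (rule fits_times[OF B assms])
  have "ent (blk r s * F * star (blk r s)) i j
    = (\<Sum>k<r. if k = j - s then (if s \<le> i \<and> s \<le> j then ent F (i - s) (j - s) else 0) else 0)"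
    unfolding ent_times[OF 2] 1 by (intro sum.cong) auto
  then show ?thesis using assms by (auto simp: fits_def)
qed

lemma to_fm_diag_block: 
  assumes "\<And>s. s < M \<Longrightarrow> F s \<in> carrier_mat r r"
  shows "to_fm (diag_block_mat (map F [0..<M])) = (\<Sum>s<M. blk r (s * r) * to_fm (F s) * star (blk r (s * r)))
    \<and> diag_block_mat (map F [0..<M]) \<in> carrier_mat (M * r) (M * r)"
  using assms
proof (induction M)
  case 0
  then show ?case by (auto intro!: fmat_eqI simp: ent_to_fm)
next
  case (Suc M)
  let ?D = "diag_block_mat (map F [0..<M])"
  have IH: "to_fm ?D = (\<Sum>s<M. blk r (s * r) * to_fm (F s) * star (blk r (s * r)))"
    and D: "?D \<in> carrier_mat (M * r) (M * r)" using Suc by auto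
  have FM: "F M \<in> carrier_mat r r" using Suc.prems by simp
  have eq: "diag_block_mat (map F [0..<Suc M]) =
      four_block_mat ?D (0\<^sub>m (M * r) r) (0\<^sub>m r (M * r)) (F M)"
    using D FM by (simp add: diag_block_mat_append Let_def del: diag_block_mat.simps(2))
  have E: "four_block_mat ?D (0\<^sub>m (M * r) r) (0\<^sub>m r (M * r)) (F M) \<in> carrier_mat (Suc M * r) (Suc M * r)"
    using D FM by (auto simp: add.commute)
  have "to_fm (four_block_mat ?D (0\<^sub>m (M * r) r) (0\<^sub>m r (M * r)) (F M))
     = to_fm ?D + blk r (M * r) * to_fm (F M) * star (blk r (M * r))"
    using D FM by (intro fmat_eqI) (auto simp: ent_to_fm'[OF E] ent_to_fm'[OF D] ent_to_fm'[OF FM] ent_blk_conj[OF fits_to_fm[OF FM]])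
  then show ?case using E IH eq by (simp del: upt_Suc)
qed

section \<open>Continuity of matrix valued maps\<close>

lemma continuous_map_tendsto:
  "continuous_map X euclidean f \<longleftrightarrow> (\<forall>x\<in>topspace X. (f \<longlongrightarrow> f x) (atin X x))"
  by (simp add: continuous_map_atin)

lemma eventually_atin_topspace: "eventually (\<lambda>x. x \<in> topspace X) (atin X x)"
  unfolding eventually_atin by (metis Diff_iff openin_topspace)

lemma continuous_map_fmat:
  fixes F G :: "'x \<Rightarrow> fmat"
  assumes "continuous_map X euclidean F"
  shows "continuous_map X euclidean G \<Longrightarrow> continuous_map X euclidean (\<lambda>x. F x + G x)"
    and "continuous_map X euclidean G \<Longrightarrow> continuous_map X euclidean (\<lambda>x. F x - G x)"
    and "continuous_map X euclidean G \<Longrightarrow> continuous_map X euclidean (\<lambda>x. F x * G x)"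
    and "continuous_map X euclidean r \<Longrightarrow> continuous_map X euclidean (\<lambda>x. r x *\<^sub>R F x)"
    and "continuous_map X euclidean (\<lambda>x. norm (F x))"
    and "continuous_map X euclidean (\<lambda>x. star (F x))"
    and "continuous_map X euclidean (\<lambda>x. ent (F x) i j)"
proof -
  have st: "((\<lambda>x. star (F x)) \<longlongrightarrow> star l) A" if "(F \<longlongrightarrow> l) A" for l A
    using that unfolding tendsto_iff dist_norm by (simp flip: star_minus)
  have en: "((\<lambda>x. ent (F x) i j) \<longlongrightarrow> ent l i j) A" if "(F \<longlongrightarrow> l) A" for l A
    by (rule metric_tendsto_imp_tendsto[OF that])
       (auto simp: dist_norm simp flip: ent_simps(4) intro!: always_eventually cmod_ent_le)
  show "continuous_map X euclidean G \<Longrightarrow> continuous_map X euclidean (\<lambda>x. F x + G x)"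
    "continuous_map X euclidean G \<Longrightarrow> continuous_map X euclidean (\<lambda>x. F x - G x)"
    "continuous_map X euclidean G \<Longrightarrow> continuous_map X euclidean (\<lambda>x. F x * G x)"
    "continuous_map X euclidean r \<Longrightarrow> continuous_map X euclidean (\<lambda>x. r x *\<^sub>R F x)"
    "continuous_map X euclidean (\<lambda>x. norm (F x))"
    "continuous_map X euclidean (\<lambda>x. star (F x))"
    "continuous_map X euclidean (\<lambda>x. ent (F x) i j)"
    using assms st en unfolding continuous_map_tendsto by (auto intro!: tendsto_intros)
qed

lemma continuous_map_fmat_sum:
  fixes F :: "'i \<Rightarrow> 'x \<Rightarrow> fmat"
  assumes "\<And>i. i \<in> I \<Longrightarrow> continuous_map X euclidean (F i)"
  shows "continuous_map X euclidean (\<lambda>x. \<Sum>i\<in>I. F i x)"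
  using assms unfolding continuous_map_tendsto by (auto intro!: tendsto_sum)

lemma continuous_map_fmat_entries:
  assumes fits: "\<And>x. x \<in> topspace X \<Longrightarrow> fits a b (F x)"
    and cont: "\<And>i j. i < a \<Longrightarrow> j < b \<Longrightarrow> continuous_map X euclidean (\<lambda>x. ent (F x) i j)"
  shows "continuous_map X euclidean F"
  unfolding continuous_map_tendsto
proof
  fix x assume x: "x \<in> topspace X"
  have "((\<lambda>y. \<Sum>i<a. \<Sum>j<b. cmod (ent (F y) i j - ent (F x) i j)) \<longlongrightarrow>
      (\<Sum>i<a. \<Sum>j<b. cmod (ent (F x) i j - ent (F x) i j))) (atin X x)"
    using cont x unfolding continuous_map_tendsto by (intro tendsto_intros) auto
  then have lim: "((\<lambda>y. \<Sum>i<a. \<Sum>j<b. cmod (ent (F y) i j - ent (F x) i j)) \<longlongrightarrow> 0) (atin X x)" by simp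
  have "eventually (\<lambda>y. dist (F y) (F x) \<le> dist (\<Sum>i<a. \<Sum>j<b. cmod (ent (F y) i j - ent (F x) i j)) 0) (atin X x)"
    using eventually_atin_topspace
  proof eventually_elim
    case (elim y)
    have "norm (F y - F x) \<le> (\<Sum>i<a. \<Sum>j<b. cmod (ent (F y - F x) i j))"
      by (intro norm_le_sum_ent fits_simps fits elim x)
    also have "\<dots> = \<bar>\<dots>\<bar>" by (intro abs_of_nonneg[symmetric] sum_nonneg) auto
    finally show ?case by (simp add: dist_norm)
  qed
  then show "(F \<longlongrightarrow> F x) (atin X x)" by (rule metric_tendsto_imp_tendsto[OF lim])
qed

lemma cont_mat_iff:
  "cont_mat X a b f \<longleftrightarrow> (\<forall>x\<in>topspace X. f x \<in> carrier_mat a b) \<and> continuous_map X euclidean (\<lambda>x. to_fm (f x))"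
  (is "?L \<longleftrightarrow> ?R")
proof
  assume L: ?L
  have "continuous_map X euclidean (\<lambda>x. to_fm (f x))"
  proof (rule continuous_map_fmat_entries)
    show "fits a b (to_fm (f x))" if "x \<in> topspace X" for x
      using L that by (auto simp: cont_mat_def intro: fits_to_fm)
    show "continuous_map X euclidean (\<lambda>x. ent (to_fm (f x)) i j)" if "i < a" "j < b" for i j
    proof (rule continuous_map_eq)
      show "continuous_map X euclidean (\<lambda>x. f x $$ (i, j))" using L that by (auto simp: cont_mat_def)
      show "f x $$ (i, j) = ent (to_fm (f x)) i j" if "x \<in> topspace X" for x
        using L that \<open>i < a\<close> \<open>j < b\<close> by (subst ent_to_fm'[of _ a b]) (auto simp: cont_mat_def)
    qed
  qed
  then show ?R using L by (auto simp: cont_mat_def)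
next
  assume R: ?R
  have "continuous_map X euclidean (\<lambda>x. f x $$ (i, j))" if "i < a" "j < b" for i j
  proof (rule continuous_map_eq)
    show "continuous_map X euclidean (\<lambda>x. ent (to_fm (f x)) i j)" using R continuous_map_fmat(7) by blast
    show "ent (to_fm (f x)) i j = f x $$ (i, j)" if "x \<in> topspace X" for x
      using R that \<open>i < a\<close> \<open>j < b\<close> by (subst ent_to_fm'[of _ a b]) auto
  qed
  then show ?L using R by (auto simp: cont_mat_def)
qed

context vec_space
begin

section \<open>Ranks of equivalent projections\<close>

lemma rank_le_of_cols_subset:
  assumes A: "A \<in> carrier_mat n nc" and M: "M \<in> carrier_mat n m" and sub: "set (cols M) \<subseteq> span (set (cols A))"
  shows "rank M \<le> rank A"
proof -
  have cA: "set (cols A) \<subseteq> carrier_vec n" using A cols_dim by blast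
  have cM: "set (cols M) \<subseteq> carrier_vec n" using M cols_dim by blast
  have span: "span (set (cols M)) \<subseteq> span (set (cols A))"
    using span_subsetI[OF cA sub] .
  have "subspace class_ring (span (set (cols M))) (vs (span (set (cols A))))"
    by (rule nested_subspaces[OF span_is_subspace[OF cA] span_is_subspace[OF cM] span])
  then show ?thesis unfolding rank_def
    using vectorspace.subspace_dim[OF subspace_is_vs[OF span_is_subspace[OF cA]] _ fin_dim_span_cols[OF A]]
      fin_dim_span_cols[OF M] by simp
qed

lemma rank_mult_le_left:
  assumes A: "A \<in> carrier_mat n nc" and B: "B \<in> carrier_mat nc m"
  shows "rank (A * B) \<le> rank A"
proof (rule rank_le_of_cols_subset[OF A])
  show "A * B \<in> carrier_mat n m" using A B by simp
  show "set (cols (A * B)) \<subseteq> span (set (cols A))"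
  proof
    fix x assume "x \<in> set (cols (A * B))"
    then obtain j where j: "j < m" "x = col (A * B) j" using A B by (auto simp: cols_def)
    then have "x = A *\<^sub>v col B j" using A B by (auto intro!: eq_vecI)
    moreover have "col B j \<in> carrier_vec nc" using B j by auto
    ultimately have "x \<in> col_space A" using A by (auto simp: col_space_eq[OF A])
    then show "x \<in> span (set (cols A))" by (simp add: col_space_def)
  qed
qed

text \<open>The columns of \<open>B\<close> are a basis of the column space of \<open>A\<close>, chosen among the columns of \<open>A\<close>.\<close>

lemma rank_factorization:
  assumes A: "A \<in> carrier_mat n nc"
  shows "\<exists>B C. B \<in> carrier_mat n (rank A) \<and> C \<in> carrier_mat (rank A) nc \<and> A = B * C"
proof -
  let ?S = "set (cols A)"
  have cA: "?S \<subseteq> carrier_vec n" using A cols_dim by blast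
  obtain U where U: "maximal U (\<lambda>T. T \<subseteq> ?S \<and> lin_indpt T)"
    using maximal_exists_superset[of ?S "\<lambda>T. T \<subseteq> ?S \<and> lin_indpt T" "{}"] by (auto simp: lin_dep_def)
  then have US: "U \<subseteq> ?S" and li: "lin_indpt U" by (auto simp: maximal_def)
  have cU: "U \<subseteq> carrier_vec n" using US cA by blast
  have sub: "?S \<subseteq> span U"
  proof
    fix s assume s: "s \<in> ?S"
    show "s \<in> span U"
    proof (rule ccontr)
      assume ns: "s \<notin> span U"
      have "lin_indpt (U \<union> {s})" using lin_dep_iff_in_span[OF cU li, of s] ns s cA span_mem[OF cU, of s] by auto
      then have "U \<union> {s} = U" using U s US unfolding maximal_def by (metis Un_subset_iff Un_upper1 empty_subsetI insert_subset)
      then show False using ns span_mem[OF cU, of s] by auto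
    qed
  qed
  have "finite U" using US finite_subset by blast
  then obtain us where us: "set us = U" "distinct us" using finite_distinct_list by blast
  have rk: "rank A = length us" using rank_card_indpt[OF A U] us distinct_card by metis
  define B where "B = mat_of_cols n us"
  have B: "B \<in> carrier_mat n (rank A)" by (simp add: B_def rk)
  have "span U = col_space B" using us cU by (simp add: col_space_def B_def)
  then have "\<forall>j<nc. \<exists>x\<in>carrier_vec (rank A). B *\<^sub>v x = col A j"
    using sub A B unfolding col_space_eq[OF B] by (auto simp: cols_def image_subset_iff)
  then obtain x where x: "\<And>j. j < nc \<Longrightarrow> x j \<in> carrier_vec (rank A) \<and> B *\<^sub>v x j = col A j" by metis
  define C where "C = mat_of_cols (rank A) (map x [0..<nc])"
  have C: "C \<in> carrier_mat (rank A) nc"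
    using mat_of_cols_carrier(1)[of "rank A" "map x [0..<nc]"] by (simp add: C_def)
  have "A = B * C"
  proof (rule mat_col_eqI)
    fix j assume "j < dim_col (B * C)"
    then have j: "j < nc" using C by simp
    have "col C j = x j" using x[OF j] j unfolding C_def by (subst col_mat_of_cols) auto
    then have "col (B * C) j = B *\<^sub>v x j" using B C j by (auto intro!: eq_vecI)
    then show "col A j = col (B * C) j" using x[OF j] by simp
  qed (use A B C in auto)
  then show ?thesis using B C by blast
qed

end

lemma rank_conj_le:
  fixes e :: "complex mat"
  assumes v: "v \<in> carrier_mat a b" and e: "e \<in> carrier_mat b b" and w: "w \<in> carrier_mat b a"
  shows "vec_space.rank a (v * e * w) \<le> vec_space.rank b e"
proof -
  interpret Va: vec_space "TYPE(complex)" a .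
  interpret Vb: vec_space "TYPE(complex)" b .
  obtain B C where B: "B \<in> carrier_mat b (Vb.rank e)" and C: "C \<in> carrier_mat (Vb.rank e) b" and eq: "e = B * C"
    using Vb.rank_factorization[OF e] by blast
  have "v * e * w = (v * B) * (C * w)"
    unfolding eq assoc_mult_mat[OF v B C, symmetric]
    by (rule assoc_mult_mat[OF mult_carrier_mat[OF v B] C w])
  then have "Va.rank (v * e * w) \<le> Va.rank (v * B)"
    using Va.rank_mult_le_left[of "v * B" "Vb.rank e" "C * w" a] v B C w by simp
  also have "\<dots> \<le> Vb.rank e" using Va.rank_le_nc[of "v * B"] v B by simp
  finally show ?thesis .
qed

lemma to_fm_mult3:
  assumes "A \<in> carrier_mat a b" "B \<in> carrier_mat b c" "C \<in> carrier_mat c d"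
  shows "to_fm (A * B * C) = to_fm A * to_fm B * to_fm C"
  using to_fm_mult[OF mult_carrier_mat[OF assms(1,2)] assms(3)] to_fm_mult[OF assms(1,2)] by simp

text \<open>Murray-von Neumann equivalent projections, even of different matrix sizes, have the same rank: each is
 obtained from the other one by multiplication from both sides.\<close>

lemma rank_of_fm_equivalent:
  assumes w: "fits a b w" and e: "fits b b e" "star w * w = e" "e * e = e" and q: "fits a a q" "w * star w = q" "q * q = q"
  shows "vec_space.rank a (of_fm a a q) = vec_space.rank b (of_fm b b e)"
proof -
  have w': "fits b a (star w)" using w by simp
  have eq1: "of_fm a a q = of_fm a b w * of_fm b b e * of_fm b a (star w)"
  proof -
    have "to_fm (of_fm a b w * of_fm b b e * of_fm b a (star w)) = w * e * star w"
      using w e w' by (simp add: to_fm_mult3[of _ a b _ b _ a])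
    also have "\<dots> = (w * star w) * (w * star w)" unfolding e(2)[symmetric] by (simp only: mult.assoc)
    also have "\<dots> = q" using q by simp
    also have "\<dots> = to_fm (of_fm a a q)" using q by simp
    finally show ?thesis 
      using to_fm_inject[OF mult_carrier_mat[OF mult_carrier_mat[OF of_fm_carrier of_fm_carrier] of_fm_carrier] of_fm_carrier] by simp
  qed
  have eq2: "of_fm b b e = of_fm b a (star w) * of_fm a a q * of_fm a b w"
  proof -
    have "to_fm (of_fm b a (star w) * of_fm a a q * of_fm a b w) = star w * q * w"
      using w q w' by (simp add: to_fm_mult3[of _ b a _ a _ b])
    also have "\<dots> = (star w * w) * (star w * w)" unfolding q(2)[symmetric] by (simp only: mult.assoc)
    also have "\<dots> = e" using e by simp
    also have "\<dots> = to_fm (of_fm b b e)" using e by simp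
    finally show ?thesis 
      using to_fm_inject[OF mult_carrier_mat[OF mult_carrier_mat[OF of_fm_carrier of_fm_carrier] of_fm_carrier] of_fm_carrier] by simp
  qed
  have "vec_space.rank a (of_fm a a q) \<le> vec_space.rank b (of_fm b b e)"
    using rank_conj_le[of "of_fm a b w" a b "of_fm b b e" "of_fm b a (star w)"] unfolding eq1[symmetric] by simp
  moreover have "vec_space.rank b (of_fm b b e) \<le> vec_space.rank a (of_fm a a q)"
    using rank_conj_le[of "of_fm b a (star w)" b a "of_fm a a q" "of_fm a b w"] unfolding eq2[symmetric] by simp
  ultimately show ?thesis by simp
qed

section \<open>Polar parts by Newton iteration\<close>

lemma tendsto_star: "(F \<longlongrightarrow> l) A \<Longrightarrow> ((\<lambda>x. star (F x)) \<longlongrightarrow> star l) A"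
  unfolding tendsto_iff dist_norm by (simp flip: star_minus)

lemma fmat_Cauchy_convergent:
  assumes fits: "\<And>n. fits a b (s n)" and C: "Cauchy s"
  shows "\<exists>l. fits a b l \<and> s \<longlonglongrightarrow> l"
proof -
  have "\<exists>z. (\<lambda>n. ent (s n) i j) \<longlonglongrightarrow> z" for i j
  proof -
    have "Cauchy (\<lambda>n. ent (s n) i j)"
      unfolding Cauchy_def dist_norm
    proof (intro allI impI)
      fix \<epsilon> :: real assume "0 < \<epsilon>"
      then obtain M where "\<forall>m\<ge>M. \<forall>n\<ge>M. norm (s m - s n) < \<epsilon>" using C unfolding Cauchy_def dist_norm by blast
      then show "\<exists>M. \<forall>m\<ge>M. \<forall>n\<ge>M. cmod (ent (s m) i j - ent (s n) i j) < \<epsilon>"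
        by (metis cmod_ent_le ent_simps(4) order_le_less_trans)
    qed
    then show ?thesis using Cauchy_convergent convergent_def by blast
  qed
  then obtain z where z: "\<And>i j. (\<lambda>n. ent (s n) i j) \<longlonglongrightarrow> z i j" by metis
  define l where "l = to_fm (Matrix.mat a b (\<lambda>(i, j). z i j))"
  have fl: "fits a b l" unfolding l_def by (intro fits_to_fm) simp
  have el: "ent l i j = z i j" if "i < a" "j < b" for i j using that by (simp add: l_def ent_to_fm)
  have "(\<lambda>n. \<Sum>i<a. \<Sum>j<b. cmod (ent (s n) i j - z i j)) \<longlonglongrightarrow> (\<Sum>i<a. \<Sum>j<b. cmod (z i j - z i j))"
    by (intro tendsto_intros z)
  then have lim: "(\<lambda>n. \<Sum>i<a. \<Sum>j<b. cmod (ent (s n) i j - z i j)) \<longlonglongrightarrow> 0" by simp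
  have "s \<longlonglongrightarrow> l"
  proof (rule metric_tendsto_imp_tendsto[OF lim], intro always_eventually allI)
    fix n
    have "norm (s n - l) \<le> (\<Sum>i<a. \<Sum>j<b. cmod (ent (s n - l) i j))" by (intro norm_le_sum_ent fits_simps fits fl)
    also have "\<dots> = (\<Sum>i<a. \<Sum>j<b. cmod (ent (s n) i j - z i j))" by (simp add: el)
    also have "\<dots> = \<bar>\<dots>\<bar>" by (intro abs_of_nonneg[symmetric] sum_nonneg) auto
    finally show "dist (s n) l \<le> dist (\<Sum>i<a. \<Sum>j<b. cmod (ent (s n) i j - z i j)) 0" by (simp add: dist_norm)
  qed
  with fl show ?thesis by blast
qed

lemma continuous_map_fmat_uniform_limit:
  fixes f :: "nat \<Rightarrow> 'x \<Rightarrow> fmat"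
  assumes cont: "\<And>n. continuous_map X euclidean (f n)"
    and le: "\<And>n x. x \<in> topspace X \<Longrightarrow> norm (f n x - g x) \<le> r n" and r: "r \<longlonglongrightarrow> 0"
  shows "continuous_map X euclidean g"
proof -
  have "continuous_map X Met_TC.mtopology g"
  proof (rule Met_TC.continuous_map_uniform_limit[where f = f and F = sequentially])
    show "\<forall>\<^sub>F n in sequentially. continuous_map X Met_TC.mtopology (f n)" using cont by simp
    fix \<epsilon> :: real assume "0 < \<epsilon>"
    with r have "eventually (\<lambda>n. r n < \<epsilon>) sequentially" by (rule order_tendstoD(2))
    then show "\<forall>\<^sub>F n in sequentially. \<forall>x\<in>topspace X. g x \<in> UNIV \<and> dist (f n x) (g x) < \<epsilon>"
    proof eventually_elim
      case (elim n)
      then show ?case using le unfolding dist_norm by (auto intro: order_le_less_trans)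
    qed
  qed auto
  then show ?thesis by simp
qed

definition polar_step :: "fmat \<Rightarrow> fmat" where
  "polar_step Z = (3/2) *\<^sub>R Z - (1/2) *\<^sub>R (Z * star Z * Z)"

text \<open>With \<open>E = e - Z\<^sup>* Z\<close>, which commutes with \<open>Z\<^sup>* Z\<close>, a step multiplies \<open>Z\<close> by \<open>e + E/2\<close>, the
 first-order approximation of \<open>(Z\<^sup>* Z)\<^bsup>-1/2\<^esup>\<close>. The new defect is quadratic in the old one.\<close>

lemma polar_step_defect:
  assumes ee: "e * e = e" "star e = e" and Ze: "Z * e = Z"
  defines "E \<equiv> e - star Z * Z"
  shows "e - star (polar_step Z) * polar_step Z = (3/4) *\<^sub>R (E * E) + (1/4) *\<^sub>R (E * E * E)"
    and "polar_step Z = Z + (1/2) *\<^sub>R (Z * E)"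
proof -
  have eZ: "e * star Z = star Z" using arg_cong[OF Ze, of star] ee by simp
  have ZZ: "star Z * Z = e - E" by (simp add: E_def)
  have eE: "e * E = E" "E * e = E"
    unfolding E_def by (simp_all add: algebra_simps ee eZ flip: mult.assoc) (simp_all add: ee Ze mult.assoc)
  have sE: "star E = E" unfolding E_def using ee by simp
  have ZE: "Z * E = Z - Z * star Z * Z" unfolding E_def by (simp add: algebra_simps Ze mult.assoc)
  have half: "(3/2) *\<^sub>R Z = Z + (1/2) *\<^sub>R Z" 
  proof -
    have c: "1 + 1/2 = (3/2 :: real)" by simp
    show ?thesis using scaleR_left_distrib[of 1 "1/2" Z] unfolding c scaleR_one .
  qed
  show step: "polar_step Z = Z + (1/2) *\<^sub>R (Z * E)"
    unfolding polar_step_def ZE by (simp add: algebra_simps) (rule half)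
  have sstep: "star (polar_step Z) = star Z + (1/2) *\<^sub>R (E * star Z)" unfolding step using sE by simp
  have "star (polar_step Z) * polar_step Z
     = star Z * Z + (1/2) *\<^sub>R (star Z * Z * E) + (1/2) *\<^sub>R (E * (star Z * Z)) + (1/4) *\<^sub>R (E * (star Z * Z) * E)"
    unfolding sstep unfolding step by (simp add: algebra_simps)
  also have "\<dots> = e - (3/4) *\<^sub>R (E * E) - (1/4) *\<^sub>R (E * E * E)"
    unfolding ZZ by (simp add: algebra_simps eE) (simp add: algebra_simps eE flip: mult.assoc scaleR_add_left)
  finally show "e - star (polar_step Z) * polar_step Z = (3/4) *\<^sub>R (E * E) + (1/4) *\<^sub>R (E * E * E)" by simp
qed

lemma polar_step_bounds:
  assumes ee: "e * e = e" "star e = e" and Ze: "Z * e = Z"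
    and E: "norm (e - star Z * Z) \<le> t" and t: "t \<le> 1/4"
  shows "norm (e - star (polar_step Z) * polar_step Z) \<le> t / 4"
    and "norm (polar_step Z - Z) \<le> t" and "polar_step Z * e = polar_step Z"
proof -
  define E where "E = e - star Z * Z"
  have Et: "norm E \<le> t" using E by (simp add: E_def)
  have t0: "0 \<le> t" using Et norm_ge_zero order_trans by blast
  have EE: "norm (E * E) \<le> t * t" by (meson Et norm_ge_zero norm_mult_ineq mult_mono order_trans t0)
  have "norm (E * E * E) \<le> t * t * t"
    by (rule order_trans[OF norm_mult_ineq]) (intro mult_mono EE Et mult_nonneg_nonneg t0 norm_ge_zero)
  also have "\<dots> \<le> t * t" using t t0 by (simp add: mult_left_le)
  finally have EEE: "norm (E * E * E) \<le> t * t" .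
  have "norm ((3/4) *\<^sub>R (E * E) + (1/4) *\<^sub>R (E * E * E)) \<le> (3/4) * norm (E * E) + (1/4) * norm (E * E * E)"
    by (rule order_trans[OF norm_triangle_ineq]) simp
  also have "\<dots> \<le> t * t" using EE EEE by simp
  also have "\<dots> \<le> t / 4" using t t0 mult_left_mono[OF t t0] by simp
  finally show "norm (e - star (polar_step Z) * polar_step Z) \<le> t / 4"
    unfolding polar_step_defect(1)[OF ee Ze] E_def .
  have "(norm Z)\<^sup>2 = norm (e - E)" by (simp add: E_def norm_star_times)
  also have "\<dots> \<le> norm e + norm E" by (rule norm_triangle_ineq4)
  also have "\<dots> \<le> 2\<^sup>2" using norm_proj_le_1[OF ee] Et t by simp
  finally have "norm Z \<le> 2" by (rule power2_le_imp_le) simp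
  then have "norm (Z * E) \<le> 2 * t"
    by (intro order_trans[OF norm_mult_ineq] mult_mono Et) auto
  then show "norm (polar_step Z - Z) \<le> t"
    unfolding polar_step_defect(2)[OF ee Ze] E_def[symmetric] by simp
  show "polar_step Z * e = polar_step Z"
    unfolding polar_step_def by (simp add: algebra_simps) (simp add: mult.assoc Ze)
qed

text \<open>The bounds \<open>\<eta> / 4\<^sup>n\<close> on the steps do not depend on \<open>Z0\<close>, which gives the uniform convergence
 needed for continuity in parameters. The last two properties record what the iteration preserves: it keeps left
 units of \<open>Z0\<close> as left units, and it keeps self-adjoint elements self-adjoint.\<close>

lemma polar_limit:
  assumes ee: "e * e = e" "star e = e" "fits b b e" and Z0: "fits a b Z0" "Z0 * e = Z0"
    and E: "norm (e - star Z0 * Z0) \<le> \<eta>" and \<eta>: "\<eta> \<le> 1/4"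
  shows "\<exists>Z. (\<lambda>n. (polar_step ^^ n) Z0) \<longlonglongrightarrow> Z \<and> (\<forall>n. norm ((polar_step ^^ n) Z0 - Z) \<le> 2 * \<eta> / 4 ^ n) \<and>
     fits a b Z \<and> star Z * Z = e \<and> Z * e = Z \<and> norm (Z - Z0) \<le> 2 * \<eta> \<and>
     (\<forall>q. q * Z0 = Z0 \<longrightarrow> q * Z = Z) \<and> (star Z0 = Z0 \<longrightarrow> star Z = Z)"
proof -
  define s where "s n = (polar_step ^^ n) Z0" for n
  have s0: "s 0 = Z0" and sS: "s (Suc n) = polar_step (s n)" for n by (auto simp: s_def)
  have \<eta>0: "0 \<le> \<eta>" using E norm_ge_zero order_trans by blast
  have inv: "fits a b (s n) \<and> s n * e = s n \<and> norm (e - star (s n) * s n) \<le> \<eta> / 4 ^ n" for n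
  proof (induction n)
    case (Suc n)
    have f: "fits a b (s n)" and se: "s n * e = s n" and d: "norm (e - star (s n) * s n) \<le> \<eta> / 4 ^ n"
      using Suc by auto
    have "\<eta> / 4 ^ n \<le> 1/4" using \<eta> \<eta>0 frac_le[of \<eta> \<eta> 1 "4 ^ n"] one_le_power[of "4 :: real" n] by linarith
    note b = polar_step_bounds[OF ee(1,2) se d this]
    have "fits a b (polar_step (s n))" unfolding polar_step_def
      using f by (intro fits_simps fits_scaleR fits_times[of a a _ b] fits_times[of a b _ a]) auto
    then show ?case using b by (simp add: sS)
  qed (use Z0 E s0 in auto)
  have step: "norm (s (Suc n) - s n) \<le> \<eta> / 4 ^ n" for n
  proof -
    have "\<eta> / 4 ^ n \<le> 1/4" using \<eta> \<eta>0 frac_le[of \<eta> \<eta> 1 "4 ^ n"] one_le_power[of "4 :: real" n] by linarith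
    then show ?thesis using polar_step_bounds(2)[OF ee(1,2), of "s n"] inv[of n] by (simp add: sS)
  qed
  have diff: "norm (s (n + k) - s n) \<le> 2 * \<eta> / 4 ^ n - 2 * \<eta> / 4 ^ (n + k)" for n k
  proof (induction k)
    case (Suc k)
    have "norm (s (n + Suc k) - s n) \<le> norm (s (n + Suc k) - s (n + k)) + norm (s (n + k) - s n)"
      using norm_triangle_ineq[of "s (n + Suc k) - s (n + k)" "s (n + k) - s n"] by simp
    also have "\<dots> \<le> \<eta> / 4 ^ (n + k) + (2 * \<eta> / 4 ^ n - 2 * \<eta> / 4 ^ (n + k))"
      using step[of "n + k"] Suc by simp
    also have "\<dots> \<le> 2 * \<eta> / 4 ^ n - 2 * \<eta> / 4 ^ (n + Suc k)"
      using \<eta>0 by (simp add: field_simps)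
    finally show ?case .
  qed simp
  have diff': "norm (s m - s n) \<le> 2 * \<eta> / 4 ^ n" if "n \<le> m" for n m
  proof -
    obtain k where "m = n + k" using \<open>n \<le> m\<close> le_Suc_ex by blast
    moreover have "0 \<le> 2 * \<eta> / 4 ^ (n + k)" using \<eta>0 by simp
    ultimately show ?thesis using diff[of n k] by simp
  qed
  have to0: "(\<lambda>n. c / 4 ^ n) \<longlonglongrightarrow> 0" for c :: real
    using tendsto_mult_left[OF LIMSEQ_power_zero[of "1/4 :: real"], of c] by (simp add: power_divide)
  have "Cauchy s"
  proof (rule CauchyI')
    fix r :: real assume "0 < r"
    then have "eventually (\<lambda>n. 2 * \<eta> / 4 ^ n < r) sequentially" using to0 by (rule order_tendstoD(2)[rotated])
    then obtain M where M: "\<And>n. M \<le> n \<Longrightarrow> 2 * \<eta> / 4 ^ n < r" by (auto simp: eventually_sequentially)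
    show "\<exists>M. \<forall>m\<ge>M. \<forall>n>m. dist (s m) (s n) < r"
    proof (intro exI[of _ M] allI impI)
      fix m n assume "M \<le> m" "m < n"
      then show "dist (s m) (s n) < r" using diff'[of m n] M[of m] by (simp add: norm_minus_commute dist_norm)
    qed
  qed
  then obtain Z where Z: "fits a b Z" "s \<longlonglongrightarrow> Z" using fmat_Cauchy_convergent[of a b s] inv by blast
  have bd: "norm (s n - Z) \<le> 2 * \<eta> / 4 ^ n" for n
  proof (rule Lim_bounded[where M = n])
    show "(\<lambda>m. norm (s n - s m)) \<longlonglongrightarrow> norm (s n - Z)" by (intro tendsto_intros Z)
    show "\<forall>m\<ge>n. norm (s n - s m) \<le> 2 * \<eta> / 4 ^ n" using diff' by (metis norm_minus_commute)
  qed
  have "(\<lambda>n. e - star (s n) * s n) \<longlonglongrightarrow> 0"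
  proof (rule Lim_null_comparison[OF always_eventually to0[of \<eta>]])
    show "\<forall>n. norm (e - star (s n) * s n) \<le> \<eta> / 4 ^ n" using inv by blast
  qed
  moreover have "(\<lambda>n. e - star (s n) * s n) \<longlonglongrightarrow> e - star Z * Z" by (intro tendsto_intros tendsto_star Z)
  ultimately have "e - star Z * Z = 0" using LIMSEQ_unique by blast
  moreover have "Z * e = Z"
  proof -
    have "(\<lambda>n. s n * e) \<longlonglongrightarrow> Z * e" by (intro tendsto_intros Z)
    moreover have "s n * e = s n" for n using inv by blast
    ultimately have "s \<longlonglongrightarrow> Z * e" by simp
    then show ?thesis using LIMSEQ_unique Z(2) by blast
  qed
  moreover have "q * Z = Z" if q: "q * Z0 = Z0" for q
  proof -
    have "q * s n = s n" for n
    proof (induction n)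
      case (Suc n)
      then show ?case unfolding sS polar_step_def by (simp add: algebra_simps flip: mult.assoc)
    qed (use q s0 in simp)
    moreover have "(\<lambda>n. q * s n) \<longlonglongrightarrow> q * Z" by (intro tendsto_intros Z)
    ultimately have "s \<longlonglongrightarrow> q * Z" by simp
    then show ?thesis using LIMSEQ_unique Z(2) by blast
  qed
  moreover have "star Z = Z" if sZ: "star Z0 = Z0"
  proof -
    have "star (s n) = s n" for n
    proof (induction n)
      case (Suc n)
      then show ?case unfolding sS polar_step_def by (simp add: mult.assoc)
    qed (use sZ s0 in simp)
    then have "s \<longlonglongrightarrow> star Z" using tendsto_star[OF Z(2)] by simp
    then show ?thesis using LIMSEQ_unique Z(2) by blast
  qed
  moreover have "norm (Z - Z0) \<le> 2 * \<eta>" using bd[of 0] s0 by (simp add: norm_minus_commute)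
  ultimately show ?thesis using Z bd unfolding s_def by (intro exI[of _ Z]) auto
qed

lemma polar_continuous:
  assumes cont: "continuous_map X euclidean Z0"
    and pt: "\<And>x. x \<in> topspace X \<Longrightarrow> fits a b (Z0 x) \<and> fits b b (e x) \<and> e x * e x = e x \<and> star (e x) = e x \<and>
      Z0 x * e x = Z0 x \<and> norm (e x - star (Z0 x) * Z0 x) \<le> \<eta>" and \<eta>: "\<eta> \<le> 1/4"
  shows "\<exists>Z. continuous_map X euclidean Z \<and> (\<forall>x\<in>topspace X. 
     fits a b (Z x) \<and> star (Z x) * Z x = e x \<and> Z x * e x = Z x \<and> norm (Z x - Z0 x) \<le> 2 * \<eta> \<and>
     (\<forall>q. q * Z0 x = Z0 x \<longrightarrow> q * Z x = Z x) \<and> (star (Z0 x) = Z0 x \<longrightarrow> star (Z x) = Z x))"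
proof -
  have "\<forall>x\<in>topspace X. \<exists>Z. (\<forall>n. norm ((polar_step ^^ n) (Z0 x) - Z) \<le> 2 * \<eta> / 4 ^ n) \<and>
     fits a b Z \<and> star Z * Z = e x \<and> Z * e x = Z \<and> norm (Z - Z0 x) \<le> 2 * \<eta> \<and>
     (\<forall>q. q * Z0 x = Z0 x \<longrightarrow> q * Z = Z) \<and> (star (Z0 x) = Z0 x \<longrightarrow> star Z = Z)"
  proof
    fix x assume "x \<in> topspace X"
    with pt[OF this] show "\<exists>Z. (\<forall>n. norm ((polar_step ^^ n) (Z0 x) - Z) \<le> 2 * \<eta> / 4 ^ n) \<and>
     fits a b Z \<and> star Z * Z = e x \<and> Z * e x = Z \<and> norm (Z - Z0 x) \<le> 2 * \<eta> \<and>
     (\<forall>q. q * Z0 x = Z0 x \<longrightarrow> q * Z = Z) \<and> (star (Z0 x) = Z0 x \<longrightarrow> star Z = Z)"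
      using polar_limit[of "e x" b a "Z0 x" \<eta>] \<eta> by blast
  qed
  from bchoice[OF this] obtain Z where Z: "\<forall>x\<in>topspace X. (\<forall>n. norm ((polar_step ^^ n) (Z0 x) - Z x) \<le> 2 * \<eta> / 4 ^ n) \<and>
     fits a b (Z x) \<and> star (Z x) * Z x = e x \<and> Z x * e x = Z x \<and> norm (Z x - Z0 x) \<le> 2 * \<eta> \<and>
     (\<forall>q. q * Z0 x = Z0 x \<longrightarrow> q * Z x = Z x) \<and> (star (Z0 x) = Z0 x \<longrightarrow> star (Z x) = Z x)" by blast
  have cn: "continuous_map X euclidean (\<lambda>x. (polar_step ^^ n) (Z0 x))" for n
  proof (induction n)
    case (Suc n)
    then show ?case unfolding funpow.simps o_def polar_step_def
      by (intro continuous_map_fmat continuous_map_const[THEN iffD2]) auto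
  qed (use cont in simp)
  have "continuous_map X euclidean Z"
  proof (rule continuous_map_fmat_uniform_limit[OF cn])
    show "norm ((polar_step ^^ n) (Z0 x) - Z x) \<le> 2 * \<eta> / 4 ^ n" if "x \<in> topspace X" for n x using Z that by blast
    show "(\<lambda>n. 2 * \<eta> / 4 ^ n) \<longlonglongrightarrow> 0"
      using tendsto_mult_left[OF LIMSEQ_power_zero[of "1/4 :: real"], of "2 * \<eta>"] by (simp add: power_divide)
  qed
  then show ?thesis using Z by (intro exI[of _ Z]) auto
qed

section \<open>Repairing an approximate projection\<close>

text \<open>The self-adjoint \<open>T = 2 Pt - 1\<close> satisfies \<open>T\<^sup>2 \<approx> 1\<close>, because \<open>Pt\<close> is close to the projection
 \<open>W W\<^sup>*\<close>; so its polar part \<open>G\<close> is a symmetry and \<open>q = (G + 1) / 2\<close> is a projection. The polar part \<open>w\<close> of \<open>q W\<close>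
 has the initial projection of \<open>W\<close> and range below \<open>q \<circ> \<xi>\<close>. The range is all of \<open>q \<circ> \<xi>\<close>, since the
 projection \<open>q \<circ> \<xi> - w w\<^sup>*\<close> has norm less than \<open>1\<close>.\<close>

lemma projection_perturbation:
  assumes \<xi>: "continuous_map X \<Omega> \<xi>" "\<xi> ` topspace X = topspace \<Omega>"
    and Pt: "continuous_map \<Omega> euclidean Pt" "\<And>y. y \<in> topspace \<Omega> \<Longrightarrow> fits R R (Pt y) \<and> star (Pt y) = Pt y"
    and W: "continuous_map X euclidean W"
      "\<And>x. x \<in> topspace X \<Longrightarrow> fits R t (W x) \<and> star (W x) * W x * (star (W x) * W x) = star (W x) * W x"
    and \<delta>: "\<And>x. x \<in> topspace X \<Longrightarrow> norm (Pt (\<xi> x) - W x * star (W x)) \<le> \<delta>" "0 \<le> \<delta>" "\<delta> \<le> 1/100"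
  shows "\<exists>q w. continuous_map \<Omega> euclidean q \<and> (\<forall>y\<in>topspace \<Omega>. fits R R (q y) \<and> q y * q y = q y \<and> star (q y) = q y) \<and>
     continuous_map X euclidean w \<and> (\<forall>x\<in>topspace X. fits R t (w x) \<and> star (w x) * w x = star (W x) * W x \<and>
       w x * star (w x) = q (\<xi> x) \<and> norm (w x - W x) \<le> 21 * \<delta>)"
proof -
  define I where "I = idm R"
  have I: "fits R R I" "I * I = I" "star I = I" using idm_left[of R R "idm R" R] by (auto simp: I_def)
  define e where "e x = star (W x) * W x" for x
  define P where "P x = W x * star (W x)" for x
  have fW: "fits R t (W x)" "fits t R (star (W x))" if "x \<in> topspace X" for x using W(2)[OF that] by auto
  have fe: "fits t t (e x)" if "x \<in> topspace X" for x unfolding e_def using fW[OF that] by (rule fits_times[rotated])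
  have fP: "fits R R (P x)" if "x \<in> topspace X" for x unfolding P_def using fW[OF that] by (rule fits_times)
  have ee: "e x * e x = e x" "star (e x) = e x" if "x \<in> topspace X" for x using W(2)[OF that] by (auto simp: e_def)
  have We: "W x * e x = W x" if "x \<in> topspace X" for x
    using partial_isometry_absorb[of "W x"] W(2)[OF that] by (simp add: e_def)
  have PP: "P x * P x = P x" "star (P x) = P x" "P x * W x = W x" "star (W x) * P x = star (W x)" if "x \<in> topspace X" for x
  proof -
    show PW: "P x * W x = W x" using We[OF that] by (simp add: P_def e_def mult.assoc)
    show sP: "star (P x) = P x" by (simp add: P_def)
    show "star (W x) * P x = star (W x)" using arg_cong[OF PW, of star] sP by simp
    show "P x * P x = P x" using PW unfolding P_def by (simp flip: mult.assoc)
  qed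
  have nW: "norm (W x) \<le> 1" if "x \<in> topspace X" for x
    by (rule norm_partial_isometry_le_1[OF ee[OF that]]) (simp add: e_def)
  have \<delta>': "norm (Pt (\<xi> x) - P x) \<le> \<delta>" if "x \<in> topspace X" for x using \<delta>(1)[OF that] by (simp add: P_def)
  have \<xi>in: "\<xi> x \<in> topspace \<Omega>" if "x \<in> topspace X" for x using \<xi>(2) that by blast

  define T where "T y = 2 *\<^sub>R Pt y - I" for y
  have T_defect: "norm (I - star (T y) * T y) \<le> 6 * \<delta>" if "y \<in> topspace \<Omega>" for y
  proof -
    obtain x where x: "x \<in> topspace X" "y = \<xi> x" using \<xi>(2) \<open>y \<in> topspace \<Omega>\<close> by blast
    \<comment> \<open>The symmetry that \<open>T y\<close> approximates at \<open>y = \<xi> x\<close>.\<close>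
    define S where "S = 2 *\<^sub>R P x - I"
    have PI: "P x * I = P x" "I * P x = P x" using fP[OF x(1)] unfolding I_def by (auto intro: idm_left idm_right)
    have SS: "S * S = I" 
    proof -
      have 4: "4 *\<^sub>R P x = 2 *\<^sub>R P x + 2 *\<^sub>R P x" by (simp flip: scaleR_add_left)
      have "S * S = 4 *\<^sub>R (P x * P x) - 2 *\<^sub>R (P x * I) - 2 *\<^sub>R (I * P x) + I * I"
        unfolding S_def by (simp add: left_diff_distrib right_diff_distrib scaleR_right_diff_distrib)
      also have "\<dots> = I" unfolding PI I(2) 4 PP(1)[OF x(1)] by simp
      finally show ?thesis .
    qed
    have sS: "star S = S" unfolding S_def using PP(2)[OF x(1)] I by simp
    have nS: "norm S \<le> 1" by (rule norm_partial_isometry_le_1[OF I(2,3)]) (simp add: sS SS)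
    have sT: "star (T y) = T y" unfolding T_def using Pt(2)[OF that] I by simp
    have "T y - S = 2 *\<^sub>R (Pt y - P x)" unfolding T_def S_def by (simp add: algebra_simps)
    then have d: "norm (T y - S) \<le> 2 * \<delta>" using \<delta>'[OF x(1)] x(2) by simp
    have nT: "norm (T y) \<le> 2"
      using norm_triangle_ineq2[of "T y" S] d nS \<delta> by linarith
    have "I - star (T y) * T y = - (S * (T y - S) + (T y - S) * T y)"
      using SS sT by (simp add: algebra_simps)
    then have "norm (I - star (T y) * T y) \<le> norm (S * (T y - S)) + norm ((T y - S) * T y)"
      by (metis norm_minus_cancel norm_triangle_ineq)
    also have "\<dots> \<le> 1 * (2 * \<delta>) + (2 * \<delta>) * 2"
      by (intro add_mono order_trans[OF norm_mult_ineq] mult_mono nS nT d) (use \<delta> in auto)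
    finally show ?thesis by simp
  qed
  have "\<exists>G. continuous_map \<Omega> euclidean G \<and> (\<forall>y\<in>topspace \<Omega>. 
     fits R R (G y) \<and> star (G y) * G y = I \<and> G y * I = G y \<and> norm (G y - T y) \<le> 2 * (6 * \<delta>) \<and>
     (\<forall>q. q * T y = T y \<longrightarrow> q * G y = G y) \<and> (star (T y) = T y \<longrightarrow> star (G y) = G y))"
  proof (rule polar_continuous)
    show "continuous_map \<Omega> euclidean T" unfolding T_def by (intro continuous_map_fmat Pt) auto
    show "6 * \<delta> \<le> 1/4" using \<delta> by simp
    fix y assume y: "y \<in> topspace \<Omega>"
    have fT: "fits R R (T y)" unfolding T_def using Pt(2)[OF y] I by simp
    have "T y * I = T y" unfolding I_def by (rule idm_right[OF fT]) simp
    then show "fits R R (T y) \<and> fits R R I \<and> I * I = I \<and> star I = I \<and> T y * I = T y \<and> norm (I - star (T y) * T y) \<le> 6 * \<delta>"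
      using fT I T_defect[OF y] by simp
  qed
  then obtain G where Gc: "continuous_map \<Omega> euclidean G" and G: "\<And>y. y \<in> topspace \<Omega> \<Longrightarrow>
     fits R R (G y) \<and> star (G y) * G y = I \<and> G y * I = G y \<and> norm (G y - T y) \<le> 2 * (6 * \<delta>) \<and> star (G y) = G y"
    using Pt(2) I(3) by (auto simp: T_def)
  define q where "q y = (1/2) *\<^sub>R (G y + I)" for y
  have qc: "continuous_map \<Omega> euclidean q" unfolding q_def by (intro continuous_map_fmat Gc) auto
  have q: "fits R R (q y)" "q y * q y = q y" "star (q y) = q y" "norm (q y - Pt y) \<le> 6 * \<delta>" if "y \<in> topspace \<Omega>" for y
  proof -
    note Gy = G[OF that]
    show "fits R R (q y)" unfolding q_def using Gy I by simp
    show "star (q y) = q y" unfolding q_def using Gy I by simp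
    have GG: "G y * G y = I" "G y * I = G y" "I * G y = G y"
    proof -
      have sG: "star (G y) = G y" and GI: "G y * I = G y" and G2: "star (G y) * G y = I" using Gy by blast+
      show "G y * G y = I" "G y * I = G y" using G2 GI sG by simp_all
      show "I * G y = G y" using arg_cong[OF GI, of star] by (simp add: sG I(3))
    qed
    have "q y * q y = (1/4) *\<^sub>R ((G y + G y) + (I + I))"
      unfolding q_def by (simp add: algebra_simps GG I)
    also have "\<dots> = q y" unfolding q_def by (simp flip: scaleR_2 scaleR_add_right)
    finally show "q y * q y = q y" .
    have "q y - Pt y = (1/2) *\<^sub>R (G y - T y)" unfolding q_def T_def by (simp add: algebra_simps flip: scaleR_2)
    then show "norm (q y - Pt y) \<le> 6 * \<delta>" using Gy by simp
  qed
  have qP: "norm (q (\<xi> x) - P x) \<le> 7 * \<delta>" if "x \<in> topspace X" for x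
  proof -
    have "norm (q (\<xi> x) - P x) \<le> norm (q (\<xi> x) - Pt (\<xi> x)) + norm (Pt (\<xi> x) - P x)"
      using norm_triangle_ineq[of "q (\<xi> x) - Pt (\<xi> x)" "Pt (\<xi> x) - P x"] by simp
    then show ?thesis using q(4)[OF \<xi>in[OF that]] \<delta>'[OF that] by linarith
  qed
  \<comment> \<open>This starting point absorbs \<open>q\<close> on the left, hence so does its polar part.\<close>
  define Z0 where "Z0 x = q (\<xi> x) * W x" for x
  have Z0W: "norm (Z0 x - W x) \<le> 7 * \<delta>" if x: "x \<in> topspace X" for x
  proof -
    have "Z0 x - W x = (q (\<xi> x) - P x) * W x" using PP(3)[OF x] by (simp add: Z0_def algebra_simps)
    then have "norm (Z0 x - W x) \<le> (7 * \<delta>) * 1"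
      using \<delta>(2) by (simp only:, intro order_trans[OF norm_mult_ineq] mult_mono qP[OF x] nW[OF x]) simp_all
    then show ?thesis by simp
  qed
  have qcx: "continuous_map X euclidean (\<lambda>x. q (\<xi> x))"
    using continuous_map_compose[OF \<xi>(1) qc] by (simp add: o_def)
  have "\<exists>w. continuous_map X euclidean w \<and> (\<forall>x\<in>topspace X. 
     fits R t (w x) \<and> star (w x) * w x = e x \<and> w x * e x = w x \<and> norm (w x - Z0 x) \<le> 2 * (7 * \<delta>) \<and>
     (\<forall>q. q * Z0 x = Z0 x \<longrightarrow> q * w x = w x) \<and> (star (Z0 x) = Z0 x \<longrightarrow> star (w x) = w x))"
  proof (rule polar_continuous)
    show "continuous_map X euclidean Z0" unfolding Z0_def by (intro continuous_map_fmat qcx W)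
    show "7 * \<delta> \<le> 1/4" using \<delta> by simp
    fix x assume x: "x \<in> topspace X"
    note qx = q[OF \<xi>in[OF x]]
    have f: "fits R t (Z0 x)" unfolding Z0_def by (rule fits_times[OF qx(1) fW(1)[OF x]])
    have "e x - star (Z0 x) * Z0 x = star (W x) * (P x - q (\<xi> x) * q (\<xi> x)) * W x"
      unfolding Z0_def using PP(3)[OF x] qx(3) by (simp add: algebra_simps) (simp add: e_def mult.assoc)
    also have "\<dots> = star (W x) * (P x - q (\<xi> x)) * W x" using qx(2) by simp
    also have "norm \<dots> \<le> (1 * (7 * \<delta>)) * 1"
      by (intro order_trans[OF norm_mult_ineq] mult_mono nW[OF x])
         (use \<delta> nW[OF x] qP[OF x] in \<open>auto simp: norm_minus_commute\<close>)
    finally have d: "norm (e x - star (Z0 x) * Z0 x) \<le> 7 * \<delta>" by simp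
    have "Z0 x * e x = Z0 x" using We[OF x] by (simp add: Z0_def mult.assoc)
    then show "fits R t (Z0 x) \<and> fits t t (e x) \<and> e x * e x = e x \<and> star (e x) = e x \<and>
      Z0 x * e x = Z0 x \<and> norm (e x - star (Z0 x) * Z0 x) \<le> 7 * \<delta>"
      using f fe[OF x] ee[OF x] d by simp
  qed
  then obtain w where wc: "continuous_map X euclidean w" and w: "\<And>x. x \<in> topspace X \<Longrightarrow>
     fits R t (w x) \<and> star (w x) * w x = e x \<and> w x * e x = w x \<and> norm (w x - Z0 x) \<le> 14 * \<delta> \<and>
     (\<forall>q. q * Z0 x = Z0 x \<longrightarrow> q * w x = w x)" by auto
  have "fits R t (w x) \<and> star (w x) * w x = star (W x) * W x \<and>
       w x * star (w x) = q (\<xi> x) \<and> norm (w x - W x) \<le> 21 * \<delta>" if x: "x \<in> topspace X" for x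
  proof -
    note qx = q[OF \<xi>in[OF x]] and wx = w[OF x]
    have qw: "q (\<xi> x) * w x = w x" using wx qx(2) by (simp add: Z0_def flip: mult.assoc)
    have wq: "star (w x) * q (\<xi> x) = star (w x)" using arg_cong[OF qw, of star] qx(3) by simp
    have nw: "norm (w x - W x) \<le> 21 * \<delta>"
      using norm_triangle_ineq[of "w x - Z0 x" "Z0 x - W x"] wx Z0W[OF x] by simp
    define r where "r = q (\<xi> x) - w x * star (w x)"
    have ww: "w x * star (w x) * (w x * star (w x)) = w x * star (w x)"
    proof -
      have "w x * star (w x) * (w x * star (w x)) = w x * (star (w x) * w x) * star (w x)" by (simp only: mult.assoc)
      also have "\<dots> = w x * star (w x)" using wx by simp
      finally show ?thesis .
    qed
    define p where "p = w x * star (w x)"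
    have "q (\<xi> x) * p = p" using qw by (simp add: p_def flip: mult.assoc)
    moreover have "p * q (\<xi> x) = p" using wq by (simp add: p_def mult.assoc)
    moreover have "p * p = p" using ww by (simp add: p_def)
    ultimately have rr: "r * r = r" unfolding r_def p_def[symmetric] by (simp add: algebra_simps qx(2))
    have sr: "star r = r" unfolding r_def using qx(3) by simp
    have nw1: "norm (w x) \<le> 1" using norm_partial_isometry_le_1[OF ee[OF x]] wx by blast
    have "r = (q (\<xi> x) - P x) + (W x - w x) * star (W x) + w x * star (W x - w x)"
      unfolding r_def P_def by (simp add: algebra_simps)
    then have "norm r \<le> norm (q (\<xi> x) - P x) + norm ((W x - w x) * star (W x)) + norm (w x * star (W x - w x))"
      by (metis (no_types) norm_triangle_mono norm_triangle_ineq order_refl)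
    also have "\<dots> \<le> 7 * \<delta> + (21 * \<delta>) * 1 + 1 * (21 * \<delta>)"
      using \<delta>(2) nw nW[OF x] nw1 qP[OF x]
      by (intro add_mono order_trans[OF norm_mult_ineq] mult_mono) (simp_all add: norm_minus_commute del: star_minus)
    also have "\<dots> < 1" using \<delta> by simp
    finally have "norm r < 1" .
    moreover have "norm r * norm r = norm r" using norm_star_times[of r] rr sr by (simp add: power2_eq_square)
    ultimately have "norm r = 0" by auto
    then have "w x * star (w x) = q (\<xi> x)" by (simp add: r_def)
    then show ?thesis using wx nw by (simp add: e_def)
  qed
  then show ?thesis using qc q(1-3) wc by (intro exI[of _ q] exI[of _ w]) blast
qed

section \<open>Orders of covers and covering dimension\<close>

lemma cover_ord_le:
  assumes "topspace X \<noteq> {}" "\<And>x. x \<in> topspace X \<Longrightarrow> card {U \<in> \<beta>. x \<in> U} \<le> d + 1"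
  shows "cover_ord X \<beta> \<le> d"
proof -
  have sub: "(\<lambda>x. card {U \<in> \<beta>. x \<in> U}) ` topspace X \<subseteq> {..d + 1}" using assms(2) by auto
  then have "finite ((\<lambda>x. card {U \<in> \<beta>. x \<in> U}) ` topspace X)" using finite_subset by blast
  then have "(MAX x\<in>topspace X. card {U \<in> \<beta>. x \<in> U}) \<le> d + 1"
    using assms by (intro Max.boundedI) auto
  then show ?thesis by (simp add: cover_ord_def)
qed

lemma card_le_cover_ord:
  assumes "finite \<beta>" "x \<in> topspace X"
  shows "card {U \<in> \<beta>. x \<in> U} \<le> cover_ord X \<beta> + 1"
proof -
  have "(\<lambda>x. card {U \<in> \<beta>. x \<in> U}) ` topspace X \<subseteq> {..card \<beta>}"
    using assms(1) by (auto intro!: card_mono)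
  then have "finite ((\<lambda>x. card {U \<in> \<beta>. x \<in> U}) ` topspace X)" using finite_subset by blast
  then have "card {U \<in> \<beta>. x \<in> U} \<le> (MAX x\<in>topspace X. card {U \<in> \<beta>. x \<in> U})"
    using assms by (intro Max_ge) auto
  then show ?thesis by (simp add: cover_ord_def)
qed

lemma covering_dim_le:
  assumes "\<And>\<U>. finite_open_cover X \<U> \<Longrightarrow> \<exists>\<beta>. finite_open_cover X \<beta> \<and> refines \<beta> \<U> \<and> cover_ord X \<beta> \<le> d"
  shows "covering_dim X \<le> enat d"
  unfolding covering_dim_def
proof (rule SUP_least)
  fix \<U> assume "\<U> \<in> {\<alpha>. finite_open_cover X \<alpha>}"
  then obtain \<beta> where \<beta>: "finite_open_cover X \<beta>" "refines \<beta> \<U>" "cover_ord X \<beta> \<le> d" using assms by blast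
  then have "cover_D X \<U> \<le> cover_ord X \<beta>" unfolding cover_D_def by (intro Least_le) blast
  then show "enat (cover_D X \<U>) \<le> enat d" using \<beta> by simp
qed

lemma cover_D_attained:
  assumes "finite_open_cover X \<alpha>"
  shows "\<exists>\<beta>. finite_open_cover X \<beta> \<and> refines \<beta> \<alpha> \<and> cover_D X \<alpha> = cover_ord X \<beta>"
  unfolding cover_D_def
  by (rule LeastI_ex) (use assms in \<open>auto simp: refines_def\<close>)

lemma openin_finite_Ball:
  assumes "finite I" "\<And>i. i \<in> I \<Longrightarrow> openin X {z \<in> topspace X. P i z}"
  shows "openin X {z \<in> topspace X. \<forall>i\<in>I. P i z}"
  using assms
proof (induction I)
  case (insert i I)
  have "{z \<in> topspace X. \<forall>i\<in>insert i I. P i z} = {z \<in> topspace X. P i z} \<inter> {z \<in> topspace X. \<forall>i\<in>I. P i z}" by auto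
  then show ?case using insert by (auto intro!: openin_Int)
qed auto

section \<open>The dimension of a complex\<close>

lemma not_Ints_between: "0 < x \<Longrightarrow> x < 1 \<Longrightarrow> (x :: real) \<notin> \<int>"
  by (auto elim!: Ints_cases)

text \<open>Think of \<open>c\<close> as barycentric coordinates on a subset of a \<open>d\<close>-dimensional complex. For each of \<open>d + 1\<close>
 offsets \<open>(k + 1) \<theta>\<close>, the hyperplanes on which a coordinate scaled by \<open>n\<close> is an integer plus the offset cut the space
 into small, pairwise disjoint open cells. These \<open>d + 1\<close> families together form a cover of order at most \<open>d\<close>, provided
 that each point avoids the hyperplanes of some offset. If it did not, then distinct nonzero coordinates would lie
 on hyperplanes of distinct offsets, hence all of the at most \<open>d + 1\<close> nonzero coordinates would be used up. Their sum is \<open>1\<close>,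
 so the sum of all offsets would be an integer; the choice of \<open>\<theta>\<close> makes it equal to \<open>1/2\<close>.

 The assumption \<open>leb\<close> says that the coordinates induce the topology, uniformly as in Lebesgue's number lemma.\<close>

lemma covering_dim_barycentric:
  fixes c :: "'i \<Rightarrow> 'y \<Rightarrow> real"
  assumes ne: "topspace \<Omega> \<noteq> {}" and I: "finite I"
    and cont: "\<And>i. i \<in> I \<Longrightarrow> continuous_map \<Omega> euclideanreal (c i)"
    and pos: "\<And>i y. i \<in> I \<Longrightarrow> y \<in> topspace \<Omega> \<Longrightarrow> 0 \<le> c i y"
    and sum1: "\<And>y. y \<in> topspace \<Omega> \<Longrightarrow> (\<Sum>i\<in>I. c i y) = 1"
    and card: "\<And>y. y \<in> topspace \<Omega> \<Longrightarrow> card {i \<in> I. c i y \<noteq> 0} \<le> d + 1"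
    and leb: "\<And>\<U>. finite_open_cover \<Omega> \<U> \<Longrightarrow> \<exists>\<delta>>0. \<forall>y\<in>topspace \<Omega>. \<exists>U\<in>\<U>. \<forall>z\<in>topspace \<Omega>.
       (\<forall>i\<in>I. \<bar>c i y - c i z\<bar> < \<delta>) \<longrightarrow> z \<in> U"
  shows "covering_dim \<Omega> \<le> enat d"
proof (rule covering_dim_le)
  fix \<U> assume \<U>: "finite_open_cover \<Omega> \<U>"
  obtain \<delta> where \<delta>: "\<delta> > 0" "\<And>y. y \<in> topspace \<Omega> \<Longrightarrow> \<exists>U\<in>\<U>. \<forall>z\<in>topspace \<Omega>. (\<forall>i\<in>I. \<bar>c i y - c i z\<bar> < \<delta>) \<longrightarrow> z \<in> U"
    using leb[OF \<U>] by blast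
  obtain n where n: "0 < n" "1 / real n < \<delta>" using \<delta>(1) by (metis nat_approx_posE zero_less_Suc)
  \<comment> \<open>The offsets \<open>\<theta>, 2 \<theta>, \<dots>, (d + 1) \<theta>\<close> are distinct modulo \<open>1\<close> and nonzero, and their sum is \<open>1/2\<close>.\<close>
  define \<theta> where "\<theta> = 1 / (real (d + 1) * real (d + 2))"
  have \<theta>0: "\<theta> > 0" by (simp add: \<theta>_def)
  have \<theta>d: "real (d + 1) * \<theta> < 1" unfolding \<theta>_def by (simp add: divide_simps)
  have \<theta>k: "0 < real (k + 1) * \<theta>" "real (k + 1) * \<theta> < 1" if "k \<le> d" for k
  proof -
    show "0 < real (k + 1) * \<theta>" using \<theta>0 by simp
    have "real (k + 1) * \<theta> \<le> real (d + 1) * \<theta>" using that \<theta>0 by (intro mult_right_mono) auto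
    then show "real (k + 1) * \<theta> < 1" using \<theta>d by linarith
  qed
  define f where "f k i y = real n * c i y - real (k + 1) * \<theta>" for k i y
  define G where "G k = {y \<in> topspace \<Omega>. \<forall>i\<in>I. f k i y \<notin> \<int>}" for k
  define cell where "cell k \<tau> = {z \<in> topspace \<Omega>. \<forall>i\<in>I. real_of_int (\<tau> i) < f k i z \<and> f k i z < real_of_int (\<tau> i) + 1}" for k \<tau>
  define code where "code k y = (\<lambda>i\<in>I. \<lfloor>f k i y\<rfloor>)" for k y
  define T where "T = (\<Pi>\<^sub>E i\<in>I. {-1..int n})"
  have c_le1: "c i y \<le> 1" if "i \<in> I" "y \<in> topspace \<Omega>" for i y
    using member_le_sum[of i I "\<lambda>i. c i y"] sum1[OF that(2)] pos that I by auto
  have code_T: "code k y \<in> T" if "k \<le> d" "y \<in> topspace \<Omega>" for k y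
  proof -
    have "-1 \<le> \<lfloor>f k i y\<rfloor> \<and> \<lfloor>f k i y\<rfloor> \<le> int n" if "i \<in> I" for i
    proof -
      have "0 \<le> real n * c i y" "real n * c i y \<le> real n * 1"
        using pos[OF \<open>i \<in> I\<close> \<open>y \<in> _\<close>] c_le1[OF \<open>i \<in> I\<close> \<open>y \<in> _\<close>] by (simp_all add: mult_left_le)
      then have "-1 \<le> f k i y" "f k i y \<le> real n" using \<theta>k[OF \<open>k \<le> d\<close>] unfolding f_def by linarith+
      then show ?thesis by (simp add: le_floor_iff) linarith
    qed
    then show ?thesis by (auto simp: T_def code_def)
  qed
  have in_cell: "y \<in> cell k (code k y)" if "y \<in> G k" for k y
  proof -
    have "real_of_int \<lfloor>f k i y\<rfloor> < f k i y \<and> f k i y < real_of_int \<lfloor>f k i y\<rfloor> + 1" if "i \<in> I" for i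
    proof -
      have "f k i y \<notin> \<int>" using \<open>y \<in> G k\<close> that by (auto simp: G_def)
      then have "real_of_int \<lfloor>f k i y\<rfloor> \<noteq> f k i y" by (metis Ints_of_int)
      then show ?thesis
        using of_int_floor_le[of "f k i y"] real_of_int_floor_add_one_gt[of "f k i y"] by (metis less_le)
    qed
    then show ?thesis using that by (auto simp: cell_def code_def G_def)
  qed
  have cell_code: "code k y = \<tau>" if "y \<in> cell k \<tau>" "\<tau> \<in> T" for k y \<tau>
  proof
    fix i
    show "code k y i = \<tau> i"
    proof (cases "i \<in> I")
      case True
      then have "real_of_int (\<tau> i) < f k i y" "f k i y < real_of_int (\<tau> i) + 1" using that(1) by (auto simp: cell_def)
      then have "\<lfloor>f k i y\<rfloor> = \<tau> i" by (intro floor_unique) auto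
      then show ?thesis using True by (simp add: code_def)
    next
      case False
      then show ?thesis using that(2) by (auto simp: code_def T_def PiE_def extensional_def)
    qed
  qed
  define \<beta> where "\<beta> = (\<lambda>(k, \<tau>). cell k \<tau>) ` ({..d} \<times> T)"
  have fin\<beta>: "finite \<beta>" unfolding \<beta>_def T_def using I by (intro finite_imageI finite_cartesian_product finite_PiE) auto
  have open_cell: "openin \<Omega> (cell k \<tau>)" for k \<tau>
    unfolding cell_def
  proof (rule openin_finite_Ball[OF I])
    fix i assume i: "i \<in> I"
    have "continuous_map \<Omega> euclideanreal (f k i)" unfolding f_def by (intro continuous_intros cont i)
    then have "openin \<Omega> {z \<in> topspace \<Omega>. f k i z \<in> {real_of_int (\<tau> i)<..<real_of_int (\<tau> i) + 1}}"
      by (rule openin_continuous_map_preimage) simp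
    then show "openin \<Omega> {z \<in> topspace \<Omega>. real_of_int (\<tau> i) < f k i z \<and> f k i z < real_of_int (\<tau> i) + 1}" by simp
  qed
  have cover: "\<exists>k\<le>d. y \<in> G k" if y: "y \<in> topspace \<Omega>" for y
  proof (rule ccontr)
    assume "\<not> ?thesis"
    then have "\<forall>k\<in>{..d}. \<exists>i. i \<in> I \<and> f k i y \<in> \<int>" using y by (auto simp: G_def)
    from bchoice[OF this] obtain \<iota> where \<iota>: "\<And>k. k \<le> d \<Longrightarrow> \<iota> k \<in> I \<and> f k (\<iota> k) y \<in> \<int>" by auto
    have inj: "inj_on \<iota> {..d}"
    proof -
      have "False" if kk: "k < k'" "k' \<le> d" "\<iota> k = \<iota> k'" for k k'
      proof -
        have "f k (\<iota> k) y - f k' (\<iota> k') y \<in> \<int>" using \<iota>[of k] \<iota>[of k'] kk by auto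
        then have "(real k' - real k) * \<theta> \<in> \<int>" using kk(3) by (simp add: f_def algebra_simps)
        moreover have "0 < (real k' - real k) * \<theta>" using kk \<theta>0 by simp
        moreover have "(real k' - real k) * \<theta> \<le> real (k' + 1) * \<theta>" using \<theta>0 by (intro mult_right_mono) auto
        then have "(real k' - real k) * \<theta> < 1" using \<theta>k[OF kk(2)] by linarith
        ultimately show False using not_Ints_between by blast
      qed
      then show ?thesis by (auto simp: inj_on_def) (metis linorder_neqE_nat)
    qed
    have nz: "c (\<iota> k) y \<noteq> 0" if "k \<le> d" for k
    proof
      assume "c (\<iota> k) y = 0"
      then have "real (k + 1) * \<theta> \<in> \<int>" using \<iota>[OF that] by (simp add: f_def)
      then show False using \<theta>k[OF that] not_Ints_between by blast
    qed
    have sub: "\<iota> ` {..d} \<subseteq> {i \<in> I. c i y \<noteq> 0}" using \<iota> nz by auto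
    have eq: "\<iota> ` {..d} = {i \<in> I. c i y \<noteq> 0}"
      by (rule card_seteq[OF _ sub]) (use I card[OF y] card_image[OF inj] in auto)
    have "1 = (\<Sum>i\<in>{i \<in> I. c i y \<noteq> 0}. c i y)"
      unfolding sum1[OF y, symmetric] using I by (intro sum.mono_neutral_right) auto
    also have "\<dots> = (\<Sum>k\<le>d. c (\<iota> k) y)" unfolding eq[symmetric] by (simp add: sum.reindex[OF inj])
    finally have s1: "(\<Sum>k\<le>d. c (\<iota> k) y) = 1" by simp
    have "(\<Sum>k\<le>d. f k (\<iota> k) y) \<in> \<int>" using \<iota> by (intro Ints_sum) auto
    moreover have "(\<Sum>k\<le>d. f k (\<iota> k) y) = real n - 1/2"
    proof -
      have "(\<Sum>k\<le>d. f k (\<iota> k) y) = real n * (\<Sum>k\<le>d. c (\<iota> k) y) - (\<Sum>k\<le>d. real (k + 1)) * \<theta>"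
        unfolding f_def by (simp only: sum_subtractf sum_distrib_left sum_distrib_right)
      also have "(\<Sum>k\<le>d. real (k + 1)) = real (d + 1) * real (d + 2) / 2"
        by (induction d) (auto simp: field_simps)
      also have "real (d + 1) * real (d + 2) / 2 * \<theta> = 1/2" by (simp add: \<theta>_def)
      finally show ?thesis using s1 by simp
    qed
    ultimately have "real n - (real n - 1/2) \<in> \<int>" by (metis Ints_diff Ints_of_nat)
    then show False using not_Ints_between[of "1/2"] by simp
  qed
  have foc: "finite_open_cover \<Omega> \<beta>"
    unfolding finite_open_cover_def
  proof (intro conjI fin\<beta> equalityI)
    show "\<forall>U\<in>\<beta>. openin \<Omega> U" unfolding \<beta>_def using open_cell by auto
    show "\<Union>\<beta> \<subseteq> topspace \<Omega>" unfolding \<beta>_def cell_def by auto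
    show "topspace \<Omega> \<subseteq> \<Union>\<beta>"
    proof
      fix y assume y: "y \<in> topspace \<Omega>"
      then obtain k where k: "k \<le> d" "y \<in> G k" using cover by blast
      then show "y \<in> \<Union>\<beta>" unfolding \<beta>_def using in_cell[OF k(2)] code_T[OF k(1) y] by blast
    qed
  qed
  have ord: "cover_ord \<Omega> \<beta> \<le> d"
  proof (rule cover_ord_le[OF ne])
    fix y assume "y \<in> topspace \<Omega>"
    have "{U \<in> \<beta>. y \<in> U} \<subseteq> (\<lambda>k. cell k (code k y)) ` {..d}"
      unfolding \<beta>_def using cell_code by auto
    then have "card {U \<in> \<beta>. y \<in> U} \<le> card {..d}" by (rule surj_card_le[rotated]) simp
    then show "card {U \<in> \<beta>. y \<in> U} \<le> d + 1" by simp
  qed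
  have "refines \<beta> \<U>"
    unfolding refines_def
  proof
    fix V assume "V \<in> \<beta>"
    then obtain k \<tau> where k: "k \<le> d" "\<tau> \<in> T" "V = cell k \<tau>" by (auto simp: \<beta>_def)
    show "\<exists>U\<in>\<U>. V \<subseteq> U"
    proof (cases "V = {}")
      case True
      have "\<U> \<noteq> {}" using \<U> ne unfolding finite_open_cover_def by (metis Union_empty)
      then show ?thesis using True by blast
    next
      case False
      then obtain y where y: "y \<in> V" by blast
      then have yt: "y \<in> topspace \<Omega>" using k by (auto simp: cell_def)
      obtain U where U: "U \<in> \<U>" "\<forall>z\<in>topspace \<Omega>. (\<forall>i\<in>I. \<bar>c i y - c i z\<bar> < \<delta>) \<longrightarrow> z \<in> U" using \<delta>(2)[OF yt] by blast
      have "V \<subseteq> U"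
      proof
        fix z assume z: "z \<in> V"
        then have zt: "z \<in> topspace \<Omega>" using k by (auto simp: cell_def)
        have "\<bar>c i y - c i z\<bar> < \<delta>" if "i \<in> I" for i
        proof -
          have "real_of_int (\<tau> i) < f k i z \<and> f k i z < real_of_int (\<tau> i) + 1"
            "real_of_int (\<tau> i) < f k i y \<and> f k i y < real_of_int (\<tau> i) + 1"
            using y z k that by (auto simp: cell_def)
          then have "\<bar>f k i y - f k i z\<bar> < 1" by linarith
          then have "\<bar>real n * (c i y - c i z)\<bar> < 1" by (simp add: f_def algebra_simps)
          moreover have "\<bar>real n * (c i y - c i z)\<bar> = \<bar>c i y - c i z\<bar> * real n" by (simp only: abs_mult abs_of_nat mult.commute)
          ultimately have "\<bar>c i y - c i z\<bar> < 1 / real n" using n by (simp only: pos_less_divide_eq of_nat_0_less_iff)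
          then show ?thesis using n by linarith
        qed
        then show "z \<in> U" using U zt by blast
      qed
      then show ?thesis using U by blast
    qed
  qed
  with foc ord show "\<exists>\<beta>. finite_open_cover \<Omega> \<beta> \<and> refines \<beta> \<U> \<and> cover_ord \<Omega> \<beta> \<le> d" by blast
qed

section \<open>The map to the nerve of a cover\<close>

text \<open>Around each point there is a function supported in a member of the cover; by compactness finitely
 many of them suffice, and those that belong to the same member of the cover are added up.\<close>

lemma finite_partition_of_unity:
  assumes X: "compact_space X" "Hausdorff_space X" and \<beta>: "finite_open_cover X \<beta>"
  shows "\<exists>h. (\<forall>V\<in>\<beta>. continuous_map X euclideanreal (h V)) \<and>
    (\<forall>x\<in>topspace X. (\<forall>V\<in>\<beta>. 0 \<le> h V x \<and> (h V x \<noteq> 0 \<longrightarrow> x \<in> V)) \<and> (\<Sum>V\<in>\<beta>. h V x) = (1 :: real))"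
proof -
  have cr: "completely_regular_space X"
    using X by (intro normal_imp_completely_regular_space compact_Hausdorff_or_regular_imp_normal_space) auto
  have "\<forall>p\<in>topspace X. \<exists>V u. V \<in> \<beta> \<and> continuous_map X euclideanreal u \<and> u p = (1::real) \<and>
     (\<forall>x\<in>topspace X. 0 \<le> u x \<and> (u x \<noteq> 0 \<longrightarrow> x \<in> V))"
  proof
    fix p assume p: "p \<in> topspace X"
    then obtain V where V: "V \<in> \<beta>" "p \<in> V" using \<beta> by (auto simp: finite_open_cover_def)
    have "closedin X (topspace X - V)" using \<beta> V by (auto simp: finite_open_cover_def)
    then obtain f :: "_ \<Rightarrow> real" where f: "continuous_map X (top_of_set {0..1}) f" "f p = 0" "f ` (topspace X - V) \<subseteq> {1}"
      using cr p V unfolding completely_regular_space_def by (metis Diff_iff)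
    have fc: "continuous_map X euclideanreal f" and f01: "\<And>x. x \<in> topspace X \<Longrightarrow> f x \<in> {0..1}"
      using f(1) by (auto simp: continuous_map_in_subtopology)
    show "\<exists>V u. V \<in> \<beta> \<and> continuous_map X euclideanreal u \<and> u p = (1::real) \<and>
     (\<forall>x\<in>topspace X. 0 \<le> u x \<and> (u x \<noteq> 0 \<longrightarrow> x \<in> V))"
      using V f f01 by (intro exI[of _ V] exI[of _ "\<lambda>x. 1 - f x"]) (auto intro!: continuous_intros fc)
  qed
  from bchoice[OF this] obtain Vp where "\<forall>p\<in>topspace X. \<exists>u. Vp p \<in> \<beta> \<and> continuous_map X euclideanreal u \<and> u p = (1::real) \<and>
     (\<forall>x\<in>topspace X. 0 \<le> u x \<and> (u x \<noteq> 0 \<longrightarrow> x \<in> Vp p))" by blast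
  from bchoice[OF this] obtain u where u: "\<And>p. p \<in> topspace X \<Longrightarrow> Vp p \<in> \<beta> \<and> continuous_map X euclideanreal (u p) \<and> u p p = (1::real) \<and>
     (\<forall>x\<in>topspace X. 0 \<le> u p x \<and> (u p x \<noteq> 0 \<longrightarrow> x \<in> Vp p))" by blast
  define O' where "O' p = {x \<in> topspace X. u p x \<in> {0<..}}" for p
  have "openin X (O' p)" if "p \<in> topspace X" for p
    unfolding O'_def using u[OF that] by (intro openin_continuous_map_preimage[where Y = euclideanreal]) auto
  moreover have "topspace X \<subseteq> \<Union>(O' ` topspace X)" using u by (force simp: O'_def)
  ultimately obtain \<F> where "finite \<F>" "\<F> \<subseteq> O' ` topspace X" "topspace X \<subseteq> \<Union>\<F>"
    using X(1) unfolding compact_space_alt by (metis (no_types, lifting) imageE)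
  then obtain P where P: "finite P" "P \<subseteq> topspace X" "topspace X \<subseteq> \<Union>(O' ` P)"
    by (metis finite_subset_image)
  define g where "g V x = (\<Sum>p\<in>{p\<in>P. Vp p = V}. u p x)" for V x
  define s where "s x = (\<Sum>V\<in>\<beta>. g V x)" for x
  have fin\<beta>: "finite \<beta>" using \<beta> by (simp add: finite_open_cover_def)
  have gc: "continuous_map X euclideanreal (g V)" for V
    unfolding g_def using P u by (intro continuous_map_sum) auto
  have sc: "continuous_map X euclideanreal s" unfolding s_def using fin\<beta> gc by (intro continuous_map_sum) auto
  have g0: "0 \<le> g V x" if "x \<in> topspace X" for V x unfolding g_def using P u that by (intro sum_nonneg) auto
  have gV: "x \<in> V" if "x \<in> topspace X" "g V x \<noteq> 0" for V x
  proof -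
    obtain p where "p \<in> P" "Vp p = V" "u p x \<noteq> 0" using \<open>g V x \<noteq> 0\<close> unfolding g_def by (metis (mono_tags, lifting) mem_Collect_eq sum.neutral)
    then show ?thesis using u P that by blast
  qed
  have spos: "0 < s x" if x: "x \<in> topspace X" for x
  proof -
    obtain p where p: "p \<in> P" "x \<in> O' p" using P x by blast
    have "0 < u p x" using p by (simp add: O'_def)
    also have "u p x \<le> g (Vp p) x" unfolding g_def using P u p x by (intro member_le_sum) auto
    also have "\<dots> \<le> s x" unfolding s_def using g0[OF x] fin\<beta> u p P by (intro member_le_sum) auto
    finally show ?thesis .
  qed
  define h where "h V x = g V x / s x" for V x
  show ?thesis
  proof (intro exI[of _ h] conjI ballI)
    show "continuous_map X euclideanreal (h V)" for V
      unfolding h_def by (intro continuous_map_real_divide gc sc) (use spos in fastforce)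
    fix x assume x: "x \<in> topspace X"
    show "(\<Sum>V\<in>\<beta>. h V x) = 1" using spos[OF x] by (simp add: h_def s_def flip: sum_divide_distrib)
    fix V
    show "0 \<le> h V x" using g0[OF x] spos[OF x] by (simp add: h_def less_imp_le)
    show "h V x \<noteq> 0 \<longrightarrow> x \<in> V" using gV[OF x] by (auto simp: h_def)
  qed
qed

text \<open>The coordinates of \<open>\<xi> x\<close> are the values at \<open>x\<close> of a partition of unity, so at most \<open>d + 1\<close> of them are nonzero.
 The members of \<open>\<beta>\<close> are injected into \<open>'a\<close> to place \<open>\<Omega>\<close> in the type \<open>'a \<Rightarrow> complex\<close>.\<close>

lemma nerve_map:
  fixes X :: "'x topology"
  assumes inf: "infinite (UNIV :: 'a set)"
    and X: "compact_space X" "Hausdorff_space X" "topspace X \<noteq> {}"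
    and \<beta>: "finite_open_cover X \<beta>" and d: "\<And>x. x \<in> topspace X \<Longrightarrow> card {V\<in>\<beta>. x \<in> V} \<le> d + 1"
  shows "\<exists>(\<Omega> :: ('a \<Rightarrow> complex) topology) \<xi> t. compact_space \<Omega> \<and> Hausdorff_space \<Omega> \<and>
     continuous_map X \<Omega> \<xi> \<and> \<xi> ` topspace X = topspace \<Omega> \<and> covering_dim \<Omega> \<le> enat d \<and>
    (\<forall>V\<in>\<beta>. continuous_map \<Omega> euclideanreal (t V)) \<and>
    (\<forall>x\<in>topspace X. (\<forall>V\<in>\<beta>. 0 \<le> t V (\<xi> x) \<and> (t V (\<xi> x) \<noteq> 0 \<longrightarrow> x \<in> V)) \<and> (\<Sum>V\<in>\<beta>. t V (\<xi> x)) = (1 :: real))"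
proof -
  obtain h where hc: "\<And>V. V \<in> \<beta> \<Longrightarrow> continuous_map X euclideanreal (h V)" and
    h: "\<And>x V. x \<in> topspace X \<Longrightarrow> V \<in> \<beta> \<Longrightarrow> 0 \<le> h V x \<and> (h V x \<noteq> 0 \<longrightarrow> x \<in> V)"
    and h1: "\<And>x. x \<in> topspace X \<Longrightarrow> (\<Sum>V\<in>\<beta>. h V x) = (1 :: real)"
    using finite_partition_of_unity[OF X(1,2) \<beta>] by blast
  have fin: "finite \<beta>" using \<beta> by (simp add: finite_open_cover_def)
  obtain e :: "'x set \<Rightarrow> 'a" where e: "inj_on e \<beta>"
    using infinite_arbitrarily_large[OF inf, of "card \<beta>"] fin by (metis card_le_inj order_refl)
  define \<xi> where "\<xi> x = (\<lambda>a. if a \<in> e ` \<beta> then complex_of_real (h (inv_into \<beta> e a) x) else 0)" for x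
  have \<xi>e: "\<xi> x (e V) = of_real (h V x)" if "V \<in> \<beta>" for x V
    using that e by (simp add: \<xi>_def)
  define t where "t V y = Re (y (e V))" for V and y :: "'a \<Rightarrow> complex"
  have t\<xi>: "t V (\<xi> x) = h V x" if "V \<in> \<beta>" for V x using \<xi>e[OF that] by (simp add: t_def)
  define M where "M = \<xi> ` topspace X"
  \<comment> \<open>The topology of \<open>\<Omega>\<close> is given by the \<open>\<ell>\<^sup>1\<close>-distance of the coordinates.\<close>
  define D where "D y z = (\<Sum>V\<in>\<beta>. \<bar>t V y - t V z\<bar>)" for y z
  interpret Metric_space M D
  proof
    show "0 \<le> D x y" for x y unfolding D_def by (intro sum_nonneg) auto
    show "D x y = D y x" for x y unfolding D_def by (simp add: abs_minus_commute)
    show "D x z \<le> D x y + D y z" for x y z unfolding D_def sum.distrib[symmetric] by (intro sum_mono) auto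
    fix y z assume "y \<in> M" "z \<in> M"
    then obtain p q where pq: "y = \<xi> p" "z = \<xi> q" by (auto simp: M_def)
    show "D y z = 0 \<longleftrightarrow> y = z"
    proof
      assume "D y z = 0"
      then have eq: "\<And>V. V \<in> \<beta> \<Longrightarrow> t V y = t V z" unfolding D_def using fin by (simp add: sum_nonneg_eq_0_iff)
      then have "\<And>V. V \<in> \<beta> \<Longrightarrow> h V p = h V q" using pq t\<xi> by metis
      then show "y = z" unfolding pq by (auto simp: \<xi>_def e inv_into_into)
    qed (simp add: D_def)
  qed
  have tc: "continuous_map mtopology euclideanreal (t V)" if "V \<in> \<beta>" for V
    unfolding continuous_map_from_metric
  proof (intro conjI ballI allI impI)
    fix y U assume "y \<in> M" and U: "openin euclideanreal U \<and> t V y \<in> U"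
    then obtain r where r: "r > 0" "\<And>s. \<bar>s - t V y\<bar> < r \<Longrightarrow> s \<in> U"
      by (auto simp: open_dist dist_real_def)
    have "\<bar>t V z - t V y\<bar> \<le> D y z" for z
      unfolding D_def using member_le_sum[of V \<beta> "\<lambda>V. \<bar>t V y - t V z\<bar>"] that fin by (simp add: abs_minus_commute)
    then show "\<exists>r>0. \<forall>z. z \<in> M \<and> D y z < r \<longrightarrow> t V z \<in> U" using r by (metis order_le_less_trans)
  qed simp
  have \<xi>M: "\<xi> x \<in> M" if "x \<in> topspace X" for x using that by (simp add: M_def)
  have \<xi>c: "continuous_map X mtopology \<xi>"
    unfolding continuous_map_to_metric
  proof (intro ballI allI impI)
    fix x and \<epsilon> :: real assume x: "x \<in> topspace X" and "0 < \<epsilon>"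
    have "continuous_map X euclideanreal (\<lambda>y. \<Sum>V\<in>\<beta>. \<bar>h V x - h V y\<bar>)"
      using fin hc by (intro continuous_intros) auto
    then have "openin X {y \<in> topspace X. (\<Sum>V\<in>\<beta>. \<bar>h V x - h V y\<bar>) \<in> {..<\<epsilon>}}"
      by (rule openin_continuous_map_preimage) simp
    moreover have "D (\<xi> x) (\<xi> y) = (\<Sum>V\<in>\<beta>. \<bar>h V x - h V y\<bar>)" for y unfolding D_def by (simp add: t\<xi>)
    ultimately show "\<exists>U. openin X U \<and> x \<in> U \<and> (\<forall>y\<in>U. \<xi> y \<in> mball (\<xi> x) \<epsilon>)"
      using x \<open>0 < \<epsilon>\<close> by (intro exI[of _ "{y \<in> topspace X. (\<Sum>V\<in>\<beta>. \<bar>h V x - h V y\<bar>) \<in> {..<\<epsilon>}}"]) (auto simp: \<xi>M)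
  qed
  have comp: "compact_space mtopology"
    using image_compactin[OF X(1)[unfolded compact_space_def] \<xi>c] 
    by (simp only: compact_space_def M_def[symmetric] topspace_mtopology)
  have tM: "0 \<le> t V y" "(\<Sum>V\<in>\<beta>. t V y) = 1" "card {V \<in> \<beta>. t V y \<noteq> 0} \<le> d + 1" if "y \<in> M" "V \<in> \<beta>" for y V
  proof -
    obtain x where x: "x \<in> topspace X" "y = \<xi> x" using \<open>y \<in> M\<close> by (auto simp: M_def)
    show "0 \<le> t V y" using h[OF x(1) that(2)] x t\<xi>[OF that(2)] by simp
    show "(\<Sum>V\<in>\<beta>. t V y) = 1" using h1[OF x(1)] x t\<xi> by simp
    have "{V \<in> \<beta>. t V y \<noteq> 0} \<subseteq> {V \<in> \<beta>. x \<in> V}" using h[OF x(1)] x(2) t\<xi> by auto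
    then have "card {V \<in> \<beta>. t V y \<noteq> 0} \<le> card {V \<in> \<beta>. x \<in> V}" using fin by (intro card_mono) auto
    then show "card {V \<in> \<beta>. t V y \<noteq> 0} \<le> d + 1" using d[OF x(1)] by simp
  qed
  have \<beta>ne: "\<beta> \<noteq> {}" using \<beta> X(3) unfolding finite_open_cover_def by (metis Union_empty)
  have Mne: "M \<noteq> {}" using X(3) unfolding M_def by (simp only: image_is_empty not_False_eq_True)
  have dim: "covering_dim mtopology \<le> enat d"
  proof (rule covering_dim_barycentric[where I = \<beta> and c = t])
    show "topspace mtopology \<noteq> {}" unfolding topspace_mtopology using Mne .
    fix \<U> assume \<U>: "finite_open_cover mtopology \<U>"
    obtain \<epsilon> where \<epsilon>: "\<epsilon> > 0" "\<And>y. y \<in> M \<Longrightarrow> \<exists>U\<in>\<U>. mball y \<epsilon> \<subseteq> U"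
      using lebesgue_number[of M \<U>] comp \<U> by (auto simp: finite_open_cover_def compact_space_def)
    have cb: "0 < card \<beta>" using fin \<beta>ne by (simp add: card_gt_0_iff)
    show "\<exists>\<delta>>0. \<forall>y\<in>topspace mtopology. \<exists>U\<in>\<U>. \<forall>z\<in>topspace mtopology. (\<forall>i\<in>\<beta>. \<bar>t i y - t i z\<bar> < \<delta>) \<longrightarrow> z \<in> U"
    proof (intro exI[of _ "\<epsilon> / card \<beta>"] conjI ballI)
      show "0 < \<epsilon> / card \<beta>" using cb \<epsilon> by simp
      fix y assume "y \<in> topspace mtopology"
      then have y: "y \<in> M" by simp
      then obtain U where U: "U \<in> \<U>" "mball y \<epsilon> \<subseteq> U" using \<epsilon> by blast
      have "z \<in> U" if z: "z \<in> M" "\<forall>i\<in>\<beta>. \<bar>t i y - t i z\<bar> < \<epsilon> / card \<beta>" for z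
      proof -
        have "D y z < (\<Sum>V\<in>\<beta>. \<epsilon> / card \<beta>)" unfolding D_def using z fin \<beta>ne by (intro sum_strict_mono) auto
        also have "\<dots> = \<epsilon>" using cb by simp
        finally have "z \<in> mball y \<epsilon>" using y z by simp
        then show ?thesis using U by blast
      qed
      then show "\<exists>U\<in>\<U>. \<forall>z\<in>topspace mtopology. (\<forall>i\<in>\<beta>. \<bar>t i y - t i z\<bar> < \<epsilon> / card \<beta>) \<longrightarrow> z \<in> U"
        using U by auto
    qed
  qed (use fin tc tM \<beta>ne in auto)
  show ?thesis
  proof (intro exI conjI)
    show "\<forall>V\<in>\<beta>. continuous_map mtopology euclideanreal (t V)" using tc by blast
    show "\<forall>x\<in>topspace X. (\<forall>V\<in>\<beta>. 0 \<le> t V (\<xi> x) \<and> (t V (\<xi> x) \<noteq> 0 \<longrightarrow> x \<in> V)) \<and> (\<Sum>V\<in>\<beta>. t V (\<xi> x)) = 1"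
      using h h1 t\<xi> by simp
    show "\<xi> ` topspace X = topspace mtopology" unfolding topspace_mtopology by (simp only: M_def)
  qed (rule comp Hausdorff_space_mtopology \<xi>c dim)+
qed

section \<open>Homogeneous algebras as algebras of matrix valued functions\<close>

definition fval :: "(nat \<Rightarrow> 'x \<Rightarrow> complex mat) \<Rightarrow> nat \<Rightarrow> 'x \<Rightarrow> fmat" where
  "fval f l x = to_fm (f l x)"

definition homog_mk :: "'x homog_data \<Rightarrow> (nat \<Rightarrow> 'x \<Rightarrow> fmat) \<Rightarrow> nat \<Rightarrow> 'x \<Rightarrow> complex mat" where
  "homog_mk S G = (\<lambda>l\<in>{..<summands S}. \<lambda>x\<in>topspace (spc S l). of_fm (msize S l) (msize S l) (G l x))"

lemmas homog_algebra_defs = homog_algebra_def direct_sum_algebra_def summand_algebra_def corner_algebra_def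

lemma homogeneousD:
  assumes "homogeneous S" "l < summands S"
  shows "topspace (spc S l) \<noteq> {}" "compact_space (spc S l)" "Hausdorff_space (spc S l)" "0 < prank S l"
    "continuous_map (spc S l) euclidean (fval (prj S) l)"
    "x \<in> topspace (spc S l) \<Longrightarrow> prj S l x \<in> carrier_mat (msize S l) (msize S l)"
    "x \<in> topspace (spc S l) \<Longrightarrow> fits (msize S l) (msize S l) (fval (prj S) l x)"
    "x \<in> topspace (spc S l) \<Longrightarrow> fval (prj S) l x * fval (prj S) l x = fval (prj S) l x"
    "x \<in> topspace (spc S l) \<Longrightarrow> star (fval (prj S) l x) = fval (prj S) l x"
    "x \<in> topspace (spc S l) \<Longrightarrow> vec_space.rank (msize S l) (prj S l x) = prank S l"
proof -
  have h: "topspace (spc S l) \<noteq> {}" "compact_space (spc S l)" "Hausdorff_space (spc S l)" "0 < prank S l"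
    "mat_projection (spc S l) (msize S l) (prj S l)" 
    "\<forall>x\<in>topspace (spc S l). vec_space.rank (msize S l) (prj S l x) = prank S l"
    using assms unfolding homogeneous_def by blast+
  have c: "cont_mat (spc S l) (msize S l) (msize S l) (prj S l)" 
    and p: "\<And>x. x \<in> topspace (spc S l) \<Longrightarrow> prj S l x * prj S l x = prj S l x \<and> mat_adjoint (prj S l x) = prj S l x"
    using h(5) unfolding mat_projection_def by blast+
  have cm: "prj S l x \<in> carrier_mat (msize S l) (msize S l)" if "x \<in> topspace (spc S l)" for x
    using c that unfolding cont_mat_def by blast
  show "topspace (spc S l) \<noteq> {}" "compact_space (spc S l)" "Hausdorff_space (spc S l)" "0 < prank S l"
    by (fact h)+
  show "continuous_map (spc S l) euclidean (fval (prj S) l)" using c unfolding cont_mat_iff fval_def by blast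
  assume x: "x \<in> topspace (spc S l)"
  show "prj S l x \<in> carrier_mat (msize S l) (msize S l)" by (rule cm[OF x])
  show "fits (msize S l) (msize S l) (fval (prj S) l x)" unfolding fval_def by (rule fits_to_fm[OF cm[OF x]])
  show "fval (prj S) l x * fval (prj S) l x = fval (prj S) l x"
    unfolding fval_def using to_fm_mult[OF cm[OF x] cm[OF x]] p[OF x] by simp
  show "star (fval (prj S) l x) = fval (prj S) l x"
    unfolding fval_def using to_fm_adjoint[OF cm[OF x]] p[OF x] by simp
  show "vec_space.rank (msize S l) (prj S l x) = prank S l" using h(6) x by blast
qed

context
  fixes S :: "'x homog_data"
  assumes S: "homogeneous S"
begin

lemma homog_carrier_matD:
  assumes "f \<in> carrier (homog_algebra S)" "l < summands S" "x \<in> topspace (spc S l)"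
  shows "f l x \<in> carrier_mat (msize S l) (msize S l)"
  using assms by (auto simp: homog_algebra_defs cont_mat_def PiE_iff)

lemma homog_carrierD:
  assumes "f \<in> carrier (homog_algebra S)" "l < summands S"
  shows "continuous_map (spc S l) euclidean (fval f l)"
    "x \<in> topspace (spc S l) \<Longrightarrow> fits (msize S l) (msize S l) (fval f l x)"
    "x \<in> topspace (spc S l) \<Longrightarrow> fval (prj S) l x * fval f l x = fval f l x"
    "x \<in> topspace (spc S l) \<Longrightarrow> fval f l x * fval (prj S) l x = fval f l x"
proof -
  have f: "cont_mat (spc S l) (msize S l) (msize S l) (f l)"
    "\<And>x. x \<in> topspace (spc S l) \<Longrightarrow> prj S l x * f l x * prj S l x = f l x"
    using assms by (auto simp: homog_algebra_defs PiE_iff)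
  show "continuous_map (spc S l) euclidean (fval f l)" using f(1) unfolding cont_mat_iff fval_def by blast
  assume x: "x \<in> topspace (spc S l)"
  have cm: "f l x \<in> carrier_mat (msize S l) (msize S l)" by (rule homog_carrier_matD[OF assms x])
  have cp: "prj S l x \<in> carrier_mat (msize S l) (msize S l)" by (rule homogeneousD(6)[OF S assms(2) x])
  show "fits (msize S l) (msize S l) (fval f l x)" unfolding fval_def by (rule fits_to_fm[OF cm])
  have eq: "fval (prj S) l x * fval f l x * fval (prj S) l x = fval f l x"
    unfolding fval_def using to_fm_mult3[OF cp cm cp] f(2)[OF x] by simp
  have pp: "fval (prj S) l x * fval (prj S) l x = fval (prj S) l x" by (rule homogeneousD(8)[OF S assms(2) x])
  show "fval (prj S) l x * fval f l x = fval f l x" using eq pp by (metis mult.assoc)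
  show "fval f l x * fval (prj S) l x = fval f l x" using eq pp by (metis mult.assoc)
qed

lemma homog_ext:
  assumes "f \<in> carrier (homog_algebra S)" "g \<in> carrier (homog_algebra S)"
    and "\<And>l x. l < summands S \<Longrightarrow> x \<in> topspace (spc S l) \<Longrightarrow> fval f l x = fval g l x"
  shows "f = g"
proof (rule PiE_ext[of f "{..<summands S}" _ g])
  show "f \<in> (\<Pi>\<^sub>E l\<in>{..<summands S}. carrier (summand_algebra S l))" "g \<in> (\<Pi>\<^sub>E l\<in>{..<summands S}. carrier (summand_algebra S l))"
    using assms(1,2) by (simp_all add: homog_algebra_def direct_sum_algebra_def)
  fix l assume "l \<in> {..<summands S}"
  then have l: "l < summands S" by simp
  have "f l \<in> extensional (topspace (spc S l))" "g l \<in> extensional (topspace (spc S l))"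
    using assms(1,2) l by (auto simp: homog_algebra_defs PiE_iff)
  then show "f l = g l"
  proof (rule extensionalityI)
    fix x assume x: "x \<in> topspace (spc S l)"
    show "f l x = g l x"
      using assms(3)[OF l x] to_fm_inject[OF homog_carrier_matD[OF assms(1) l x] homog_carrier_matD[OF assms(2) l x]]
      by (simp add: fval_def)
  qed
qed

lemma homog_mk:
  assumes "\<And>l. l < summands S \<Longrightarrow> continuous_map (spc S l) euclidean (G l)"
    and fit: "\<And>l x. l < summands S \<Longrightarrow> x \<in> topspace (spc S l) \<Longrightarrow> fits (msize S l) (msize S l) (G l x)"
    and corner: "\<And>l x. l < summands S \<Longrightarrow> x \<in> topspace (spc S l) \<Longrightarrow> fval (prj S) l x * G l x * fval (prj S) l x = G l x"
  shows "homog_mk S G \<in> carrier (homog_algebra S)"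
    and "\<And>l x. l < summands S \<Longrightarrow> x \<in> topspace (spc S l) \<Longrightarrow> fval (homog_mk S G) l x = G l x"
proof -
  show eq: "fval (homog_mk S G) l x = G l x" if "l < summands S" "x \<in> topspace (spc S l)" for l x
    using that fit by (simp add: fval_def homog_mk_def)
  have "homog_mk S G l \<in> extensional (topspace (spc S l)) \<and> cont_mat (spc S l) (msize S l) (msize S l) (homog_mk S G l) \<and>
      (\<forall>x\<in>topspace (spc S l). prj S l x * homog_mk S G l x * prj S l x = homog_mk S G l x)" if l: "l < summands S" for l
  proof (intro conjI ballI)
    show "homog_mk S G l \<in> extensional (topspace (spc S l))" using l by (simp add: homog_mk_def)
    have "continuous_map (spc S l) euclidean (\<lambda>x. to_fm (homog_mk S G l x))"
      using eq[OF l] by (intro continuous_map_eq[OF assms(1)[OF l]]) (auto simp: fval_def)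
    then show "cont_mat (spc S l) (msize S l) (msize S l) (homog_mk S G l)"
      unfolding cont_mat_iff using l by (simp add: homog_mk_def)
    fix x assume x: "x \<in> topspace (spc S l)"
    have cm: "homog_mk S G l x \<in> carrier_mat (msize S l) (msize S l)" using l x by (simp add: homog_mk_def)
    have cp: "prj S l x \<in> carrier_mat (msize S l) (msize S l)" by (rule homogeneousD(6)[OF S l x])
    have "to_fm (prj S l x * homog_mk S G l x * prj S l x) = to_fm (homog_mk S G l x)"
      using to_fm_mult3[OF cp cm cp] corner[OF l x] eq[OF l x] by (simp add: fval_def)
    then show "prj S l x * homog_mk S G l x * prj S l x = homog_mk S G l x"
      using to_fm_inject[OF mult_carrier_mat[OF mult_carrier_mat[OF cp cm] cp] cm] by simp
  qed
  moreover have "homog_mk S G \<in> extensional {..<summands S}" by (simp add: homog_mk_def)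
  ultimately show "homog_mk S G \<in> carrier (homog_algebra S)"
    by (simp add: homog_algebra_defs PiE_iff)
qed

lemma homog_fval_ops:
  assumes l: "l < summands S" "x \<in> topspace (spc S l)"
  shows "fval \<one>\<^bsub>homog_algebra S\<^esub> l x = fval (prj S) l x" 
    and "fval \<zero>\<^bsub>homog_algebra S\<^esub> l x = 0"
    and "f \<in> carrier (homog_algebra S) \<Longrightarrow> fval (c \<odot>\<^bsub>homog_algebra S\<^esub> f) l x = scl c (fval f l x)"
    and "f \<in> carrier (homog_algebra S) \<Longrightarrow> fval (adj (homog_algebra S) f) l x = star (fval f l x)"
    and "f \<in> carrier (homog_algebra S) \<Longrightarrow> g \<in> carrier (homog_algebra S) \<Longrightarrow>
      fval (f \<otimes>\<^bsub>homog_algebra S\<^esub> g) l x = fval f l x * fval g l x"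
    and "f \<in> carrier (homog_algebra S) \<Longrightarrow> g \<in> carrier (homog_algebra S) \<Longrightarrow>
      fval (f \<oplus>\<^bsub>homog_algebra S\<^esub> g) l x = fval f l x + fval g l x"
proof -
  note cm = homog_carrier_matD[OF _ l]
  show "fval \<one>\<^bsub>homog_algebra S\<^esub> l x = fval (prj S) l x" "fval \<zero>\<^bsub>homog_algebra S\<^esub> l x = 0"
    using l by (simp_all add: fval_def homog_algebra_defs)
  show "f \<in> carrier (homog_algebra S) \<Longrightarrow> fval (c \<odot>\<^bsub>homog_algebra S\<^esub> f) l x = scl c (fval f l x)"
    using l by (simp add: fval_def to_fm_smult homog_algebra_defs)
  show "f \<in> carrier (homog_algebra S) \<Longrightarrow> fval (adj (homog_algebra S) f) l x = star (fval f l x)"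
    using l cm[of f] by (simp add: fval_def to_fm_adjoint homog_algebra_defs)
  show "f \<in> carrier (homog_algebra S) \<Longrightarrow> g \<in> carrier (homog_algebra S) \<Longrightarrow>
      fval (f \<otimes>\<^bsub>homog_algebra S\<^esub> g) l x = fval f l x * fval g l x"
    using l to_fm_mult[OF cm[of f] cm[of g]] by (simp add: fval_def homog_algebra_defs)
  show "f \<in> carrier (homog_algebra S) \<Longrightarrow> g \<in> carrier (homog_algebra S) \<Longrightarrow>
      fval (f \<oplus>\<^bsub>homog_algebra S\<^esub> g) l x = fval f l x + fval g l x"
    using l to_fm_add[OF cm[of f] cm[of g]] by (simp add: fval_def homog_algebra_defs)
qed

lemma homog_mk_fval:
  assumes ext: "f \<in> extensional {..<summands S}" "\<And>l. l < summands S \<Longrightarrow> f l \<in> extensional (topspace (spc S l))"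
    and car: "\<And>l x. l < summands S \<Longrightarrow> x \<in> topspace (spc S l) \<Longrightarrow> f l x \<in> carrier_mat (msize S l) (msize S l)"
  shows "homog_mk S (fval f) = f"
proof
  fix l
  show "homog_mk S (fval f) l = f l"
  proof (cases "l < summands S")
    case True
    show ?thesis
    proof
      fix x
      show "homog_mk S (fval f) l x = f l x"
        using True car[OF True, of x] ext(2)[OF True] by (cases "x \<in> topspace (spc S l)")
          (simp_all add: homog_mk_def fval_def of_fm_to_fm extensional_def)
    qed
  next
    case False
    then show ?thesis using ext(1) by (simp add: homog_mk_def extensional_def)
  qed
qed

lemma homog_closed:
  shows "\<one>\<^bsub>homog_algebra S\<^esub> \<in> carrier (homog_algebra S)"
    and "\<zero>\<^bsub>homog_algebra S\<^esub> \<in> carrier (homog_algebra S)"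
    and "f \<in> carrier (homog_algebra S) \<Longrightarrow> c \<odot>\<^bsub>homog_algebra S\<^esub> f \<in> carrier (homog_algebra S)"
    and "f \<in> carrier (homog_algebra S) \<Longrightarrow> adj (homog_algebra S) f \<in> carrier (homog_algebra S)"
    and "f \<in> carrier (homog_algebra S) \<Longrightarrow> g \<in> carrier (homog_algebra S) \<Longrightarrow>
      f \<otimes>\<^bsub>homog_algebra S\<^esub> g \<in> carrier (homog_algebra S)"
    and "f \<in> carrier (homog_algebra S) \<Longrightarrow> g \<in> carrier (homog_algebra S) \<Longrightarrow>
      f \<oplus>\<^bsub>homog_algebra S\<^esub> g \<in> carrier (homog_algebra S)"
proof -
  have key: "f \<in> carrier (homog_algebra S)"
    if ext: "f \<in> extensional {..<summands S}" "\<And>l. l < summands S \<Longrightarrow> f l \<in> extensional (topspace (spc S l))"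
    and car: "\<And>l x. l < summands S \<Longrightarrow> x \<in> topspace (spc S l) \<Longrightarrow> f l x \<in> carrier_mat (msize S l) (msize S l)"
    and eq: "\<And>l x. l < summands S \<Longrightarrow> x \<in> topspace (spc S l) \<Longrightarrow> fval f l x = G l x"
    and cont: "\<And>l. l < summands S \<Longrightarrow> continuous_map (spc S l) euclidean (G l)"
    and corner: "\<And>l x. l < summands S \<Longrightarrow> x \<in> topspace (spc S l) \<Longrightarrow> fval (prj S) l x * G l x * fval (prj S) l x = G l x"
    for f and G :: "nat \<Rightarrow> 'x \<Rightarrow> fmat"
  proof -
    have "homog_mk S (fval f) \<in> carrier (homog_algebra S)"
    proof (rule homog_mk(1))
      fix l assume l: "l < summands S"
      show "continuous_map (spc S l) euclidean (fval f l)"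
        by (rule continuous_map_eq[OF cont[OF l]]) (simp add: eq l)
      fix x assume x: "x \<in> topspace (spc S l)"
      show "fits (msize S l) (msize S l) (fval f l x)" unfolding fval_def by (rule fits_to_fm[OF car[OF l x]])
      show "fval (prj S) l x * fval f l x * fval (prj S) l x = fval f l x" using corner[OF l x] eq[OF l x] by simp
    qed
    then show ?thesis using homog_mk_fval[OF ext car] by simp
  qed
  note cm = homog_carrier_matD
  note ops = homog_fval_ops
  show "\<one>\<^bsub>homog_algebra S\<^esub> \<in> carrier (homog_algebra S)"
    by (rule key[where G = "fval (prj S)"]) (simp_all add: ops homogeneousD[OF S], simp_all add: homog_algebra_defs homogeneousD[OF S])
  show "\<zero>\<^bsub>homog_algebra S\<^esub> \<in> carrier (homog_algebra S)"
    by (rule key[where G = "\<lambda>_ _. 0"]) (simp_all add: ops, simp_all add: homog_algebra_defs)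
  assume f: "f \<in> carrier (homog_algebra S)"
  note fD = homog_carrierD[OF f]
  have sc: "continuous_map X euclidean (\<lambda>x. scl c (F x))" if "continuous_map X euclidean F" for X and F :: "'x \<Rightarrow> fmat"
  proof -
    have "((\<lambda>x. scl c (F x)) \<longlongrightarrow> scl c l) A" if "(F \<longlongrightarrow> l) A" for l A
    proof -
      have "((\<lambda>x. cmod c * norm (F x - l)) \<longlongrightarrow> cmod c * norm (l - l)) A" by (intro tendsto_intros that)
      moreover have "scl c (F x) - scl c l = scl c (F x - l)" for x by (rule fmat_eqI) (simp add: algebra_simps)
      ultimately show ?thesis unfolding tendsto_iff dist_norm by (simp add: norm_scl)
    qed
    then show ?thesis using that unfolding continuous_map_tendsto by blast
  qed
  show "c \<odot>\<^bsub>homog_algebra S\<^esub> f \<in> carrier (homog_algebra S)"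
    by (rule key[where G = "\<lambda>l x. scl c (fval f l x)"])
      (simp_all add: ops f sc fD scl_mult, simp_all add: homog_algebra_defs cm[OF f])
  have sp: "star (fval f l x) * fval (prj S) l x = star (fval f l x)" "fval (prj S) l x * star (fval f l x) = star (fval f l x)"
    if "l < summands S" "x \<in> topspace (spc S l)" for l x
    using arg_cong[OF fD(3)[OF that], of star] arg_cong[OF fD(4)[OF that], of star] homogeneousD(9)[OF S that] by simp_all
  show "adj (homog_algebra S) f \<in> carrier (homog_algebra S)"
    by (rule key[where G = "\<lambda>l x. star (fval f l x)"])
      (simp_all add: ops f continuous_map_fmat(6) fD sp, simp_all add: homog_algebra_defs cm[OF f] mat_adjoint_carrier)
  assume g: "g \<in> carrier (homog_algebra S)"
  note gD = homog_carrierD[OF g]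
  show "f \<otimes>\<^bsub>homog_algebra S\<^esub> g \<in> carrier (homog_algebra S)"
    by (rule key[where G = "\<lambda>l x. fval f l x * fval g l x"])
      (simp_all add: ops f g continuous_map_fmat(3) fD gD mult.assoc,
       simp_all add: homog_algebra_defs mult_carrier_mat[OF cm[OF f] cm[OF g]] fD gD flip: mult.assoc)
  show "f \<oplus>\<^bsub>homog_algebra S\<^esub> g \<in> carrier (homog_algebra S)"
    by (rule key[where G = "\<lambda>l x. fval f l x + fval g l x"])
      (simp_all add: ops f g continuous_map_fmat(1) fD gD distrib_left distrib_right,
       simp_all add: homog_algebra_defs cm[OF g])
qed

text \<open>Inequalities with an arbitrary bound take the place of the maxima and suprema in the definition of the norm.\<close>

lemma homog_cnorm_le_iff:
  assumes f: "f \<in> carrier (homog_algebra S)"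
  shows "cnorm (homog_algebra S) f \<le> c \<longleftrightarrow> (\<forall>l<summands S. \<forall>x\<in>topspace (spc S l). norm (fval f l x) \<le> c)"
proof -
  have "cnorm (homog_algebra S) f = (MAX l\<in>{..<summands S}. SUP x\<in>topspace (spc S l). norm (fval f l x))"
    by (simp add: homog_algebra_defs mat_opnorm_eq fval_def)
  moreover have "{..<summands S} \<noteq> {}" using S by (auto simp: homogeneous_def)
  moreover have "(SUP x\<in>topspace (spc S l). norm (fval f l x)) \<le> c \<longleftrightarrow> (\<forall>x\<in>topspace (spc S l). norm (fval f l x) \<le> c)"
    if l: "l < summands S" for l
  proof (rule cSUP_le_iff)
    show "topspace (spc S l) \<noteq> {}" using homogeneousD(1)[OF S l] .
    have "compactin euclideanreal ((\<lambda>x. norm (fval f l x)) ` topspace (spc S l))"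
      using image_compactin[OF homogeneousD(2)[OF S l, unfolded compact_space_def] continuous_map_fmat(5)[OF homog_carrierD(1)[OF f l]]] .
    then have "bounded ((\<lambda>x. norm (fval f l x)) ` topspace (spc S l))" by (simp add: compact_imp_bounded)
    then show "bdd_above ((\<lambda>x. norm (fval f l x)) ` topspace (spc S l))" by (rule bounded_imp_bdd_above)
  qed
  ultimately show ?thesis by (auto simp: Max_le_iff)
qed

end

section \<open>Block systems\<close>

lemma sum_mult_orthogonal:
  fixes f g :: "'i \<Rightarrow> fmat"
  assumes "finite I" "\<And>i j. i \<in> I \<Longrightarrow> j \<in> I \<Longrightarrow> i \<noteq> j \<Longrightarrow> f i * g j = 0"
  shows "(\<Sum>i\<in>I. f i) * (\<Sum>j\<in>I. g j) = (\<Sum>i\<in>I. f i * g i)"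
proof -
  have "(\<Sum>i\<in>I. f i) * (\<Sum>j\<in>I. g j) = (\<Sum>i\<in>I. \<Sum>j\<in>I. f i * g j)" by (rule sum_product)
  also have "\<dots> = (\<Sum>i\<in>I. f i * g i)"
  proof (rule sum.cong[OF refl])
    fix i assume i: "i \<in> I"
    have "(\<Sum>j\<in>I. f i * g j) = (\<Sum>j\<in>{i}. f i * g j)"
      using assms i by (intro sum.mono_neutral_right) auto
    then show "(\<Sum>j\<in>I. f i * g j) = f i * g i" by simp
  qed
  finally show ?thesis .
qed

text \<open>The range of \<open>J b\<close> is the place of the block \<open>b\<close>: these are isometries with orthogonal ranges.\<close>

definition block_system :: "'b set \<Rightarrow> ('b \<Rightarrow> nat) \<Rightarrow> ('b \<Rightarrow> fmat) \<Rightarrow> bool" where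
  "block_system B r J \<longleftrightarrow> finite B \<and> (\<forall>b\<in>B. \<forall>b'\<in>B. star (J b) * J b' = (if b = b' then idm (r b) else 0))"

definition block_diag :: "'b set \<Rightarrow> ('b \<Rightarrow> fmat) \<Rightarrow> ('b \<Rightarrow> fmat) \<Rightarrow> fmat" where
  "block_diag B J F = (\<Sum>b\<in>B. J b * F b * star (J b))"

lemma star_block_diag: "star (block_diag B J F) = block_diag B J (\<lambda>b. star (F b))"
  by (simp add: block_diag_def mult.assoc)

lemma block_diag_mult:
  assumes B: "block_system B r J" and F: "\<And>b. b \<in> B \<Longrightarrow> fits (r b) (r b) (F b)"
  shows "block_diag B J F * block_diag B J G = block_diag B J (\<lambda>b. F b * G b)"
proof -
  have eq: "(J b * F b * star (J b)) * (J b' * G b' * star (J b')) = J b * F b * (star (J b) * J b') * (G b' * star (J b'))" for b b'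
    by (simp add: mult.assoc)
  have "block_diag B J F * block_diag B J G = (\<Sum>b\<in>B. (J b * F b * star (J b)) * (J b * G b * star (J b)))"
    unfolding block_diag_def
    by (rule sum_mult_orthogonal) (use B in \<open>auto simp: block_system_def eq\<close>)
  also have "\<dots> = block_diag B J (\<lambda>b. F b * G b)"
    unfolding block_diag_def
  proof (rule sum.cong[OF refl])
    fix b assume b: "b \<in> B"
    have "(J b * F b * star (J b)) * (J b * G b * star (J b)) = J b * (F b * idm (r b)) * (G b * star (J b))"
      unfolding eq using B b by (simp add: block_system_def mult.assoc)
    then show "(J b * F b * star (J b)) * (J b * G b * star (J b)) = J b * (F b * G b) * star (J b)"
      unfolding idm_right[OF F[OF b] order_refl] by (simp add: mult.assoc)
  qed
  finally show ?thesis .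
qed

lemma norm_block_le_1: assumes "block_system B r J" "b \<in> B" shows "norm (J b) \<le> 1"
  by (rule norm_partial_isometry_le_1[of "idm (r b)"])
     (use assms in \<open>auto simp: block_system_def intro: idm_left[of "r b" "r b"]\<close>)

lemma norm_block_diag_ge:
  assumes B: "block_system B r J" and F: "\<And>b. b \<in> B \<Longrightarrow> fits (r b) (r b) (F b)" and b: "b \<in> B"
  shows "norm (F b) \<le> norm (block_diag B J F)"
proof -
  have "star (J b) * block_diag B J F * J b = (\<Sum>b'\<in>B. (star (J b) * J b') * F b' * (star (J b') * J b))"
    by (simp add: block_diag_def sum_distrib_left sum_distrib_right mult.assoc)
  also have "\<dots> = (\<Sum>b'\<in>{b}. (star (J b) * J b') * F b' * (star (J b') * J b))"
    using B b by (intro sum.mono_neutral_right) (auto simp: block_system_def)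
  also have "\<dots> = F b" using B b F[OF b] by (simp add: block_system_def idm_left[OF F] idm_right[OF F])
  finally have "norm (F b) = norm (star (J b) * block_diag B J F * J b)" by simp
  also have "\<dots> \<le> (1 * norm (block_diag B J F)) * 1"
    by (intro order_trans[OF norm_mult_ineq] mult_mono) (use norm_block_le_1[OF B b] in auto)
  finally show ?thesis by simp
qed

text \<open>By the C*-identity, \<open>\<parallel>D\<parallel>\<close> raised to the power \<open>2\<^sup>m\<close> is the norm of a block diagonal matrix
 with blocks of norm at most \<open>c\<close> raised to the same power. The triangle inequality loses the factor \<open>card B\<close> there, and taking roots
 makes this loss disappear as \<open>m\<close> grows.\<close>

lemma norm_block_diag_le:
  assumes B: "block_system B r J" and F: "\<And>b. b \<in> B \<Longrightarrow> fits (r b) (r b) (F b)"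
    and c: "\<And>b. b \<in> B \<Longrightarrow> norm (F b) \<le> c" "0 \<le> c"
  shows "norm (block_diag B J F) \<le> c"
proof -
  have pow: "norm (block_diag B J F) ^ (2 ^ m) \<le> card B * c ^ (2 ^ m)"
    if "\<And>b. b \<in> B \<Longrightarrow> fits (r b) (r b) (F b)" "\<And>b. b \<in> B \<Longrightarrow> norm (F b) \<le> c" "0 \<le> c" for m F and c :: real
    using that
  proof (induction m arbitrary: F c)
    case 0
    have "norm (block_diag B J F) \<le> (\<Sum>b\<in>B. norm (J b * F b * star (J b)))"
      unfolding block_diag_def by (rule norm_sum)
    also have "\<dots> \<le> (\<Sum>b\<in>B. (1 * c) * 1)"
      by (intro sum_mono order_trans[OF norm_mult_ineq] mult_mono) (use 0 norm_block_le_1[OF B] in auto)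
    finally show ?case by simp
  next
    case (Suc m)
    have fs: "fits (r b) (r b) (star (F b) * F b)" if "b \<in> B" for b
      using Suc.prems(1)[OF that] by (intro fits_times[of _ "r b"]) auto
    have "norm (block_diag B J F) ^ (2 ^ Suc m) = (norm (star (block_diag B J F) * block_diag B J F)) ^ (2 ^ m)"
      by (simp add: norm_star_times power_mult[symmetric] del: star_sum)
    also have "star (block_diag B J F) * block_diag B J F = block_diag B J (\<lambda>b. star (F b) * F b)"
      unfolding star_block_diag by (rule block_diag_mult[OF B]) (use Suc.prems in auto)
    also have "norm \<dots> ^ (2 ^ m) \<le> card B * (c\<^sup>2) ^ (2 ^ m)"
    proof (rule Suc.IH[OF fs])
      show "norm (star (F b) * F b) \<le> c\<^sup>2" if "b \<in> B" for b
        unfolding norm_star_times using Suc.prems(2)[OF that] by (intro power_mono) auto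
    qed auto
    finally show ?case by (simp add: power_mult[symmetric])
  qed
  let ?D = "norm (block_diag B J F)"
  show ?thesis
  proof (rule ccontr)
    assume "\<not> ?D \<le> c"
    then have gt: "c < ?D" by simp
    show False
    proof (cases "c = 0")
      case True
      then show False using pow[OF F c, of 0] gt by simp
    next
      case False
      then have c0: "0 < c" using c by simp
      have "1 < ?D / c" using gt c0 by simp
      then obtain n where n: "real (card B) < (?D / c) ^ n" using real_arch_pow by blast
      have "n \<le> 2 ^ n" by (simp add: less_imp_le)
      then have "(?D / c) ^ n \<le> (?D / c) ^ (2 ^ n)" using \<open>1 < ?D / c\<close> by (intro power_increasing) auto
      also have "\<dots> \<le> card B" using pow[OF F c, of n] c0 by (simp add: power_divide pos_divide_le_eq)
      finally show False using n by simp
    qed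
  qed
qed

lemma block_diag_diff: "block_diag B J F - block_diag B J G = block_diag B J (\<lambda>b. F b - G b)"
  unfolding block_diag_def by (simp add: sum_subtractf algebra_simps)

lemma fits_block_diag:
  assumes "\<And>b. b \<in> B \<Longrightarrow> fits R (r b) (J b)" "\<And>b. b \<in> B \<Longrightarrow> fits (r b) (r b) (F b)"
  shows "fits R R (block_diag B J F)"
  unfolding block_diag_def
proof (rule fits_sum)
  fix b assume b: "b \<in> B"
  have "fits (r b) R (star (J b))" using assms(1)[OF b] by simp
  then show "fits R R (J b * F b * star (J b))"
    by (intro fits_times[OF fits_times[OF assms(1)[OF b] assms(2)[OF b]]])
qed

lemma blk_mult_blk: "s + r \<le> M \<Longrightarrow> blk M u * blk r s = blk r (u + s)"
proof (rule fmat_eqI)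
  fix i j :: nat assume "s + r \<le> M"
  have "ent (blk M u * blk r s) i j = (\<Sum>k<M. if k = s + j then (if j < r \<and> i = u + s + j then 1 else 0) else 0)"
    unfolding ent_times[OF fits_blk[of u M "u + M", OF order_refl]] by (intro sum.cong) auto
  then show "ent (blk M u * blk r s) i j = ent (blk r (u + s)) i j" using \<open>s + r \<le> M\<close> by auto
qed

section \<open>Diagonal maps\<close>

lemma fval_hom:
  assumes S: "homogeneous S" and T: "homogeneous T" and \<phi>: "\<phi> \<in> star_hom (homog_algebra S) (homog_algebra T)"
    and k: "k < summands T" "x \<in> topspace (spc T k)"
  shows "f \<in> carrier (homog_algebra S) \<Longrightarrow> \<phi> f \<in> carrier (homog_algebra T)"
    and "f \<in> carrier (homog_algebra S) \<Longrightarrow> g \<in> carrier (homog_algebra S) \<Longrightarrow>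
      fval (\<phi> (f \<oplus>\<^bsub>homog_algebra S\<^esub> g)) k x = fval (\<phi> f) k x + fval (\<phi> g) k x"
    and "f \<in> carrier (homog_algebra S) \<Longrightarrow> g \<in> carrier (homog_algebra S) \<Longrightarrow>
      fval (\<phi> (f \<otimes>\<^bsub>homog_algebra S\<^esub> g)) k x = fval (\<phi> f) k x * fval (\<phi> g) k x"
    and "fval (\<phi> \<one>\<^bsub>homog_algebra S\<^esub>) k x = fval (prj T) k x"
    and "fval (\<phi> \<zero>\<^bsub>homog_algebra S\<^esub>) k x = 0"
proof -
  have hom: "\<phi> \<in> Ring.ring_hom (homog_algebra S) (homog_algebra T)" using \<phi> by (simp add: star_hom_def)
  show c: "\<phi> f \<in> carrier (homog_algebra T)" if "f \<in> carrier (homog_algebra S)" for f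
    using ring_hom_closed[OF hom that] .
  show add: "fval (\<phi> (f \<oplus>\<^bsub>homog_algebra S\<^esub> g)) k x = fval (\<phi> f) k x + fval (\<phi> g) k x"
    if "f \<in> carrier (homog_algebra S)" "g \<in> carrier (homog_algebra S)" for f g
    unfolding ring_hom_add[OF hom that] by (rule homog_fval_ops(6)[OF T k c[OF that(1)] c[OF that(2)]])
  show "fval (\<phi> (f \<otimes>\<^bsub>homog_algebra S\<^esub> g)) k x = fval (\<phi> f) k x * fval (\<phi> g) k x"
    if "f \<in> carrier (homog_algebra S)" "g \<in> carrier (homog_algebra S)" for f g
    unfolding ring_hom_mult[OF hom that] by (rule homog_fval_ops(5)[OF T k c[OF that(1)] c[OF that(2)]])
  show "fval (\<phi> \<one>\<^bsub>homog_algebra S\<^esub>) k x = fval (prj T) k x"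
    unfolding ring_hom_one[OF hom] by (rule homog_fval_ops(1)[OF T k])
  have z: "\<zero>\<^bsub>homog_algebra S\<^esub> \<in> carrier (homog_algebra S)" by (rule homog_closed(2)[OF S])
  have "\<zero>\<^bsub>homog_algebra S\<^esub> \<oplus>\<^bsub>homog_algebra S\<^esub> \<zero>\<^bsub>homog_algebra S\<^esub> = \<zero>\<^bsub>homog_algebra S\<^esub>"
    by (rule homog_ext[OF S]) (simp_all add: homog_closed[OF S] homog_fval_ops[OF S])
  then show "fval (\<phi> \<zero>\<^bsub>homog_algebra S\<^esub>) k x = 0" using add[OF z z] by simp
qed

lemma homog_sum_embed:
  assumes S: "homogeneous S" and T: "homogeneous T" and \<phi>: "\<phi> \<in> star_hom (homog_algebra S) (homog_algebra T)"
    and k: "k < summands T" "x \<in> topspace (spc T k)" and f: "f \<in> carrier (homog_algebra S)"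
  shows "fval (\<phi> f) k x = (\<Sum>l<summands S. fval (\<phi> (summand_embed S l (f l))) k x)"
    and "\<And>l. l < summands S \<Longrightarrow> f l \<in> carrier (summand_algebra S l)"
    and "\<And>l. l < summands S \<Longrightarrow> summand_embed S l (f l) \<in> carrier (homog_algebra S)"
    and "\<And>l l' y. l < summands S \<Longrightarrow> l' < summands S \<Longrightarrow> y \<in> topspace (spc S l') \<Longrightarrow>
      fval (summand_embed S l (f l)) l' y = (if l' = l then fval f l y else 0)"
proof -
  note hom = fval_hom[OF S T \<phi> k]
  have fl: "f l \<in> carrier (summand_algebra S l)" if "l < summands S" for l
    using f that by (auto simp: homog_algebra_def direct_sum_algebra_def)
  have zl: "\<zero>\<^bsub>summand_algebra S l\<^esub> \<in> carrier (summand_algebra S l)" if "l < summands S" for l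
    using homog_closed(2)[OF S] that by (auto simp: homog_algebra_def direct_sum_algebra_def)
  have z0: "to_fm (\<zero>\<^bsub>summand_algebra S l\<^esub> y) = 0" if "y \<in> topspace (spc S l)" for l y
    using that by (simp add: summand_algebra_def corner_algebra_def)
  define F where "F n = (\<lambda>l\<in>{..<summands S}. if l < n then f l else \<zero>\<^bsub>summand_algebra S l\<^esub>)" for n
  have F: "F n \<in> carrier (homog_algebra S)" for n
    using fl zl by (auto simp: homog_algebra_def direct_sum_algebra_def F_def)
  have hF: "fval (F n) l y = (if l < n then fval f l y else 0)" if "l < summands S" "y \<in> topspace (spc S l)" for n l y
    using that z0 by (simp add: F_def fval_def)
  have E: "summand_embed S l (f l) \<in> carrier (homog_algebra S)" if "l < summands S" for l
    using fl zl that by (auto simp: homog_algebra_def direct_sum_algebra_def summand_embed_def)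
  have hE: "fval (summand_embed S l (f l)) l' y = (if l' = l then fval f l y else 0)"
    if "l < summands S" "l' < summands S" "y \<in> topspace (spc S l')" for l l' y
    using that z0 by (simp add: summand_embed_def fval_def)
  have "n \<le> summands S \<Longrightarrow> fval (\<phi> (F n)) k x = (\<Sum>l<n. fval (\<phi> (summand_embed S l (f l))) k x)" for n
  proof (induction n)
    case 0
    have "F 0 = \<zero>\<^bsub>homog_algebra S\<^esub>"
      by (rule homog_ext[OF S F homog_closed(2)[OF S]]) (simp add: hF homog_fval_ops[OF S])
    then show ?case using hom(5) by simp
  next
    case (Suc n)
    then have n: "n < summands S" by simp
    have "F (Suc n) = F n \<oplus>\<^bsub>homog_algebra S\<^esub> summand_embed S n (f n)"
    proof (rule homog_ext[OF S F homog_closed(6)[OF S F E[OF n]]])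
      fix l y assume l: "l < summands S" "y \<in> topspace (spc S l)"
      show "fval (F (Suc n)) l y = fval (F n \<oplus>\<^bsub>homog_algebra S\<^esub> summand_embed S n (f n)) l y"
        unfolding homog_fval_ops(6)[OF S l F E[OF n]] hE[OF n l] hF[OF l] by auto
    qed
    then show ?case using hom(2)[OF F E[OF n]] Suc by simp
  qed
  from this[of "summands S"] have "fval (\<phi> (F (summands S))) k x = (\<Sum>l<summands S. fval (\<phi> (summand_embed S l (f l))) k x)" by simp
  moreover have "F (summands S) = f" by (rule homog_ext[OF S F f]) (simp add: hF)
  ultimately show "fval (\<phi> f) k x = (\<Sum>l<summands S. fval (\<phi> (summand_embed S l (f l))) k x)" by simp
  show "\<And>l. l < summands S \<Longrightarrow> f l \<in> carrier (summand_algebra S l)" by (rule fl)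
  show "\<And>l. l < summands S \<Longrightarrow> summand_embed S l (f l) \<in> carrier (homog_algebra S)" by (rule E)
  show "\<And>l l' y. l < summands S \<Longrightarrow> l' < summands S \<Longrightarrow> y \<in> topspace (spc S l') \<Longrightarrow>
      fval (summand_embed S l (f l)) l' y = (if l' = l then fval f l y else 0)" by (rule hE)
qed

text \<open>All summands of the source at once. The partial isometries \<open>v\<^sub>l\<close> in the diagonal forms of the components have orthogonal
 initial projections \<open>Q\<^sub>l\<close>, as these are, up to \<open>U\<close>, the images of the orthogonal central projections of the source,
 and the \<open>Q\<^sub>l\<close> add up to the unit of the target. Hence stacking the \<open>v\<^sub>l\<close> on top of each other, and absorbing the unitary \<open>U\<close>,
 yields one partial isometry \<open>W\<close> that conjugates \<open>\<phi>\<close> into block diagonal form.\<close>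

lemma diagonal_representation:
  fixes S T :: "'x homog_data"
  assumes S: "homogeneous S" and T: "homogeneous T" and \<phi>: "\<phi> \<in> star_hom (homog_algebra S) (homog_algebra T)"
    and U: "U \<in> unitary_elements (homog_algebra T)" and k: "k < summands T"
    and L: "\<And>l s x. l < summands S \<Longrightarrow> s < m l \<Longrightarrow> x \<in> topspace (spc T k) \<Longrightarrow> L l s x \<in> topspace (spc S l)"
    and diag: "\<And>l. l < summands S \<Longrightarrow> diagonal_form S l T k (m l) (L l)
      (\<lambda>f. (U \<otimes>\<^bsub>homog_algebra T\<^esub> \<phi> (summand_embed S l f) \<otimes>\<^bsub>homog_algebra T\<^esub> adj (homog_algebra T) U) k)"
  defines "B \<equiv> SIGMA l:{..<summands S}. {..<m l}"
  shows "\<exists>R J W. block_system B (\<lambda>b. msize S (fst b)) J \<and> (\<forall>b\<in>B. fits R (msize S (fst b)) (J b)) \<and>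
     continuous_map (spc T k) euclidean W \<and> (\<forall>x\<in>topspace (spc T k). fits R (msize T k) (W x) \<and>
       star (W x) * W x = fval (prj T) k x \<and>
       W x * star (W x) = block_diag B J (\<lambda>b. fval (prj S) (fst b) (L (fst b) (snd b) x)) \<and>
       (\<forall>f\<in>carrier (homog_algebra S). 
         fval (\<phi> f) k x = star (W x) * block_diag B J (\<lambda>b. fval f (fst b) (L (fst b) (snd b) x)) * W x))"
proof -
  let ?A = "homog_algebra S" and ?B = "homog_algebra T"
  define h where "h = summands S"
  define t where "t = msize T k"
  define M where "M l = m l * msize S l" for l
  have "\<forall>l\<in>{..<h}. \<exists>v. cont_mat (spc T k) (M l) t v \<and>
        (\<forall>x\<in>topspace (spc T k).
           v x * mat_adjoint (v x) = diag_block_mat (map (\<lambda>s. prj S l (L l s x)) [0..<m l]) \<and>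
           (\<forall>f\<in>carrier (summand_algebra S l).
              (U \<otimes>\<^bsub>?B\<^esub> \<phi> (summand_embed S l f) \<otimes>\<^bsub>?B\<^esub> adj ?B U) k x
              = mat_adjoint (v x) * diag_block_mat (map (\<lambda>s. f (L l s x)) [0..<m l]) * v x))"
    using diag unfolding diagonal_form_def M_def t_def h_def by auto
  from bchoice[OF this] obtain v where vc: "\<And>l. l < h \<Longrightarrow> cont_mat (spc T k) (M l) t (v l)"
    and vv: "\<And>l x. l < h \<Longrightarrow> x \<in> topspace (spc T k) \<Longrightarrow>
       v l x * mat_adjoint (v l x) = diag_block_mat (map (\<lambda>s. prj S l (L l s x)) [0..<m l])"
    and v\<phi>: "\<And>l x f. l < h \<Longrightarrow> x \<in> topspace (spc T k) \<Longrightarrow> f \<in> carrier (summand_algebra S l) \<Longrightarrow>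
       (U \<otimes>\<^bsub>?B\<^esub> \<phi> (summand_embed S l f) \<otimes>\<^bsub>?B\<^esub> adj ?B U) k x
              = mat_adjoint (v l x) * diag_block_mat (map (\<lambda>s. f (L l s x)) [0..<m l]) * v l x"
    by auto
  define V where "V l x = to_fm (v l x)" for l x
  have Vc: "continuous_map (spc T k) euclidean (V l)" if "l < h" for l
    using vc[OF that] unfolding cont_mat_iff V_def by blast
  have vm: "v l x \<in> carrier_mat (M l) t" if "l < h" "x \<in> topspace (spc T k)" for l x
    using vc[OF that(1)] that(2) unfolding cont_mat_iff by blast
  have Vf: "fits (M l) t (V l x)" "fits t (M l) (star (V l x))" if "l < h" "x \<in> topspace (spc T k)" for l x
    using fits_to_fm[OF vm[OF that]] by (simp_all add: V_def)
  have UA: "U \<in> carrier ?B" "adj ?B U \<otimes>\<^bsub>?B\<^esub> U = \<one>\<^bsub>?B\<^esub>" "U \<otimes>\<^bsub>?B\<^esub> adj ?B U = \<one>\<^bsub>?B\<^esub>"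
    using U by (auto simp: unitary_elements_def)
  have Ua: "adj ?B U \<in> carrier ?B" by (rule homog_closed(4)[OF T UA(1)])
  define u where "u x = fval U k x" for x
  define p where "p x = fval (prj T) k x" for x
  have uc: "continuous_map (spc T k) euclidean u" using homog_carrierD(1)[OF T UA(1) k] by (simp add: u_def[abs_def])
  define Dl where "Dl l F x = block_diag {..<m l} (\<lambda>s. blk (msize S l) (s * msize S l)) (\<lambda>s. F (L l s x))" for l x and F :: "'x \<Rightarrow> fmat"
  define off where "off l = (\<Sum>l'<l. M l')" for l
  define R where "R = off h"
  define J where "J b = blk (msize S (fst b)) (off (fst b) + snd b * msize S (fst b))" for b :: "nat \<times> nat"
  have off_le: "off l + M l \<le> off l'" if "l < l'" for l l'
  proof -
    have "off l + M l = (\<Sum>i<Suc l. M i)" by (simp add: off_def)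
    also have "\<dots> \<le> off l'" unfolding off_def using that by (intro sum_mono2) auto
    finally show ?thesis .
  qed
  have s_le: "s * msize S l + msize S l \<le> M l" if "s < m l" for s l
  proof -
    have "s * msize S l + msize S l = Suc s * msize S l" by simp
    also have "\<dots> \<le> m l * msize S l" using that by (intro mult_right_mono) auto
    finally show ?thesis by (simp add: M_def)
  qed
  have finB: "finite B" by (simp add: B_def)
  have bs: "block_system B (\<lambda>b. msize S (fst b)) J"
    unfolding block_system_def
  proof (intro conjI ballI finB)
    fix b b' assume b: "b \<in> B" "b' \<in> B"
    obtain l s l' s' where eq: "b = (l, s)" "b' = (l', s')" by (metis surj_pair)
    have s: "s < m l" "s' < m l'" "l < h" "l' < h" using b eq by (auto simp: B_def h_def)
    show "star (J b) * J b' = (if b = b' then idm (msize S (fst b)) else 0)"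
    proof (cases "b = b'")
      case True then show ?thesis by (simp add: J_def star_blk_blk)
    next
      case False
      have "off l + s * msize S l + msize S l \<le> off l' + s' * msize S l' \<or> off l' + s' * msize S l' + msize S l' \<le> off l + s * msize S l"
      proof (cases "l = l'")
        case True
        then have "s < s' \<or> s' < s" using False eq by auto
        then have "Suc s * msize S l \<le> s' * msize S l \<or> Suc s' * msize S l \<le> s * msize S l"
          using mult_le_mono1[of "Suc s" s' "msize S l"] mult_le_mono1[of "Suc s'" s "msize S l"] by auto
        then show ?thesis using True by auto
      next
        case False
        then show ?thesis using off_le[of l l'] off_le[of l' l] s_le[OF s(1)] s_le[OF s(2)] by linarith
      qed
      then have "star (J b) * J b' = 0" unfolding J_def eq fst_conv snd_conv by (rule star_blk_blk_disjoint)
      then show ?thesis using False by simp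
    qed
  qed
  have fJ: "fits R (msize S (fst b)) (J b)" if "b \<in> B" for b
  proof -
    have "snd b < m (fst b)" "fst b < h" using that by (auto simp: B_def h_def)
    then show ?thesis unfolding J_def R_def using s_le[of "snd b" "fst b"] off_le[of "fst b" h] by (intro fits_blk) linarith
  qed
  define Bl where "Bl l = blk (M l) (off l)" for l
  have Bl_orth: "star (Bl l) * Bl l' = 0" if "l \<noteq> l'" for l l'
    unfolding Bl_def using off_le[of l l'] off_le[of l' l] that by (intro star_blk_blk_disjoint) linarith
  have Bl_id: "star (Bl l) * Bl l = idm (M l)" for l unfolding Bl_def by (rule star_blk_blk)
  have Bl_fits: "fits R (M l) (Bl l)" if "l < h" for l
    unfolding Bl_def R_def by (rule fits_blk[OF off_le[OF that]])
  have BlDl: "(\<Sum>l<h. Bl l * Dl l (fval f l) x * star (Bl l)) = block_diag B J (\<lambda>b. fval f (fst b) (L (fst b) (snd b) x))" for f x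
  proof -
    have "Bl l * Dl l (fval f l) x * star (Bl l) = (\<Sum>s<m l. J (l, s) * fval f l (L l s x) * star (J (l, s)))" for l
    proof -
      have "Bl l * Dl l (fval f l) x * star (Bl l) =
         (\<Sum>s<m l. (Bl l * blk (msize S l) (s * msize S l)) * fval f l (L l s x) * star (Bl l * blk (msize S l) (s * msize S l)))"
        by (simp add: Dl_def block_diag_def sum_distrib_left sum_distrib_right mult.assoc)
      also have "\<dots> = (\<Sum>s<m l. J (l, s) * fval f l (L l s x) * star (J (l, s)))"
        using s_le by (intro sum.cong refl) (simp add: Bl_def J_def blk_mult_blk)
      finally show ?thesis .
    qed
    then show ?thesis unfolding block_diag_def B_def h_def by (simp add: sum.Sigma case_prod_unfold)
  qed
  \<comment> \<open>The matrices \<open>V l\<close>, stacked at the row offsets \<open>off l\<close>, after the unitary.\<close>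
  define W where "W x = (\<Sum>l<h. Bl l * V l x * u x)" for x
  have Wc: "continuous_map (spc T k) euclidean W"
    unfolding W_def by (intro continuous_map_fmat_sum continuous_map_fmat(3) uc Vc) auto
  have "fits R t (W x) \<and> star (W x) * W x = fval (prj T) k x \<and>
       W x * star (W x) = block_diag B J (\<lambda>b. fval (prj S) (fst b) (L (fst b) (snd b) x)) \<and>
       (\<forall>f\<in>carrier ?A. fval (\<phi> f) k x = star (W x) * block_diag B J (\<lambda>b. fval f (fst b) (L (fst b) (snd b) x)) * W x)"
    if x: "x \<in> topspace (spc T k)" for x
  proof -
    note opsT = homog_fval_ops[OF T k x] and pT = homogeneousD(7-9)[OF T k x, folded p_def]
    note hom = fval_hom[OF S T \<phi> k x]
    have uf: "fits t t (u x)" using homog_carrierD(2)[OF T UA(1) k x] by (simp add: u_def t_def)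
    have pu: "p x * u x = u x" "u x * p x = u x" using homog_carrierD(3,4)[OF T UA(1) k x] by (simp_all add: u_def p_def)
    have pu': "star (u x) * p x = star (u x)" "p x * star (u x) = star (u x)"
      using arg_cong[OF pu(1), of star] arg_cong[OF pu(2), of star] pT by simp_all
    have uu: "star (u x) * u x = p x" "u x * star (u x) = p x"
      using opsT(5)[OF Ua UA(1)] opsT(5)[OF UA(1) Ua] opsT(4)[OF UA(1)] opsT(1) UA(2,3) by (simp_all add: u_def p_def)
    have conj: "fval (U \<otimes>\<^bsub>?B\<^esub> g \<otimes>\<^bsub>?B\<^esub> adj ?B U) k x = u x * fval g k x * star (u x)" if "g \<in> carrier ?B" for g
      using opsT(5)[OF homog_closed(5)[OF T UA(1) that] Ua] opsT(5)[OF UA(1) that] opsT(4)[OF UA(1)] by (simp add: u_def)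
    have D: "u x * fval (\<phi> (summand_embed S l (f l))) k x * star (u x) = star (V l x) * Dl l (fval f l) x * V l x"
      if l: "l < h" and f: "f \<in> carrier ?A" for l f
    proof -
      note emb = homog_sum_embed[OF S T \<phi> k x f]
      have lS: "l < summands S" using l by (simp add: h_def)
      have fcm: "f l (L l s x) \<in> carrier_mat (msize S l) (msize S l)" if "s < m l" for s
        by (rule homog_carrier_matD[OF S f lS L[OF lS that x]])
      have dbl: "to_fm (diag_block_mat (map (\<lambda>s. f l (L l s x)) [0..<m l])) = Dl l (fval f l) x"
        and dcm: "diag_block_mat (map (\<lambda>s. f l (L l s x)) [0..<m l]) \<in> carrier_mat (M l) (M l)"
        using to_fm_diag_block[of "m l" "\<lambda>s. f l (L l s x)", OF fcm] by (auto simp: Dl_def block_diag_def fval_def M_def)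
      have "u x * fval (\<phi> (summand_embed S l (f l))) k x * star (u x)
         = fval (U \<otimes>\<^bsub>?B\<^esub> \<phi> (summand_embed S l (f l)) \<otimes>\<^bsub>?B\<^esub> adj ?B U) k x"
        by (rule conj[symmetric]) (rule hom(1)[OF emb(3)[OF lS]])
      also have "\<dots> = to_fm (mat_adjoint (v l x) * diag_block_mat (map (\<lambda>s. f l (L l s x)) [0..<m l]) * v l x)"
        unfolding fval_def using v\<phi>[OF l x emb(2)[OF lS]] by simp
      also have "\<dots> = star (V l x) * Dl l (fval f l) x * V l x"
        unfolding to_fm_mult3[OF mat_adjoint_carrier[OF vm[OF l x]] dcm vm[OF l x]] dbl to_fm_adjoint[OF vm[OF l x]] V_def ..
      finally show ?thesis .
    qed
    have one: "\<one>\<^bsub>?A\<^esub> \<in> carrier ?A" by (rule homog_closed(1)[OF S])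
    define P where "P l = Dl l (fval (prj S) l) x" for l
    have Dl_one: "Dl l (fval \<one>\<^bsub>?A\<^esub> l) x = P l" if "l < h" for l
      unfolding Dl_def P_def block_diag_def using that L[OF _ _ x]
      by (intro sum.cong refl) (simp add: homog_fval_ops(1)[OF S] h_def)
    have VV: "V l x * star (V l x) = P l" if l: "l < h" for l
    proof -
      have lS: "l < summands S" using l by (simp add: h_def)
      have "to_fm (diag_block_mat (map (\<lambda>s. prj S l (L l s x)) [0..<m l])) = P l"
        using to_fm_diag_block[of "m l" "\<lambda>s. prj S l (L l s x)" "msize S l"] homogeneousD(6)[OF S lS L[OF lS _ x]]
        by (auto simp: P_def Dl_def block_diag_def fval_def)
      then show ?thesis
        unfolding V_def to_fm_adjoint[OF vm[OF l x], symmetric] to_fm_mult[OF vm[OF l x] mat_adjoint_carrier[OF vm[OF l x]], symmetric]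
          vv[OF l x] by simp
    qed
    have bsl: "block_system {..<m l} (\<lambda>_. msize S l) (\<lambda>s. blk (msize S l) (s * msize S l))" for l
      unfolding block_system_def
    proof (intro conjI ballI)
      fix s s' :: nat
      have "s * msize S l + msize S l \<le> s' * msize S l \<or> s' * msize S l + msize S l \<le> s * msize S l" if "s \<noteq> s'"
      proof -
        have "s < s' \<or> s' < s" using that by auto
        then have "Suc s * msize S l \<le> s' * msize S l \<or> Suc s' * msize S l \<le> s * msize S l"
          using mult_le_mono1[of "Suc s" s' "msize S l"] mult_le_mono1[of "Suc s'" s "msize S l"] by auto
        then show ?thesis by auto
      qed
      then show "star (blk (msize S l) (s * msize S l)) * blk (msize S l) (s' * msize S l) = (if s = s' then idm (msize S l) else 0)"
        by (auto simp: star_blk_blk star_blk_blk_disjoint)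
    qed simp
    have PD: "P l * Dl l (fval f l) x = Dl l (fval f l) x" "Dl l (fval f l) x * P l = Dl l (fval f l) x"
      if l: "l < h" and f: "f \<in> carrier ?A" for l f
    proof -
      have lS: "l < summands S" using l by (simp add: h_def)
      have c: "block_diag {..<m l} J' (\<lambda>s. F s) = block_diag {..<m l} J' (\<lambda>s. G s)" if "\<And>s. s < m l \<Longrightarrow> F s = G s" for J' and F G :: "nat \<Rightarrow> fmat"
        unfolding block_diag_def using that by simp
      show "P l * Dl l (fval f l) x = Dl l (fval f l) x"
        unfolding P_def Dl_def
        by (subst block_diag_mult[OF bsl]) (auto intro!: c homogeneousD(7)[OF S lS] homog_carrierD(3)[OF S f lS] L[OF lS _ x])
      show "Dl l (fval f l) x * P l = Dl l (fval f l) x"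
        unfolding P_def Dl_def
        by (subst block_diag_mult[OF bsl]) (auto intro!: c homog_carrierD(2,4)[OF S f lS] L[OF lS _ x])
    qed
    have PP: "P l * P l = P l" if "l < h" for l using PD[OF that one] Dl_one[OF that] by simp
    have sP: "star (P l) = P l" if "l < h" for l using VV[OF that, symmetric] by simp
    have PV: "P l * V l x = V l x" if l: "l < h" for l
    proof -
      have "star (star (P l * V l x - V l x)) * star (P l * V l x - V l x)
         = P l * (V l x * star (V l x)) * P l - P l * (V l x * star (V l x)) - V l x * star (V l x) * P l + V l x * star (V l x)"
        using sP[OF l] by (simp add: algebra_simps)
      also have "\<dots> = 0" by (simp add: VV[OF l] PP[OF l])
      finally have "star (P l * V l x - V l x) = 0" by (rule cstar_zero)
      then have "star (star (P l * V l x - V l x)) = 0" by (metis star_zero)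
      then show ?thesis by simp
    qed
    define Q where "Q l = star (V l x) * V l x" for l
    have Qu: "Q l = u x * fval (\<phi> (summand_embed S l (\<one>\<^bsub>?A\<^esub> l))) k x * star (u x)" if l: "l < h" for l
    proof -
      have "star (V l x) * P l * V l x = Q l" unfolding Q_def using PV[OF l] by (simp add: mult.assoc)
      then show ?thesis using D[OF l one] Dl_one[OF l] by simp
    qed
    \<comment> \<open>The units of the summands add up to the unit, and \<open>\<phi>\<close> is unital.\<close>
    have sumQ: "(\<Sum>l<h. Q l) = p x"
    proof -
      have "(\<Sum>l<h. Q l) = (\<Sum>l<h. u x * fval (\<phi> (summand_embed S l (\<one>\<^bsub>?A\<^esub> l))) k x * star (u x))"
        using Qu by simp
      also have "\<dots> = u x * fval (\<phi> \<one>\<^bsub>?A\<^esub>) k x * star (u x)"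
        unfolding homog_sum_embed(1)[OF S T \<phi> k x one] h_def by (simp add: sum_distrib_left sum_distrib_right)
      also have "\<dots> = p x" unfolding hom(4) p_def[symmetric] using pu uu by simp
      finally show ?thesis .
    qed
    have VQ: "V l x * Q l = V l x" if l: "l < h" for l
      unfolding Q_def using VV[OF l] PV[OF l] by (simp flip: mult.assoc)
    \<comment> \<open>The units of different summands are orthogonal, and \<open>\<phi>\<close> is multiplicative.\<close>
    have QQ: "Q l * Q l' = 0" if l: "l < h" "l' < h" "l \<noteq> l'" for l l'
    proof -
      let ?e = "summand_embed S l (\<one>\<^bsub>?A\<^esub> l)" and ?e' = "summand_embed S l' (\<one>\<^bsub>?A\<^esub> l')"
      have lS: "l < summands S" "l' < summands S" using l by (simp_all add: h_def)
      note emb = homog_sum_embed[OF S T \<phi> k x one]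
      have e: "?e \<in> carrier ?A" "?e' \<in> carrier ?A" using emb(3) lS by blast+
      have "?e \<otimes>\<^bsub>?A\<^esub> ?e' = \<zero>\<^bsub>?A\<^esub>"
        using l by (intro homog_ext[OF S homog_closed(5)[OF S e] homog_closed(2)[OF S]])
          (simp add: homog_fval_ops[OF S] e emb(4)[OF lS(1)] emb(4)[OF lS(2)])
      then have z: "fval (\<phi> ?e) k x * fval (\<phi> ?e') k x = 0" using hom(3)[OF e] hom(5) by simp
      have "Q l * Q l' = u x * (fval (\<phi> ?e) k x * (star (u x) * u x) * fval (\<phi> ?e') k x) * star (u x)"
        unfolding Qu[OF l(1)] Qu[OF l(2)] by (simp add: mult.assoc)
      also have "fval (\<phi> ?e) k x * (star (u x) * u x) = fval (\<phi> ?e) k x"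
        unfolding uu p_def by (rule homog_carrierD(4)[OF T hom(1)[OF e(1)] k x])
      finally show ?thesis by (simp add: z)
    qed
    have VVo: "V l x * star (V l' x) = 0" if l: "l < h" "l' < h" "l \<noteq> l'" for l l'
    proof -
      have "V l x * star (V l' x) = (V l x * Q l) * star (V l' x * Q l')" using VQ l by simp
      also have "\<dots> = V l x * (Q l * Q l') * star (V l' x)" by (simp add: Q_def mult.assoc)
      finally show ?thesis using QQ[OF l] by simp
    qed
    have QsV: "p x * star (V l x) = star (V l x)" if l: "l < h" for l
    proof -
      have "p x * star (V l x) = (\<Sum>l'<h. Q l' * star (V l x))" by (simp add: sum_distrib_right flip: sumQ)
      also have "\<dots> = (\<Sum>l'\<in>{l}. Q l' * star (V l x))"
        using l VVo by (intro sum.mono_neutral_right) (auto simp: Q_def mult.assoc)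
      also have "\<dots> = star (V l x * Q l)" by (simp add: Q_def mult.assoc)
      finally show ?thesis using VQ[OF l] by simp
    qed
    have IV: "idm (M l) * V l x = V l x" if "l < h" for l by (rule idm_left[OF Vf(1)[OF that x] order_refl])
    have fW: "fits R t (W x)" unfolding W_def
      by (intro fits_sum fits_times[OF fits_times[OF Bl_fits Vf(1)[OF _ x]] uf]) auto
    have sW: "star (W x) = (\<Sum>l<h. star (u x) * star (V l x) * star (Bl l))" by (simp add: W_def mult.assoc)
    have "star (W x) * W x = (\<Sum>l<h. (star (u x) * star (V l x) * star (Bl l)) * (Bl l * V l x * u x))"
      unfolding sW unfolding W_def
    proof (rule sum_mult_orthogonal)
      fix i j :: nat assume "i \<noteq> j"
      have "star (u x) * star (V i x) * star (Bl i) * (Bl j * V j x * u x) = star (u x) * star (V i x) * (star (Bl i) * Bl j) * (V j x * u x)"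
        by (simp add: mult.assoc)
      then show "star (u x) * star (V i x) * star (Bl i) * (Bl j * V j x * u x) = 0" using Bl_orth[OF \<open>i \<noteq> j\<close>] by simp
    qed simp
    also have "\<dots> = (\<Sum>l<h. star (u x) * Q l * u x)"
    proof (rule sum.cong[OF refl])
      fix l assume "l \<in> {..<h}"
      have "(star (u x) * star (V l x) * star (Bl l)) * (Bl l * V l x * u x) = star (u x) * star (V l x) * (star (Bl l) * Bl l * V l x) * u x"
        by (simp add: mult.assoc)
      also have "\<dots> = star (u x) * Q l * u x" unfolding Bl_id using IV \<open>l \<in> _\<close> by (simp add: Q_def mult.assoc)
      finally show "(star (u x) * star (V l x) * star (Bl l)) * (Bl l * V l x * u x) = star (u x) * Q l * u x" .
    qed
    also have "\<dots> = star (u x) * p x * u x" unfolding sumQ[symmetric] by (simp add: sum_distrib_left sum_distrib_right)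
    also have "\<dots> = p x" using pu' uu by simp
    finally have WW: "star (W x) * W x = p x" .
    have Wu: "W x * star (u x) = (\<Sum>l<h. Bl l * V l x)"
    proof -
      have "V l x * p x = V l x" if "l < h" for l using arg_cong[OF QsV[OF that], of star] pT by simp
      then show ?thesis unfolding W_def by (simp add: sum_distrib_right mult.assoc uu)
    qed
    have "W x * star (W x) = (W x * star (u x)) * star (W x * star (u x))"
    proof -
      have "W x * p x = W x" unfolding W_def by (simp add: sum_distrib_right mult.assoc pu)
      moreover have "(W x * star (u x)) * star (W x * star (u x)) = (W x * (star (u x) * u x)) * star (W x)"
        by (simp add: mult.assoc)
      ultimately show ?thesis unfolding uu by simp
    qed
    also have "\<dots> = (\<Sum>l<h. Bl l * V l x) * (\<Sum>l<h. star (V l x) * star (Bl l))" unfolding Wu by simp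
    also have "\<dots> = (\<Sum>l<h. Bl l * V l x * (star (V l x) * star (Bl l)))"
    proof (rule sum_mult_orthogonal)
      fix i j :: nat assume "i \<in> {..<h}" "j \<in> {..<h}" "i \<noteq> j"
      then have "V i x * star (V j x) = 0" using VVo by auto
      moreover have "Bl i * V i x * (star (V j x) * star (Bl j)) = Bl i * (V i x * star (V j x)) * star (Bl j)" by (simp add: mult.assoc)
      ultimately show "Bl i * V i x * (star (V j x) * star (Bl j)) = 0" by simp
    qed simp
    also have "\<dots> = (\<Sum>l<h. Bl l * P l * star (Bl l))"
      using VV by (intro sum.cong refl) (simp add: mult.assoc flip: VV)
    also have "\<dots> = block_diag B J (\<lambda>b. fval (prj S) (fst b) (L (fst b) (snd b) x))"
      unfolding P_def by (rule BlDl)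
    finally have WW': "W x * star (W x) = block_diag B J (\<lambda>b. fval (prj S) (fst b) (L (fst b) (snd b) x))" .
    have "fval (\<phi> f) k x = star (W x) * block_diag B J (\<lambda>b. fval f (fst b) (L (fst b) (snd b) x)) * W x" if f: "f \<in> carrier ?A" for f
    proof -
      let ?d = "\<lambda>l. Dl l (fval f l) x"
      have "star (W x) * (\<Sum>l<h. Bl l * ?d l * star (Bl l)) = (\<Sum>l<h. star (u x) * star (V l x) * star (Bl l) * (Bl l * ?d l * star (Bl l)))"
        unfolding sW
      proof (rule sum_mult_orthogonal)
        fix i j :: nat assume "i \<noteq> j"
        have "star (u x) * star (V i x) * star (Bl i) * (Bl j * ?d j * star (Bl j)) = star (u x) * star (V i x) * (star (Bl i) * Bl j) * (?d j * star (Bl j))"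
          by (simp add: mult.assoc)
        then show "star (u x) * star (V i x) * star (Bl i) * (Bl j * ?d j * star (Bl j)) = 0" using Bl_orth[OF \<open>i \<noteq> j\<close>] by simp
      qed simp
      also have "\<dots> = (\<Sum>l<h. star (u x) * star (V l x) * ?d l * star (Bl l))"
      proof (rule sum.cong[OF refl])
        fix l assume "l \<in> {..<h}"
        then have l: "l < h" by simp
        have "star (V l x) * idm (M l) = star (V l x)" using arg_cong[OF IV[OF l], of star] by simp
        moreover have "star (u x) * star (V l x) * star (Bl l) * (Bl l * ?d l * star (Bl l)) = star (u x) * (star (V l x) * (star (Bl l) * Bl l)) * ?d l * star (Bl l)"
          by (simp add: mult.assoc)
        ultimately show "star (u x) * star (V l x) * star (Bl l) * (Bl l * ?d l * star (Bl l)) = star (u x) * star (V l x) * ?d l * star (Bl l)"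
          unfolding Bl_id by simp
      qed
      finally have 1: "star (W x) * (\<Sum>l<h. Bl l * ?d l * star (Bl l)) = (\<Sum>l<h. star (u x) * star (V l x) * ?d l * star (Bl l))" .
      have "star (W x) * (\<Sum>l<h. Bl l * ?d l * star (Bl l)) * W x = (\<Sum>l<h. star (u x) * star (V l x) * ?d l * star (Bl l) * (Bl l * V l x * u x))"
        unfolding 1 unfolding W_def
      proof (rule sum_mult_orthogonal)
        fix i j :: nat assume "i \<noteq> j"
        have "star (u x) * star (V i x) * ?d i * star (Bl i) * (Bl j * V j x * u x) = star (u x) * star (V i x) * ?d i * (star (Bl i) * Bl j) * (V j x * u x)"
          by (simp add: mult.assoc)
        then show "star (u x) * star (V i x) * ?d i * star (Bl i) * (Bl j * V j x * u x) = 0" using Bl_orth[OF \<open>i \<noteq> j\<close>] by simp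
      qed simp
      also have "\<dots> = (\<Sum>l<h. star (u x) * (star (V l x) * ?d l * V l x) * u x)"
      proof (rule sum.cong[OF refl])
        fix l assume "l \<in> {..<h}"
        then have l: "l < h" by simp
        have "star (u x) * star (V l x) * ?d l * star (Bl l) * (Bl l * V l x * u x) = star (u x) * star (V l x) * ?d l * ((star (Bl l) * Bl l) * V l x) * u x"
          by (simp add: mult.assoc)
        then show "star (u x) * star (V l x) * ?d l * star (Bl l) * (Bl l * V l x * u x) = star (u x) * (star (V l x) * ?d l * V l x) * u x"
          unfolding Bl_id IV[OF l] by (simp add: mult.assoc)
      qed
      also have "\<dots> = (\<Sum>l<h. star (u x) * (u x * fval (\<phi> (summand_embed S l (f l))) k x * star (u x)) * u x)"
        using D[OF _ f] by simp
      also have "\<dots> = star (u x) * (u x * fval (\<phi> f) k x * star (u x)) * u x"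
        unfolding homog_sum_embed(1)[OF S T \<phi> k x f] h_def by (simp add: sum_distrib_left sum_distrib_right)
      also have "\<dots> = (star (u x) * u x) * fval (\<phi> f) k x * (star (u x) * u x)" by (simp add: mult.assoc)
      also have "\<dots> = fval (\<phi> f) k x"
        unfolding uu p_def using homog_carrierD(3,4)[OF T hom(1)[OF f] k x] by simp
      finally show ?thesis unfolding BlDl by simp
    qed
    then show ?thesis using fW WW WW' by (simp add: p_def)
  qed
  then show ?thesis using bs fJ Wc unfolding t_def by (intro exI[of _ R] exI[of _ J] exI[of _ W]) blast
qed

section \<open>The norm in the limit\<close>

lemma AH_diagonal_representation:
  assumes AH: "AH_algebra A S \<phi> \<psi>" and diag: "diagonal_maps S \<phi> m L" and ij: "i < j" and k: "k < summands (S j)"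
  defines "B \<equiv> SIGMA l:{..<summands (S i)}. {..<m i j l k}"
  shows "\<exists>R J W. block_system B (\<lambda>b. msize (S i) (fst b)) J \<and> (\<forall>b\<in>B. fits R (msize (S i) (fst b)) (J b)) \<and>
     continuous_map (spc (S j) k) euclidean W \<and> (\<forall>x\<in>topspace (spc (S j) k). fits R (msize (S j) k) (W x) \<and>
       star (W x) * W x = fval (prj (S j)) k x \<and>
       W x * star (W x) = block_diag B J (\<lambda>b. fval (prj (S i)) (fst b) (L i j (fst b) k (snd b) x)) \<and>
       (\<forall>f\<in>carrier (homog_algebra (S i)). 
         fval (\<phi> i j f) k x = star (W x) * block_diag B J (\<lambda>b. fval f (fst b) (L i j (fst b) k (snd b) x)) * W x))"
    and "\<And>l s. l < summands (S i) \<Longrightarrow> s < m i j l k \<Longrightarrow> continuous_map (spc (S j) k) (spc (S i) l) (L i j l k s)"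
proof -
  have hom: "homogeneous (S i)" "homogeneous (S j)" "\<phi> i j \<in> star_hom (homog_algebra (S i)) (homog_algebra (S j))"
    using AH ij unfolding AH_algebra_def inductive_limit_def by auto
  obtain U where U: "U \<in> unitary_elements (homog_algebra (S j))"
    and d: "\<forall>l<summands (S i). \<forall>k<summands (S j).
             (\<forall>s<m i j l k. continuous_map (spc (S j) k) (spc (S i) l) (L i j l k s)) \<and>
             diagonal_form (S i) l (S j) k (m i j l k) (L i j l k)
               (\<lambda>f. (U \<otimes>\<^bsub>homog_algebra (S j)\<^esub> \<phi> i j (summand_embed (S i) l f)
                       \<otimes>\<^bsub>homog_algebra (S j)\<^esub> adj (homog_algebra (S j)) U) k)"
    using diag ij unfolding diagonal_maps_def by meson
  show c: "\<And>l s. l < summands (S i) \<Longrightarrow> s < m i j l k \<Longrightarrow> continuous_map (spc (S j) k) (spc (S i) l) (L i j l k s)"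
    using d k by blast
  have Lin: "L i j l k s x \<in> topspace (spc (S i) l)" if "l < summands (S i)" "s < m i j l k" "x \<in> topspace (spc (S j) k)" for l s x
    using continuous_map_funspace[OF c[OF that(1,2)]] that(3) by auto
  show "\<exists>R J W. block_system B (\<lambda>b. msize (S i) (fst b)) J \<and> (\<forall>b\<in>B. fits R (msize (S i) (fst b)) (J b)) \<and>
     continuous_map (spc (S j) k) euclidean W \<and> (\<forall>x\<in>topspace (spc (S j) k). fits R (msize (S j) k) (W x) \<and>
       star (W x) * W x = fval (prj (S j)) k x \<and>
       W x * star (W x) = block_diag B J (\<lambda>b. fval (prj (S i)) (fst b) (L i j (fst b) k (snd b) x)) \<and>
       (\<forall>f\<in>carrier (homog_algebra (S i)). 
         fval (\<phi> i j f) k x = star (W x) * block_diag B J (\<lambda>b. fval f (fst b) (L i j (fst b) k (snd b) x)) * W x))"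
    unfolding B_def
    by (rule diagonal_representation[OF hom U k, where m = "\<lambda>l. m i j l k" and L = "\<lambda>l. L i j l k"])
       (use Lin d k in auto)
qed

text \<open>Conjugation by the partial isometry \<open>W\<close> is isometric on the corner in which the block diagonal matrix lives, so
 the norm of an image is the largest norm of a block.\<close>

lemma AH_norm_le_iff:
  assumes AH: "AH_algebra A S \<phi> \<psi>" and diag: "diagonal_maps S \<phi> m L" and ij: "i < j"
    and f: "f \<in> carrier (homog_algebra (S i))" and c: "0 \<le> c"
  shows "cnorm (homog_algebra (S j)) (\<phi> i j f) \<le> c \<longleftrightarrow> (\<forall>k<summands (S j). \<forall>x\<in>topspace (spc (S j) k).
     \<forall>l<summands (S i). \<forall>s<m i j l k. norm (fval f l (L i j l k s x)) \<le> c)"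
proof -
  have Si: "homogeneous (S i)" and Sj: "homogeneous (S j)" and hom: "\<phi> i j \<in> star_hom (homog_algebra (S i)) (homog_algebra (S j))"
    using AH ij unfolding AH_algebra_def inductive_limit_def by auto
  have \<phi>f: "\<phi> i j f \<in> carrier (homog_algebra (S j))" using hom f by (auto simp: star_hom_def Ring.ring_hom_def)
  have "norm (fval (\<phi> i j f) k x) \<le> c \<longleftrightarrow> (\<forall>l<summands (S i). \<forall>s<m i j l k. norm (fval f l (L i j l k s x)) \<le> c)"
    if k: "k < summands (S j)" and x: "x \<in> topspace (spc (S j) k)" for k x
  proof -
    define B where "B = (SIGMA l:{..<summands (S i)}. {..<m i j l k})"
    note rep = AH_diagonal_representation[OF AH diag ij k]
    have Lin: "L i j l k s x \<in> topspace (spc (S i) l)" if "l < summands (S i)" "s < m i j l k" for l s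
      using continuous_map_funspace[OF rep(2)[OF that]] x by auto
    define D where "D g = (\<lambda>b. fval g (fst b) (L i j (fst b) k (snd b) x))" for g :: "nat \<Rightarrow> 'b \<Rightarrow> complex mat"
    obtain R J W where J: "block_system B (\<lambda>b. msize (S i) (fst b)) J"
      and WW: "star W * W = fval (prj (S j)) k x" and WW': "W * star W = block_diag B J (D (prj (S i)))"
      and rf: "fval (\<phi> i j f) k x = star W * block_diag B J (D f) * W"
      using rep(1) x f unfolding B_def D_def by blast
    have Df: "fits (msize (S i) (fst b)) (msize (S i) (fst b)) (D f b)"
      and Dp: "fits (msize (S i) (fst b)) (msize (S i) (fst b)) (D (prj (S i)) b)"
      and pf: "D (prj (S i)) b * D f b = D f b" "D f b * D (prj (S i)) b = D f b" if "b \<in> B" for b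
      using that homog_carrierD(2-4)[OF Si f _ Lin] homogeneousD(7)[OF Si _ Lin] by (auto simp: B_def D_def)
    have W1: "norm W \<le> 1"
      by (rule norm_partial_isometry_le_1[OF homogeneousD(8,9)[OF Sj k x] WW])
    have "block_diag B J (D (prj (S i))) * block_diag B J (D f) = block_diag B J (\<lambda>b. D (prj (S i)) b * D f b)"
      by (rule block_diag_mult[OF J Dp])
    also have "\<dots> = block_diag B J (D f)" unfolding block_diag_def using pf by (intro sum.cong) auto
    finally have "block_diag B J (D (prj (S i))) * block_diag B J (D f) = block_diag B J (D f)" .
    moreover have "block_diag B J (D f) * block_diag B J (D (prj (S i))) = block_diag B J (D f)"
    proof -
      have "block_diag B J (D f) * block_diag B J (D (prj (S i))) = block_diag B J (\<lambda>b. D f b * D (prj (S i)) b)"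
        by (rule block_diag_mult[OF J Df])
      also have "\<dots> = block_diag B J (D f)" unfolding block_diag_def using pf by (intro sum.cong) auto
      finally show ?thesis .
    qed
    ultimately have corner: "block_diag B J (D f) = W * fval (\<phi> i j f) k x * star W"
      unfolding rf using WW' by (metis mult.assoc)
    have "norm (fval (\<phi> i j f) k x) = norm (block_diag B J (D f))"
    proof (rule antisym)
      show "norm (fval (\<phi> i j f) k x) \<le> norm (block_diag B J (D f))"
        using norm_mult_ineq[of "star W * block_diag B J (D f)" W] norm_mult_ineq[of "star W" "block_diag B J (D f)"]
          W1 mult_mono[OF W1 order_refl, of "norm (block_diag B J (D f))"]
          mult_mono[OF order_refl W1, of "norm (star W * block_diag B J (D f))"] unfolding rf by simp
      show "norm (block_diag B J (D f)) \<le> norm (fval (\<phi> i j f) k x)"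
        using norm_mult_ineq[of "W * fval (\<phi> i j f) k x" "star W"] norm_mult_ineq[of W "fval (\<phi> i j f) k x"]
          W1 mult_mono[OF W1 order_refl, of "norm (fval (\<phi> i j f) k x)"]
          mult_mono[OF order_refl W1, of "norm (W * fval (\<phi> i j f) k x)"] unfolding corner by simp
    qed
    also have "\<dots> \<le> c \<longleftrightarrow> (\<forall>b\<in>B. norm (D f b) \<le> c)"
      using norm_block_diag_le[OF J Df _ c] norm_block_diag_ge[OF J Df] order_trans by blast
    finally show ?thesis by (auto simp: B_def D_def)
  qed
  then show ?thesis unfolding homog_cnorm_le_iff[OF Sj \<phi>f] by auto
qed

text \<open>The topological upper limit of the images of the eigenvalue maps into the \<open>l\<close>-th space of \<open>S j\<close>. The images of successive
 stages need not be nested, so that an intersection would not do.\<close>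

definition limit_set ::
  "(nat \<Rightarrow> 'x homog_data) \<Rightarrow> (nat \<Rightarrow> nat \<Rightarrow> nat \<Rightarrow> nat \<Rightarrow> nat) \<Rightarrow>
    (nat \<Rightarrow> nat \<Rightarrow> nat \<Rightarrow> nat \<Rightarrow> nat \<Rightarrow> 'x \<Rightarrow> 'x) \<Rightarrow> nat \<Rightarrow> nat \<Rightarrow> 'x set" where
  "limit_set S m L j l = {x \<in> topspace (spc (S j) l). \<forall>G. openin (spc (S j) l) G \<and> x \<in> G \<longrightarrow>
     (\<forall>N. \<exists>n\<ge>N. j < n \<and> (\<exists>k<summands (S n). \<exists>s<m j n l k. \<exists>y\<in>topspace (spc (S n) k). L j n l k s y \<in> G))}"

lemma closedin_limit_set: "closedin (spc (S j) l) (limit_set S m L j l)"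
  unfolding closedin_def
proof
  let ?X = "spc (S j) l"
  show "limit_set S m L j l \<subseteq> topspace ?X" by (auto simp: limit_set_def)
  define hit where "hit N G \<longleftrightarrow> (\<exists>n\<ge>N. j < n \<and> (\<exists>k<summands (S n). \<exists>s<m j n l k. \<exists>y\<in>topspace (spc (S n) k). L j n l k s y \<in> G))" for N G
  have lim: "limit_set S m L j l = {x \<in> topspace ?X. \<forall>G. openin ?X G \<and> x \<in> G \<longrightarrow> (\<forall>N. hit N G)}"
    unfolding limit_set_def hit_def ..
  have "\<exists>G. openin ?X G \<and> x \<in> G \<and> G \<subseteq> topspace ?X - limit_set S m L j l" if x: "x \<in> topspace ?X - limit_set S m L j l" for x
  proof -
    obtain G N where G: "openin ?X G" "x \<in> G" "\<not> hit N G" using x unfolding lim by blast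
    have "G \<subseteq> topspace ?X - limit_set S m L j l" using G openin_subset[OF G(1)] unfolding lim by blast
    then show ?thesis using G by blast
  qed
  then show "openin ?X (topspace ?X - limit_set S m L j l)" by (subst openin_subopen) blast
qed

lemma limit_setD:
  assumes "x \<in> limit_set S m L j l" "openin (spc (S j) l) G" "x \<in> G"
  shows "\<exists>n\<ge>N. j < n \<and> (\<exists>k<summands (S n). \<exists>s<m j n l k. \<exists>y\<in>topspace (spc (S n) k). L j n l k s y \<in> G)"
proof -
  have "\<forall>G. openin (spc (S j) l) G \<and> x \<in> G \<longrightarrow>
     (\<forall>N. \<exists>n\<ge>N. j < n \<and> (\<exists>k<summands (S n). \<exists>s<m j n l k. \<exists>y\<in>topspace (spc (S n) k). L j n l k s y \<in> G))"
    using assms(1) unfolding limit_set_def mem_Collect_eq by (rule conjunct2)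
  then show ?thesis using assms(2,3) by (elim allE[of _ G] impE) simp_all
qed

lemma not_limit_setD:
  assumes "x \<in> topspace (spc (S j) l)" "x \<notin> limit_set S m L j l"
  shows "\<exists>G. openin (spc (S j) l) G \<and> x \<in> G \<and> (\<exists>N. \<forall>n\<ge>N. j < n \<longrightarrow>
    (\<forall>k<summands (S n). \<forall>s<m j n l k. \<forall>y\<in>topspace (spc (S n) k). L j n l k s y \<notin> G))"
proof -
  have "\<not> (\<forall>G. openin (spc (S j) l) G \<and> x \<in> G \<longrightarrow>
     (\<forall>N. \<exists>n\<ge>N. j < n \<and> (\<exists>k<summands (S n). \<exists>s<m j n l k. \<exists>y\<in>topspace (spc (S n) k). L j n l k s y \<in> G)))"
    using assms unfolding limit_set_def by (simp only: mem_Collect_eq simp_thms)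
  then show ?thesis by (simp only: not_all not_imp not_ex de_Morgan_conj bex_simps ball_simps imp_conv_disj) metis
qed

text \<open>If \<open>f\<close> is large at a point of the limit set, then it is large at values of eigenvalue maps of
 arbitrarily late stages. Conversely, the compact set on which \<open>f\<close> is at least \<open>c' > c\<close> is disjoint from the limit set, and
 is therefore avoided by all eigenvalue maps of late stages.\<close>

lemma limit_norm_le_iff:
  assumes AH: "AH_algebra A S \<phi> \<psi>" and diag: "diagonal_maps S \<phi> m L"
    and f: "f \<in> carrier (homog_algebra (S j))" and c: "0 \<le> c"
  shows "cnorm A (\<psi> j f) \<le> c \<longleftrightarrow> (\<forall>l<summands (S j). \<forall>x\<in>limit_set S m L j l. norm (fval f l x) \<le> c)"
proof -
  have Sj: "homogeneous (S j)" using AH unfolding AH_algebra_def by auto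
  have lim: "(\<lambda>n. cnorm (homog_algebra (S n)) (\<phi> j n f)) \<longlonglongrightarrow> cnorm A (\<psi> j f)"
    using AH f unfolding AH_algebra_def inductive_limit_def by blast
  note norm_iff = AH_norm_le_iff[OF AH diag _ f]
  show ?thesis
  proof
    assume le: "cnorm A (\<psi> j f) \<le> c"
    show "\<forall>l<summands (S j). \<forall>x\<in>limit_set S m L j l. norm (fval f l x) \<le> c"
    proof (intro allI impI ballI, rule ccontr)
      fix l x assume l: "l < summands (S j)" and x: "x \<in> limit_set S m L j l" and n: "\<not> norm (fval f l x) \<le> c"
      obtain c' where c': "c < c'" "c' < norm (fval f l x)" using n dense[of c "norm (fval f l x)"] by auto
      define G where "G = {y \<in> topspace (spc (S j) l). norm (fval f l y) \<in> {c'<..}}"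
      have G: "openin (spc (S j) l) G" unfolding G_def
        by (rule openin_continuous_map_preimage[OF continuous_map_fmat(5)[OF homog_carrierD(1)[OF Sj f l]]]) simp
      have "x \<in> G" using x c' by (simp add: G_def limit_set_def)
      have "\<exists>n\<ge>N. c' \<le> cnorm (homog_algebra (S n)) (\<phi> j n f)" for N
      proof -
        obtain n k s y where n: "n \<ge> N" "j < n" "k < summands (S n)" "s < m j n l k" "y \<in> topspace (spc (S n) k)" "L j n l k s y \<in> G"
          using limit_setD[OF x G \<open>x \<in> G\<close>, of N] by blast
        have "\<not> cnorm (homog_algebra (S n)) (\<phi> j n f) \<le> c''" if "0 \<le> c''" "c'' \<le> c'" for c''
          using norm_iff[OF n(2) that(1)] n l that(2) unfolding G_def by force
        from this[of c'] show ?thesis using n(1) c c' by (intro exI[of _ n]) auto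
      qed
      moreover have "eventually (\<lambda>n. cnorm (homog_algebra (S n)) (\<phi> j n f) < c') sequentially"
        by (rule order_tendstoD(2)[OF lim]) (use le c' in simp)
      ultimately show False unfolding eventually_sequentially by (meson not_less)
    qed
  next
    assume R: "\<forall>l<summands (S j). \<forall>x\<in>limit_set S m L j l. norm (fval f l x) \<le> c"
    show "cnorm A (\<psi> j f) \<le> c"
    proof (rule dense_ge)
      fix c' assume c': "c < c'"
      have "\<exists>N. \<forall>n\<ge>N. j < n \<longrightarrow> (\<forall>k<summands (S n). \<forall>s<m j n l k. \<forall>y\<in>topspace (spc (S n) k). norm (fval f l (L j n l k s y)) < c')"
        if l: "l < summands (S j)" for l
      proof -
        let ?X = "spc (S j) l"
        define Z where "Z = {y \<in> topspace ?X. norm (fval f l y) \<in> {c'..}}"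
        have "closedin ?X Z" unfolding Z_def
          by (rule closedin_continuous_map_preimage[OF continuous_map_fmat(5)[OF homog_carrierD(1)[OF Sj f l]]]) simp
        then have Zc: "compactin ?X Z" using homogeneousD(2)[OF Sj l] by (rule closedin_compact_space[rotated])
        have "\<forall>x\<in>Z. \<exists>G. openin ?X G \<and> x \<in> G \<and> (\<exists>N. \<forall>n\<ge>N. j < n \<longrightarrow> (\<forall>k<summands (S n). \<forall>s<m j n l k. \<forall>y\<in>topspace (spc (S n) k). L j n l k s y \<notin> G))"
        proof
          fix x assume x: "x \<in> Z"
          then have "x \<notin> limit_set S m L j l" using R l c' by (force simp: Z_def)
          then show "\<exists>G. openin ?X G \<and> x \<in> G \<and> (\<exists>N. \<forall>n\<ge>N. j < n \<longrightarrow> (\<forall>k<summands (S n). \<forall>s<m j n l k. \<forall>y\<in>topspace (spc (S n) k). L j n l k s y \<notin> G))"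
            using x by (intro not_limit_setD) (auto simp: Z_def)
        qed
        from bchoice[OF this] obtain G where G: "\<And>x. x \<in> Z \<Longrightarrow> openin ?X (G x) \<and> x \<in> G x \<and>
          (\<exists>N. \<forall>n\<ge>N. j < n \<longrightarrow> (\<forall>k<summands (S n). \<forall>s<m j n l k. \<forall>y\<in>topspace (spc (S n) k). L j n l k s y \<notin> G x))" by blast
        have "\<exists>\<F>. finite \<F> \<and> \<F> \<subseteq> G ` Z \<and> Z \<subseteq> \<Union>\<F>"
        proof (rule compactinD[OF Zc])
          show "openin ?X U" if "U \<in> G ` Z" for U using that G by blast
          show "Z \<subseteq> \<Union>(G ` Z)" using G by blast
        qed
        then obtain P where P: "finite P" "P \<subseteq> Z" "Z \<subseteq> \<Union>(G ` P)" by (metis finite_subset_image)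
        have "\<forall>x\<in>P. \<exists>N. \<forall>n\<ge>N. j < n \<longrightarrow> (\<forall>k<summands (S n). \<forall>s<m j n l k. \<forall>y\<in>topspace (spc (S n) k). L j n l k s y \<notin> G x)"
          using G P(2) by blast
        from bchoice[OF this] obtain N where N: "\<forall>x\<in>P. \<forall>n\<ge>N x. j < n \<longrightarrow> (\<forall>k<summands (S n). \<forall>s<m j n l k. \<forall>y\<in>topspace (spc (S n) k). L j n l k s y \<notin> G x)"
          by blast
        show ?thesis
        proof (intro exI[of _ "sum N P"] allI impI ballI)
          fix n k s y assume n: "sum N P \<le> n" "j < n" "k < summands (S n)" "s < m j n l k" "y \<in> topspace (spc (S n) k)"
          have "L j n l k s y \<notin> Z"
          proof
            assume "L j n l k s y \<in> Z"
            then obtain x where x: "x \<in> P" "L j n l k s y \<in> G x" using P(3) by blast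
            have "N x \<le> n" using member_le_sum[of x P N] P(1) x n(1) by simp
            then show False using N x n by blast
          qed
          moreover have "L j n l k s y \<in> topspace ?X"
            using continuous_map_funspace[OF AH_diagonal_representation(2)[OF AH diag n(2,3) l n(4)]] n(5) by auto
          ultimately show "norm (fval f l (L j n l k s y)) < c'" by (auto simp: Z_def)
        qed
      qed
      then have "\<forall>l\<in>{..<summands (S j)}. \<exists>N. \<forall>n\<ge>N. j < n \<longrightarrow> (\<forall>k<summands (S n). \<forall>s<m j n l k. \<forall>y\<in>topspace (spc (S n) k). norm (fval f l (L j n l k s y)) < c')"
        by simp
      from bchoice[OF this] obtain N where N: "\<forall>l\<in>{..<summands (S j)}. \<forall>n\<ge>N l. j < n \<longrightarrow> (\<forall>k<summands (S n). \<forall>s<m j n l k. \<forall>y\<in>topspace (spc (S n) k). norm (fval f l (L j n l k s y)) < c')"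
        by blast
      show "cnorm A (\<psi> j f) \<le> c'"
      proof (rule Lim_bounded[OF lim, where M = "Suc j + (\<Sum>l<summands (S j). N l)"], intro allI impI)
        fix n assume n: "Suc j + (\<Sum>l<summands (S j). N l) \<le> n"
        have jn: "j < n" using n by simp
        have "N l \<le> n" if "l < summands (S j)" for l
          using member_le_sum[of l "{..<summands (S j)}" N] that n by simp
        then show "cnorm (homog_algebra (S n)) (\<phi> j n f) \<le> c'"
          unfolding norm_iff[OF jn less_imp_le[OF order_le_less_trans[OF c c']]] using N jn by (auto intro: less_imp_le)
      qed
    qed
  qed
qed

section \<open>Approximation over the nerve\<close>

lemma small_oscillation_cover:
  assumes S: "homogeneous S" and F: "finite F" "F \<subseteq> carrier (homog_algebra S)" and \<delta>: "0 < \<delta>"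
  shows "\<exists>\<alpha>\<in>component_covers S. \<forall>l<summands S. \<forall>U\<in>\<alpha> l. \<forall>x\<in>U. \<forall>y\<in>U. \<forall>f\<in>F. norm (fval f l x - fval f l y) \<le> \<delta>"
proof -
  have "\<forall>l\<in>{..<summands S}. \<exists>\<alpha>. finite_open_cover (spc S l) \<alpha> \<and> (\<forall>U\<in>\<alpha>. \<forall>x\<in>U. \<forall>y\<in>U. \<forall>f\<in>F. norm (fval f l x - fval f l y) \<le> \<delta>)"
  proof
    fix l assume "l \<in> {..<summands S}"
    then have l: "l < summands S" by simp
    let ?X = "spc S l"
    define G where "G x = {y \<in> topspace ?X. \<forall>f\<in>F. norm (fval f l y - fval f l x) < \<delta> / 2}" for x
    have G: "openin ?X (G x)" for x unfolding G_def
    proof (rule openin_finite_Ball[OF F(1)])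
      fix f assume "f \<in> F"
      then have "continuous_map ?X euclidean (fval f l)" using F homog_carrierD(1)[OF S _ l] by blast
      then have "continuous_map ?X euclidean (\<lambda>y. norm (fval f l y - fval f l x))" by (intro continuous_map_fmat) auto
      then have "openin ?X {y \<in> topspace ?X. norm (fval f l y - fval f l x) \<in> {..<\<delta>/2}}" by (rule openin_continuous_map_preimage) simp
      then show "openin ?X {y \<in> topspace ?X. norm (fval f l y - fval f l x) < \<delta> / 2}" by simp
    qed
    have "topspace ?X \<subseteq> \<Union>(G ` topspace ?X)" using \<delta> by (auto simp: G_def)
    then obtain \<F> where \<F>: "finite \<F>" "\<F> \<subseteq> G ` topspace ?X" "topspace ?X \<subseteq> \<Union>\<F>"
      using homogeneousD(2)[OF S l] G unfolding compact_space_alt by (metis (no_types, lifting) imageE)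
    have \<F>o: "openin ?X U" if "U \<in> \<F>" for U using that \<F>(2) G by blast
    have "\<Union>\<F> \<subseteq> topspace ?X" by (rule Union_least) (rule openin_subset[OF \<F>o])
    then have "finite_open_cover ?X \<F>" unfolding finite_open_cover_def
      using \<F>(1,3) \<F>o by blast
    moreover have "norm (fval f l x - fval f l y) \<le> \<delta>" if "U \<in> \<F>" "x \<in> U" "y \<in> U" "f \<in> F" for U x y f
    proof -
      obtain z where "U = G z" using \<open>U \<in> \<F>\<close> \<F>(2) by blast
      then have "norm (fval f l x - fval f l z) < \<delta> / 2" "norm (fval f l y - fval f l z) < \<delta> / 2" using that by (auto simp: G_def)
      then show ?thesis using norm_triangle_ineq4[of "fval f l x - fval f l z" "fval f l y - fval f l z"] by simp
    qed
    ultimately show "\<exists>\<alpha>. finite_open_cover ?X \<alpha> \<and> (\<forall>U\<in>\<alpha>. \<forall>x\<in>U. \<forall>y\<in>U. \<forall>f\<in>F. norm (fval f l x - fval f l y) \<le> \<delta>)" by blast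
  qed
  from bchoice[OF this] obtain \<alpha> where \<alpha>: "\<forall>l\<in>{..<summands S}. finite_open_cover (spc S l) (\<alpha> l) \<and>
    (\<forall>U\<in>\<alpha> l. \<forall>x\<in>U. \<forall>y\<in>U. \<forall>f\<in>F. norm (fval f l x - fval f l y) \<le> \<delta>)" ..
  then have "\<alpha> \<in> component_covers S" by (simp add: component_covers_def)
  with \<alpha> show ?thesis by (intro bexI[of _ \<alpha>]) simp_all
qed

text \<open>A model of \<open>X\<close> over \<open>\<Omega>\<close>: the maps \<open>\<Phi> f\<close> on \<open>X\<close>, with values in the corners given by \<open>p\<close>,
 are within \<open>\<eta>\<close> of the pullbacks along \<open>\<xi>\<close> and \<open>w\<close> of maps \<open>G f\<close> with values in the corners given by \<open>q\<close>.\<close>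

definition nerve_approximation ::
  "'x topology \<Rightarrow> nat \<Rightarrow> ('x \<Rightarrow> fmat) \<Rightarrow> 'f set \<Rightarrow> ('f \<Rightarrow> 'x \<Rightarrow> fmat) \<Rightarrow> nat \<Rightarrow> real \<Rightarrow> nat \<Rightarrow>
    'y topology \<Rightarrow> ('x \<Rightarrow> 'y) \<Rightarrow> ('y \<Rightarrow> fmat) \<Rightarrow> ('x \<Rightarrow> fmat) \<Rightarrow> ('f \<Rightarrow> 'y \<Rightarrow> fmat) \<Rightarrow> bool" where
  "nerve_approximation X t p F \<Phi> d \<eta> R \<Omega> \<xi> q w G \<longleftrightarrow>
     compact_space \<Omega> \<and> Hausdorff_space \<Omega> \<and> covering_dim \<Omega> \<le> enat d \<and>
     continuous_map X \<Omega> \<xi> \<and> \<xi> ` topspace X = topspace \<Omega> \<and>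
     continuous_map \<Omega> euclidean q \<and> (\<forall>y\<in>topspace \<Omega>. fits R R (q y) \<and> q y * q y = q y \<and> star (q y) = q y) \<and>
     continuous_map X euclidean w \<and>
     (\<forall>x\<in>topspace X. fits R t (w x) \<and> star (w x) * w x = p x \<and> w x * star (w x) = q (\<xi> x)) \<and>
     (\<forall>f\<in>F. continuous_map \<Omega> euclidean (G f) \<and> (\<forall>y\<in>topspace \<Omega>. fits R R (G f y) \<and> q y * G f y * q y = G f y) \<and>
       (\<forall>x\<in>topspace X. norm (\<Phi> f x - star (w x) * G f (\<xi> x) * w x) \<le> \<eta>))"

text \<open>The interpolation \<open>E f\<close> between the values of \<open>D f\<close> at the chosen points \<open>c V\<close> is within \<open>\<delta>\<close> of \<open>D f\<close>, since only
 those \<open>V\<close> that contain \<open>x\<close> contribute at \<open>\<xi> x\<close>. Passing from \<open>W\<close> to \<open>w\<close> costs another \<open>21 \<delta> K\<close> on either side.\<close>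

lemma nerve_model:
  fixes X :: "'x topology"
  assumes inf: "infinite (UNIV :: 'a set)"
    and X: "compact_space X" "Hausdorff_space X" "topspace X \<noteq> {}"
    and \<beta>: "finite_open_cover X \<beta>" and d: "\<And>x. x \<in> topspace X \<Longrightarrow> card {V\<in>\<beta>. x \<in> V} \<le> d + 1"
    and W: "continuous_map X euclidean W"
      "\<And>x. x \<in> topspace X \<Longrightarrow> fits R t (W x) \<and> star (W x) * W x * (star (W x) * W x) = star (W x) * W x"
    and f0: "f0 \<in> F" "\<And>x. x \<in> topspace X \<Longrightarrow> W x * star (W x) = D f0 x"
    and D: "\<And>f x. f \<in> F \<Longrightarrow> x \<in> topspace X \<Longrightarrow> fits R R (D f x) \<and> norm (D f x) \<le> K"
    and osc: "\<And>f V x y. f \<in> F \<Longrightarrow> V \<in> \<beta> \<Longrightarrow> x \<in> V \<Longrightarrow> y \<in> V \<Longrightarrow> norm (D f x - D f y) \<le> \<delta>"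
    and \<delta>: "0 \<le> \<delta>" "\<delta> \<le> 1/100" and K: "1 \<le> K"
  shows "\<exists>(\<Omega> :: ('a \<Rightarrow> complex) topology) \<xi> q w G. nerve_approximation X t (\<lambda>x. star (W x) * W x) F
     (\<lambda>f x. star (W x) * D f x * W x) d (43 * K * \<delta>) R \<Omega> \<xi> q w G"
proof -
  obtain \<Omega> :: "('a \<Rightarrow> complex) topology" and \<xi> t' where
    \<Omega>: "compact_space \<Omega>" "Hausdorff_space \<Omega>" and \<xi>: "continuous_map X \<Omega> \<xi>" "\<xi> ` topspace X = topspace \<Omega>"
    and dim: "covering_dim \<Omega> \<le> enat d"
    and tc: "\<And>V. V \<in> \<beta> \<Longrightarrow> continuous_map \<Omega> euclideanreal (t' V)"
    and t': "\<And>x V. x \<in> topspace X \<Longrightarrow> V \<in> \<beta> \<Longrightarrow> 0 \<le> t' V (\<xi> x) \<and> (t' V (\<xi> x) \<noteq> 0 \<longrightarrow> x \<in> V)"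
    and t1: "\<And>x. x \<in> topspace X \<Longrightarrow> (\<Sum>V\<in>\<beta>. t' V (\<xi> x)) = (1 :: real)"
    using nerve_map[OF inf X \<beta> d] by metis
  have \<beta>sub: "V \<subseteq> topspace X" if "V \<in> \<beta>" for V using \<beta> that by (auto simp: finite_open_cover_def)
  obtain x0 where x0: "x0 \<in> topspace X" using X(3) by blast
  define c where "c V = (if V = {} then x0 else SOME x. x \<in> V)" for V
  have cV: "c V \<in> V" if "V \<noteq> {}" for V using that by (simp add: c_def some_in_eq)
  have cX: "c V \<in> topspace X" if "V \<in> \<beta>" for V using cV[of V] \<beta>sub[OF that] x0 by (cases "V = {}") (auto simp: c_def)
  define E where "E f y = (\<Sum>V\<in>\<beta>. t' V y *\<^sub>R D f (c V))" for f y
  have Ec: "continuous_map \<Omega> euclidean (E f)" for f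
    unfolding E_def by (intro continuous_map_fmat_sum continuous_map_fmat(4) tc) auto
  have Ef: "fits R R (E f y)" if "f \<in> F" for f y
    unfolding E_def using D[OF that cX] by (intro fits_sum fits_scaleR) auto
  have ED: "norm (E f (\<xi> x) - D f x) \<le> \<delta>" if f: "f \<in> F" and x: "x \<in> topspace X" for f x
  proof -
    have "D f x = (\<Sum>V\<in>\<beta>. t' V (\<xi> x) *\<^sub>R D f x)" using t1[OF x] by (simp flip: scaleR_sum_left)
    then have "E f (\<xi> x) - D f x = (\<Sum>V\<in>\<beta>. t' V (\<xi> x) *\<^sub>R D f (c V)) - (\<Sum>V\<in>\<beta>. t' V (\<xi> x) *\<^sub>R D f x)"
      by (simp add: E_def)
    also have "\<dots> = (\<Sum>V\<in>\<beta>. t' V (\<xi> x) *\<^sub>R (D f (c V) - D f x))"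
      by (simp add: scaleR_right_diff_distrib sum_subtractf)
    also have "norm \<dots> \<le> (\<Sum>V\<in>\<beta>. t' V (\<xi> x) * \<delta>)"
    proof (rule order_trans[OF norm_sum], rule sum_mono)
      fix V assume V: "V \<in> \<beta>"
      note tV = t'[OF x V]
      show "norm (t' V (\<xi> x) *\<^sub>R (D f (c V) - D f x)) \<le> t' V (\<xi> x) * \<delta>"
      proof (cases "t' V (\<xi> x) = 0")
        case False
        then have "x \<in> V" using tV by blast
        then have "norm (D f (c V) - D f x) \<le> \<delta>" using osc[OF f V cV] by blast
        then show ?thesis using tV by (simp add: mult_left_mono)
      qed simp
    qed
    also have "\<dots> = \<delta>" using t1[OF x] by (simp flip: sum_distrib_right)
    finally show ?thesis .
  qed
  have EK: "norm (E f (\<xi> x)) \<le> K" if f: "f \<in> F" and x: "x \<in> topspace X" for f x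
  proof -
    have "norm (E f (\<xi> x)) \<le> (\<Sum>V\<in>\<beta>. t' V (\<xi> x) * K)"
      unfolding E_def using t'[OF x] D[OF f cX]
      by (intro order_trans[OF norm_sum] sum_mono) (auto intro!: mult_left_mono)
    also have "\<dots> = K" using t1[OF x] by (simp flip: sum_distrib_right)
    finally show ?thesis .
  qed
  have sE: "star (E f0 y) = E f0 y" for y
    unfolding E_def using f0(2)[OF cX, symmetric] by simp
  obtain q w where q: "continuous_map \<Omega> euclidean q" "\<forall>y\<in>topspace \<Omega>. fits R R (q y) \<and> q y * q y = q y \<and> star (q y) = q y"
    and w: "continuous_map X euclidean w" "\<And>x. x \<in> topspace X \<Longrightarrow> fits R t (w x) \<and> star (w x) * w x = star (W x) * W x \<and>
       w x * star (w x) = q (\<xi> x) \<and> norm (w x - W x) \<le> 21 * \<delta>"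
    using projection_perturbation[OF \<xi> Ec[of f0] _ W, of \<delta>] Ef[OF f0(1)] sE ED[OF f0(1)] f0(2) \<delta> by metis
  define G where "G f y = q y * E f y * q y" for f y
  have Gc: "continuous_map \<Omega> euclidean (G f)" for f unfolding G_def by (intro continuous_map_fmat(3) q(1) Ec)
  have Gf: "fits R R (G f y)" "q y * G f y * q y = G f y" if "f \<in> F" "y \<in> topspace \<Omega>" for f y
  proof -
    show "fits R R (G f y)" unfolding G_def using q(2) that Ef[OF that(1)] by (intro fits_times) auto
    have "q y * G f y * q y = (q y * q y) * E f y * (q y * q y)" by (simp add: G_def mult.assoc)
    then show "q y * G f y * q y = G f y" using q(2) that by (simp add: G_def)
  qed
  have est: "norm (star (W x) * D f x * W x - star (w x) * G f (\<xi> x) * w x) \<le> 43 * K * \<delta>" if f: "f \<in> F" and x: "x \<in> topspace X" for f x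
  proof -
    note wx = w(2)[OF x] and Wx = W(2)[OF x]
    have W1: "norm (W x) \<le> 1" by (rule norm_partial_isometry_le_1[of "star (W x) * W x"]) (use Wx in auto)
    have w1: "norm (w x) \<le> 1" by (rule norm_partial_isometry_le_1[of "star (W x) * W x"]) (use Wx wx in auto)
    have qw: "q (\<xi> x) * w x = w x"
      using partial_isometry_absorb[of "w x"] wx Wx by (metis mult.assoc)
    have wq: "star (w x) * q (\<xi> x) = star (w x)"
    proof -
      have "star (q (\<xi> x)) = q (\<xi> x)" using q(2) \<xi>(2) x by blast
      then show ?thesis using arg_cong[OF qw, of star] by simp
    qed
    have "star (w x) * G f (\<xi> x) * w x = (star (w x) * q (\<xi> x)) * E f (\<xi> x) * (q (\<xi> x) * w x)"
      by (simp add: G_def mult.assoc)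
    then have eq: "star (w x) * G f (\<xi> x) * w x = star (w x) * E f (\<xi> x) * w x" unfolding qw wq .
    have split: "star (W x) * D f x * W x - star (w x) * E f (\<xi> x) * w x
      = star (W x - w x) * D f x * W x + star (w x) * (D f x - E f (\<xi> x)) * W x + star (w x) * E f (\<xi> x) * (W x - w x)"
      by (simp add: algebra_simps)
    have "norm (star (W x) * D f x * W x - star (w x) * E f (\<xi> x) * w x) \<le> norm (star (W x - w x) * D f x * W x) + norm (star (w x) * (D f x - E f (\<xi> x)) * W x)
        + norm (star (w x) * E f (\<xi> x) * (W x - w x))"
      unfolding split by (rule order_trans[OF norm_triangle_ineq add_right_mono[OF norm_triangle_ineq]])
    also have "\<dots> \<le> (21 * \<delta> * K) * 1 + (1 * \<delta>) * 1 + (1 * K) * (21 * \<delta>)"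
      by (intro add_mono order_trans[OF norm_mult_ineq] mult_mono)
         (use wx D[OF f x] W1 w1 ED[OF f x] EK[OF f x] \<delta> K in \<open>auto simp: norm_minus_commute simp del: star_minus\<close>)
    also have "\<dots> \<le> 43 * K * \<delta>" using mult_right_mono[OF K \<delta>(1)] by (simp add: algebra_simps)
    finally show ?thesis unfolding eq .
  qed
  show ?thesis
    unfolding nerve_approximation_def
    using \<Omega> dim \<xi> q w Gc Gf est
    by (intro exI[of _ \<Omega>] exI[of _ \<xi>] exI[of _ q] exI[of _ w] exI[of _ G]) blast
qed

section \<open>The metric of a C*-algebra\<close>

context unital_cstar_algebra
begin

lemma cdist_triangle:
  assumes "x \<in> carrier A" "y \<in> carrier A" "z \<in> carrier A"
  shows "cdist A x z \<le> cdist A x y + cdist A y z"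
proof -
  interpret R: ring A by (rule ring)
  have "(x \<ominus> y) \<oplus> (y \<ominus> z) = x \<ominus> z"
    using assms by (simp add: R.minus_eq R.a_assoc R.r_neg1)
  then show ?thesis using cnorm_triangle[of "x \<ominus> y" "y \<ominus> z"] assms by (simp add: cdist_def)
qed

lemma minus_eq_smult: assumes "x \<in> carrier A" shows "\<ominus> x = (-1) \<odot> x"
proof -
  interpret R: ring A by (rule ring)
  interpret M: Module.module "class_ring :: complex ring" A by (rule module)
  have c: "(-1) \<odot> x \<in> carrier A" using M.smult_closed[of "-1" x] assms by simp
  have "(-1) \<odot> x \<oplus> x = (-1) \<odot> x \<oplus> 1 \<odot> x" using M.smult_one[OF assms] by simp
  also have "\<dots> = (-1 + 1) \<odot> x" using M.smult_l_distr[of "-1" 1 x] assms by simp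
  also have "\<dots> = \<zero>" using M.smult_l_null[OF assms] by simp
  finally show ?thesis using assms c by (intro R.minus_equality)
qed

lemma cdist_commute: assumes "x \<in> carrier A" "y \<in> carrier A" shows "cdist A x y = cdist A y x"
proof -
  interpret R: ring A by (rule ring)
  have "y \<ominus> x = \<ominus> (x \<ominus> y)" using assms by (simp add: R.minus_eq R.minus_add R.a_comm)
  also have "\<dots> = (-1) \<odot> (x \<ominus> y)" using assms by (intro minus_eq_smult) simp
  finally show ?thesis using assms cnorm_smult[of "x \<ominus> y" "-1"] by (simp add: cdist_def)
qed

lemma cdist_nonneg: "x \<in> carrier A \<Longrightarrow> y \<in> carrier A \<Longrightarrow> 0 \<le> cdist A x y"
proof -
  interpret R: ring A by (rule ring)
  show "x \<in> carrier A \<Longrightarrow> y \<in> carrier A \<Longrightarrow> 0 \<le> cdist A x y" unfolding cdist_def by (intro cnorm_nonneg) simp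
qed

lemma cdist_eq_0: assumes "x \<in> carrier A" "y \<in> carrier A" "cdist A x y = 0" shows "x = y"
proof -
  interpret R: ring A by (rule ring)
  have "x \<ominus> y = \<zero>" using assms cnorm_eq_0[of "x \<ominus> y"] by (simp add: cdist_def)
  then show ?thesis using assms by (simp add: R.r_right_minus_eq)
qed

text \<open>This provides room for the coordinates of the nerves in the type of elements, and the norm of the unit
 detects that some limit set is nonempty.\<close>

lemma infinite_carrier:
  assumes "carrier A \<noteq> {\<zero>}"
  shows "infinite (carrier A)" "0 < cnorm A \<one>"
proof -
  interpret R: ring A by (rule ring)
  interpret M: Module.module "class_ring :: complex ring" A by (rule module)
  have "\<one> \<noteq> \<zero>" using assms R.one_zeroD by blast
  then show pos: "0 < cnorm A \<one>" using cnorm_eq_0[of \<one>] cnorm_nonneg[of \<one>] by simp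
  have "inj (\<lambda>n :: nat. of_nat n \<odot> \<one>)"
  proof (rule injI)
    fix n k :: nat assume "of_nat n \<odot> \<one> = of_nat k \<odot> \<one>"
    then have "real n * cnorm A \<one> = real k * cnorm A \<one>" using cnorm_smult[of \<one> "of_nat n"] cnorm_smult[of \<one> "of_nat k"] by auto
    then show "n = k" using pos by auto
  qed
  then have "infinite (range (\<lambda>n :: nat. of_nat n \<odot> \<one>))" by (rule range_inj_infinite)
  moreover have "range (\<lambda>n :: nat. of_nat n \<odot> \<one>) \<subseteq> carrier A" using M.smult_closed by auto
  ultimately show "infinite (carrier A)" using infinite_super by blast
qed

end

section \<open>Subalgebras pulled back from another space\<close>

text \<open>Tietze's theorem for the real and imaginary parts of the entries.\<close>

lemma fmat_Tietze:
  fixes G :: "'x \<Rightarrow> fmat"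
  assumes X: "normal_space X" "closedin X Y" and G: "continuous_map (subtopology X Y) euclidean G"
    and fit: "\<And>x. x \<in> Y \<Longrightarrow> fits a b (G x)"
  shows "\<exists>G'. continuous_map X euclidean G' \<and> (\<forall>x. fits a b (G' x)) \<and> (\<forall>x\<in>Y. G' x = G x)"
proof -
  have ext: "\<exists>g. continuous_map X euclideanreal g \<and> (\<forall>x\<in>Y. g x = f x)"
    if "continuous_map (subtopology X Y) euclideanreal f" for f
    using Tietze_extension_realinterval[OF X is_interval_univ _ that] by (metis UNIV_not_empty subset_UNIV)
  have re: "continuous_map (subtopology X Y) euclideanreal (\<lambda>x. Re (ent (G x) i j))"
    and im: "continuous_map (subtopology X Y) euclideanreal (\<lambda>x. Im (ent (G x) i j))" for i j
    using continuous_map_fmat(7)[OF G, of i j] unfolding continuous_map_tendsto by (auto intro!: tendsto_intros)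
  obtain gr where gr: "\<And>i j. continuous_map X euclideanreal (gr i j) \<and> (\<forall>x\<in>Y. gr i j x = Re (ent (G x) i j))"
    using ext[OF re] by metis
  obtain gi where gi: "\<And>i j. continuous_map X euclideanreal (gi i j) \<and> (\<forall>x\<in>Y. gi i j x = Im (ent (G x) i j))"
    using ext[OF im] by metis
  \<comment> \<open>The entries of the extension are assembled into a matrix of the original size.\<close>
  define G' where "G' x = to_fm (Matrix.mat a b (\<lambda>(i, j). Complex (gr i j x) (gi i j x)))" for x
  have fG: "fits a b (G' x)" for x unfolding G'_def by (rule fits_to_fm) simp
  have eG: "ent (G' x) i j = Complex (gr i j x) (gi i j x)" if "i < a" "j < b" for x i j
    using that by (simp add: G'_def ent_to_fm)
  have "continuous_map X euclidean G'"
  proof (rule continuous_map_fmat_entries[OF fG])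
    fix i j assume "i < a" "j < b"
    have "continuous_map X euclidean (\<lambda>x. Complex (gr i j x) (gi i j x))"
      using gr gi unfolding continuous_map_tendsto by (auto intro!: tendsto_Complex)
    then show "continuous_map X euclidean (\<lambda>x. ent (G' x) i j)" using eG[OF \<open>i < a\<close> \<open>j < b\<close>] by simp
  qed
  moreover have "G' x = G x" if "x \<in> Y" for x
  proof (rule fmat_eqI)
    fix i j
    show "ent (G' x) i j = ent (G x) i j"
    proof (cases "i < a \<and> j < b")
      case True
      then show ?thesis using eG gr gi that by simp
    next
      case False
      then show ?thesis using fitsD[OF fG] fitsD[OF fit[OF that]] by (metis not_less)
    qed
  qed
  ultimately show ?thesis using fG by blast
qed

text \<open>The map \<open>\<psi>\<close> sees exactly the values on the closed sets \<open>Y l\<close>, and over the nonempty ones among them, enumerated by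
 \<open>\<kappa>\<close>, the corner of \<open>T\<close> is identified through \<open>w\<close> with the pullback along \<open>\<xi>\<close> of the corner of \<open>H\<close>. Under these assumptions the
 algebra of \<open>H\<close> embeds isometrically into \<open>A\<close>.\<close>

locale pullback_model =
  fixes A :: "'a cstar_algebra" and T :: "'x homog_data" and \<psi> :: "(nat \<Rightarrow> 'x \<Rightarrow> complex mat) \<Rightarrow> 'a"
    and Y :: "nat \<Rightarrow> 'x set" and H :: "'y homog_data" and \<kappa> :: "nat \<Rightarrow> nat"
    and \<xi> :: "nat \<Rightarrow> 'x \<Rightarrow> 'y" and w :: "nat \<Rightarrow> 'x \<Rightarrow> fmat"
  assumes A: "unital_cstar_algebra A" and T: "homogeneous T" and H: "homogeneous H"
    and \<psi>: "\<psi> \<in> star_hom (homog_algebra T) A"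
    and Y: "l < summands T \<Longrightarrow> closedin (spc T l) (Y l)"
    and norm_\<psi>: "f \<in> carrier (homog_algebra T) \<Longrightarrow> 0 \<le> c \<Longrightarrow>
      cnorm A (\<psi> f) \<le> c \<longleftrightarrow> (\<forall>l<summands T. \<forall>x\<in>Y l. norm (fval f l x) \<le> c)"
    and \<kappa>: "bij_betw \<kappa> {..<summands H} {l. l < summands T \<and> Y l \<noteq> {}}"
    and \<xi>: "i < summands H \<Longrightarrow> continuous_map (subtopology (spc T (\<kappa> i)) (Y (\<kappa> i))) (spc H i) (\<xi> i)"
      "i < summands H \<Longrightarrow> \<xi> i ` Y (\<kappa> i) = topspace (spc H i)"
    and w: "i < summands H \<Longrightarrow> continuous_map (subtopology (spc T (\<kappa> i)) (Y (\<kappa> i))) euclidean (w i)"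
      "i < summands H \<Longrightarrow> x \<in> Y (\<kappa> i) \<Longrightarrow> fits (msize H i) (msize T (\<kappa> i)) (w i x)"
      "i < summands H \<Longrightarrow> x \<in> Y (\<kappa> i) \<Longrightarrow> star (w i x) * w i x = fval (prj T) (\<kappa> i) x"
      "i < summands H \<Longrightarrow> x \<in> Y (\<kappa> i) \<Longrightarrow> w i x * star (w i x) = fval (prj H) i (\<xi> i x)"
begin

definition pulls_back where
  "pulls_back g f \<longleftrightarrow> (\<forall>i<summands H. \<forall>x\<in>Y (\<kappa> i). fval f (\<kappa> i) x = star (w i x) * fval g i (\<xi> i x) * w i x)"

definition image_algebra where
  "image_algebra = {\<psi> f | f g. f \<in> carrier (homog_algebra T) \<and> g \<in> carrier (homog_algebra H) \<and> pulls_back g f}"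

lemma \<kappa>_less: "i < summands H \<Longrightarrow> \<kappa> i < summands T" "i < summands H \<Longrightarrow> Y (\<kappa> i) \<noteq> {}"
  using bij_betwE[OF \<kappa>] by auto

lemma Y_sub: "l < summands T \<Longrightarrow> x \<in> Y l \<Longrightarrow> x \<in> topspace (spc T l)"
  using closedin_subset[OF Y] by blast

lemma all_\<kappa>: "(\<forall>l<summands T. \<forall>x\<in>Y l. P l x) \<longleftrightarrow> (\<forall>i<summands H. \<forall>x\<in>Y (\<kappa> i). P (\<kappa> i) x)"
proof
  assume R: "\<forall>i<summands H. \<forall>x\<in>Y (\<kappa> i). P (\<kappa> i) x"
  show "\<forall>l<summands T. \<forall>x\<in>Y l. P l x"
  proof (intro allI impI ballI)
    fix l x assume "l < summands T" "x \<in> Y l"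
    then have "l \<in> \<kappa> ` {..<summands H}" using bij_betw_imp_surj_on[OF \<kappa>] by blast
    then show "P l x" using R \<open>x \<in> Y l\<close> by blast
  qed
qed (use \<kappa>_less in blast)

lemma \<xi>_in: "i < summands H \<Longrightarrow> x \<in> Y (\<kappa> i) \<Longrightarrow> \<xi> i x \<in> topspace (spc H i)"
  using \<xi>(2) by blast

lemma w_absorb:
  assumes "i < summands H" "x \<in> Y (\<kappa> i)"
  shows "w i x * fval (prj T) (\<kappa> i) x = w i x" "fval (prj T) (\<kappa> i) x * star (w i x) = star (w i x)"
    "norm (w i x) \<le> 1"
proof -
  have x: "\<kappa> i < summands T" "x \<in> topspace (spc T (\<kappa> i))" using \<kappa>_less(1)[OF assms(1)] Y_sub assms(2) by blast+
  note p = homogeneousD(8,9)[OF T x] and ww = w(3)[OF assms]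
  show 1: "w i x * fval (prj T) (\<kappa> i) x = w i x"
    using partial_isometry_absorb[of "w i x"] unfolding ww p(1) by simp
  show "fval (prj T) (\<kappa> i) x * star (w i x) = star (w i x)" using arg_cong[OF 1, of star] p(2) by simp
  show "norm (w i x) \<le> 1" by (rule norm_partial_isometry_le_1[OF p ww])
qed

lemma \<psi>_hom:
  shows "f \<in> carrier (homog_algebra T) \<Longrightarrow> \<psi> f \<in> carrier A"
    and "f \<in> carrier (homog_algebra T) \<Longrightarrow> g \<in> carrier (homog_algebra T) \<Longrightarrow> \<psi> (f \<otimes>\<^bsub>homog_algebra T\<^esub> g) = \<psi> f \<otimes>\<^bsub>A\<^esub> \<psi> g"
    and "f \<in> carrier (homog_algebra T) \<Longrightarrow> g \<in> carrier (homog_algebra T) \<Longrightarrow> \<psi> (f \<oplus>\<^bsub>homog_algebra T\<^esub> g) = \<psi> f \<oplus>\<^bsub>A\<^esub> \<psi> g"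
    and "\<psi> \<one>\<^bsub>homog_algebra T\<^esub> = \<one>\<^bsub>A\<^esub>"
    and "f \<in> carrier (homog_algebra T) \<Longrightarrow> \<psi> (c \<odot>\<^bsub>homog_algebra T\<^esub> f) = c \<odot>\<^bsub>A\<^esub> \<psi> f"
    and "f \<in> carrier (homog_algebra T) \<Longrightarrow> \<psi> (adj (homog_algebra T) f) = adj A (\<psi> f)"
proof -
  have hom: "\<psi> \<in> Ring.ring_hom (homog_algebra T) A" using \<psi> by (simp add: star_hom_def)
  note r = ring_hom_closed[OF hom] ring_hom_mult[OF hom] ring_hom_add[OF hom] ring_hom_one[OF hom]
  show "f \<in> carrier (homog_algebra T) \<Longrightarrow> \<psi> f \<in> carrier A" by (rule r(1))
  show "f \<in> carrier (homog_algebra T) \<Longrightarrow> g \<in> carrier (homog_algebra T) \<Longrightarrow> \<psi> (f \<otimes>\<^bsub>homog_algebra T\<^esub> g) = \<psi> f \<otimes>\<^bsub>A\<^esub> \<psi> g"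
    by (rule r(2))
  show "f \<in> carrier (homog_algebra T) \<Longrightarrow> g \<in> carrier (homog_algebra T) \<Longrightarrow> \<psi> (f \<oplus>\<^bsub>homog_algebra T\<^esub> g) = \<psi> f \<oplus>\<^bsub>A\<^esub> \<psi> g"
    by (rule r(3))
  show "\<psi> \<one>\<^bsub>homog_algebra T\<^esub> = \<one>\<^bsub>A\<^esub>" by (rule r(4))
  show "f \<in> carrier (homog_algebra T) \<Longrightarrow> \<psi> (c \<odot>\<^bsub>homog_algebra T\<^esub> f) = c \<odot>\<^bsub>A\<^esub> \<psi> f"
    "f \<in> carrier (homog_algebra T) \<Longrightarrow> \<psi> (adj (homog_algebra T) f) = adj A (\<psi> f)"
    using \<psi> by (simp_all add: star_hom_def)
qed

lemma cdist_\<psi>_le_iff: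
  assumes f: "f \<in> carrier (homog_algebra T)" "f' \<in> carrier (homog_algebra T)" and c: "0 \<le> c"
  shows "cdist A (\<psi> f) (\<psi> f') \<le> c \<longleftrightarrow> (\<forall>i<summands H. \<forall>x\<in>Y (\<kappa> i). norm (fval f (\<kappa> i) x - fval f' (\<kappa> i) x) \<le> c)"
proof -
  interpret R: ring A by (rule unital_cstar_algebra.ring[OF A])
  define d where "d = homog_mk T (\<lambda>l x. fval f l x - fval f' l x)"
  have d: "d \<in> carrier (homog_algebra T)"
    and hd: "\<And>l x. l < summands T \<Longrightarrow> x \<in> topspace (spc T l) \<Longrightarrow> fval d l x = fval f l x - fval f' l x"
    unfolding d_def using homog_carrierD[OF T f(1)] homog_carrierD[OF T f(2)]
    by (intro homog_mk[OF T]; auto intro!: continuous_map_fmat simp: left_diff_distrib right_diff_distrib)+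
  have "d \<oplus>\<^bsub>homog_algebra T\<^esub> f' = f"
    by (rule homog_ext[OF T]) (simp_all add: homog_closed[OF T] homog_fval_ops[OF T] d f hd)
  then have "\<psi> f = \<psi> d \<oplus>\<^bsub>A\<^esub> \<psi> f'" using \<psi>_hom(3)[OF d f(2)] by simp
  then have "\<psi> f \<ominus>\<^bsub>A\<^esub> \<psi> f' = \<psi> d"
    using \<psi>_hom(1) d f by (simp add: R.minus_eq R.a_assoc R.r_neg)
  then have "cdist A (\<psi> f) (\<psi> f') \<le> c \<longleftrightarrow> (\<forall>l<summands T. \<forall>x\<in>Y l. norm (fval d l x) \<le> c)"
    using norm_\<psi>[OF d c] by (simp add: cdist_def)
  then show ?thesis unfolding all_\<kappa> using hd \<kappa>_less(1) Y_sub by auto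
qed

lemma pulls_back_inverse:
  assumes "pulls_back g f" "g \<in> carrier (homog_algebra H)" "i < summands H" "x \<in> Y (\<kappa> i)"
  shows "fval g i (\<xi> i x) = w i x * fval f (\<kappa> i) x * star (w i x)"
proof -
  have "w i x * fval f (\<kappa> i) x * star (w i x) = (w i x * star (w i x)) * fval g i (\<xi> i x) * (w i x * star (w i x))"
    using assms(1,3,4) by (simp add: pulls_back_def mult.assoc)
  also have "\<dots> = fval g i (\<xi> i x)"
    unfolding w(4)[OF assms(3,4)] using homog_carrierD(3,4)[OF H assms(2,3) \<xi>_in[OF assms(3,4)]] by simp
  finally show ?thesis by simp
qed

text \<open>Conjugation by \<open>w\<close> does not increase norms, and it is undone by conjugation by \<open>w\<^sup>*\<close>.\<close>

lemma norm_pulls_back_diff: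
  assumes "pulls_back g f" "pulls_back g' f'" "g \<in> carrier (homog_algebra H)" "g' \<in> carrier (homog_algebra H)" 
    and i: "i < summands H" "x \<in> Y (\<kappa> i)"
  shows "norm (fval f (\<kappa> i) x - fval f' (\<kappa> i) x) = norm (fval g i (\<xi> i x) - fval g' i (\<xi> i x))"
proof (rule antisym)
  have n: "norm (a * b * star a) \<le> norm b" "norm (star a * b * a) \<le> norm b" if "norm a \<le> 1" for a b
  proof -
    have "norm (a * b * star a) \<le> (1 * norm b) * 1"
      by (intro order_trans[OF norm_mult_ineq] mult_mono) (use that in auto)
    then show "norm (a * b * star a) \<le> norm b" by simp
    have "norm (star a * b * a) \<le> (1 * norm b) * 1"
      by (intro order_trans[OF norm_mult_ineq] mult_mono) (use that in auto)
    then show "norm (star a * b * a) \<le> norm b" by simp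
  qed
  have "fval f (\<kappa> i) x - fval f' (\<kappa> i) x = star (w i x) * (fval g i (\<xi> i x) - fval g' i (\<xi> i x)) * w i x"
    using assms(1,2) i by (simp add: pulls_back_def algebra_simps)
  then show "norm (fval f (\<kappa> i) x - fval f' (\<kappa> i) x) \<le> norm (fval g i (\<xi> i x) - fval g' i (\<xi> i x))"
    using n(2)[OF w_absorb(3)[OF i]] by simp
  have "fval g i (\<xi> i x) - fval g' i (\<xi> i x) = w i x * (fval f (\<kappa> i) x - fval f' (\<kappa> i) x) * star (w i x)"
    using pulls_back_inverse[OF assms(1,3) i] pulls_back_inverse[OF assms(2,4) i] by (simp add: algebra_simps)
  then show "norm (fval g i (\<xi> i x) - fval g' i (\<xi> i x)) \<le> norm (fval f (\<kappa> i) x - fval f' (\<kappa> i) x)"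
    using n(1)[OF w_absorb(3)[OF i]] by simp
qed

lemma all_\<xi>: "i < summands H \<Longrightarrow> (\<forall>x\<in>Y (\<kappa> i). P (\<xi> i x)) \<longleftrightarrow> (\<forall>y\<in>topspace (spc H i). P y)"
  unfolding \<xi>(2)[symmetric] by simp

lemma cdist_pulls_back:
  assumes "pulls_back g f" "pulls_back g' f'" "g \<in> carrier (homog_algebra H)" "g' \<in> carrier (homog_algebra H)" 
    "f \<in> carrier (homog_algebra T)" "f' \<in> carrier (homog_algebra T)" "0 \<le> c"
  shows "cdist A (\<psi> f) (\<psi> f') \<le> c \<longleftrightarrow> (\<forall>i<summands H. \<forall>y\<in>topspace (spc H i). norm (fval g i y - fval g' i y) \<le> c)"
  unfolding cdist_\<psi>_le_iff[OF assms(5,6,7)] using norm_pulls_back_diff[OF assms(1-4)] all_\<xi>[where P = "\<lambda>y. norm (fval g _ y - fval g' _ y) \<le> c"]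
  by simp

lemma \<psi>_eq_iff:
  assumes "pulls_back g f" "pulls_back g' f'" "g \<in> carrier (homog_algebra H)" "g' \<in> carrier (homog_algebra H)" 
    "f \<in> carrier (homog_algebra T)" "f' \<in> carrier (homog_algebra T)"
  shows "\<psi> f = \<psi> f' \<longleftrightarrow> g = g'"
proof -
  interpret R: ring A by (rule unital_cstar_algebra.ring[OF A])
  have car: "\<psi> f \<in> carrier A" "\<psi> f' \<in> carrier A" using assms \<psi>_hom(1) by blast+
  have "\<psi> f = \<psi> f' \<longleftrightarrow> cdist A (\<psi> f) (\<psi> f') \<le> 0"
  proof
    assume "\<psi> f = \<psi> f'"
    then show "cdist A (\<psi> f) (\<psi> f') \<le> 0" using car unital_cstar_algebra.cnorm_eq_0[OF A, of "\<zero>\<^bsub>A\<^esub>"]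
      by (simp add: cdist_def R.minus_eq R.r_neg)
  next
    assume "cdist A (\<psi> f) (\<psi> f') \<le> 0"
    then show "\<psi> f = \<psi> f'"
      using unital_cstar_algebra.cdist_nonneg[OF A car] unital_cstar_algebra.cdist_eq_0[OF A car] by simp
  qed
  also have "\<dots> \<longleftrightarrow> (\<forall>i<summands H. \<forall>y\<in>topspace (spc H i). fval g i y = fval g' i y)"
    using cdist_pulls_back[OF assms order_refl] by simp
  also have "\<dots> \<longleftrightarrow> g = g'" using homog_ext[OF H assms(3,4)] by blast
  finally show ?thesis .
qed

lemma pulls_back_ops:
  shows "pulls_back \<one>\<^bsub>homog_algebra H\<^esub> \<one>\<^bsub>homog_algebra T\<^esub>"
    and "pulls_back g f \<Longrightarrow> g \<in> carrier (homog_algebra H) \<Longrightarrow> f \<in> carrier (homog_algebra T) \<Longrightarrow>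
      pulls_back (c \<odot>\<^bsub>homog_algebra H\<^esub> g) (c \<odot>\<^bsub>homog_algebra T\<^esub> f)"
    and "pulls_back g f \<Longrightarrow> g \<in> carrier (homog_algebra H) \<Longrightarrow> f \<in> carrier (homog_algebra T) \<Longrightarrow>
      pulls_back (adj (homog_algebra H) g) (adj (homog_algebra T) f)"
    and "pulls_back g f \<Longrightarrow> pulls_back g' f' \<Longrightarrow> g \<in> carrier (homog_algebra H) \<Longrightarrow> f \<in> carrier (homog_algebra T) \<Longrightarrow>
      g' \<in> carrier (homog_algebra H) \<Longrightarrow> f' \<in> carrier (homog_algebra T) \<Longrightarrow>
      pulls_back (g \<otimes>\<^bsub>homog_algebra H\<^esub> g') (f \<otimes>\<^bsub>homog_algebra T\<^esub> f')"
    and "pulls_back g f \<Longrightarrow> pulls_back g' f' \<Longrightarrow> g \<in> carrier (homog_algebra H) \<Longrightarrow> f \<in> carrier (homog_algebra T) \<Longrightarrow>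
      g' \<in> carrier (homog_algebra H) \<Longrightarrow> f' \<in> carrier (homog_algebra T) \<Longrightarrow>
      pulls_back (g \<oplus>\<^bsub>homog_algebra H\<^esub> g') (f \<oplus>\<^bsub>homog_algebra T\<^esub> f')"
proof -
  have in_T: "\<kappa> i < summands T" "x \<in> topspace (spc T (\<kappa> i))" if "i < summands H" "x \<in> Y (\<kappa> i)" for i x
    using \<kappa>_less(1)[OF that(1)] Y_sub that by blast+
  note ops = homog_fval_ops[OF T in_T] homog_fval_ops[OF H _ \<xi>_in]
  show "pulls_back \<one>\<^bsub>homog_algebra H\<^esub> \<one>\<^bsub>homog_algebra T\<^esub>"
    unfolding pulls_back_def
  proof (intro allI impI ballI)
    fix i x assume i: "i < summands H" "x \<in> Y (\<kappa> i)"
    have "star (w i x) * (w i x * star (w i x)) * w i x = star (w i x) * w i x * (star (w i x) * w i x)" by (simp add: mult.assoc)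
    then show "fval \<one>\<^bsub>homog_algebra T\<^esub> (\<kappa> i) x = star (w i x) * fval \<one>\<^bsub>homog_algebra H\<^esub> i (\<xi> i x) * w i x"
      unfolding ops(1)[OF i i] ops(7)[OF i(1) i] using w(3,4)[OF i] homogeneousD(8)[OF T in_T[OF i]] by simp
  qed
  assume g: "pulls_back g f" "g \<in> carrier (homog_algebra H)" "f \<in> carrier (homog_algebra T)"
  show "pulls_back (c \<odot>\<^bsub>homog_algebra H\<^esub> g) (c \<odot>\<^bsub>homog_algebra T\<^esub> f)"
    using g unfolding pulls_back_def by (auto simp: ops scl_mult)
  show "pulls_back (adj (homog_algebra H) g) (adj (homog_algebra T) f)"
    using g unfolding pulls_back_def by (auto simp: ops mult.assoc)
  assume g': "pulls_back g' f'" "g' \<in> carrier (homog_algebra H)" "f' \<in> carrier (homog_algebra T)"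
  show "pulls_back (g \<oplus>\<^bsub>homog_algebra H\<^esub> g') (f \<oplus>\<^bsub>homog_algebra T\<^esub> f')"
    using g g' unfolding pulls_back_def by (auto simp: ops algebra_simps)
  show "pulls_back (g \<otimes>\<^bsub>homog_algebra H\<^esub> g') (f \<otimes>\<^bsub>homog_algebra T\<^esub> f')"
    unfolding pulls_back_def
  proof (intro allI impI ballI)
    fix i x assume i: "i < summands H" "x \<in> Y (\<kappa> i)"
    have "fval f (\<kappa> i) x * fval f' (\<kappa> i) x = star (w i x) * (fval g i (\<xi> i x) * (w i x * star (w i x))) * fval g' i (\<xi> i x) * w i x"
      using g(1) g'(1) i by (simp add: pulls_back_def mult.assoc)
    also have "fval g i (\<xi> i x) * (w i x * star (w i x)) = fval g i (\<xi> i x)"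
      unfolding w(4)[OF i] by (rule homog_carrierD(4)[OF H g(2) i(1) \<xi>_in[OF i]])
    finally show "fval (f \<otimes>\<^bsub>homog_algebra T\<^esub> f') (\<kappa> i) x = star (w i x) * fval (g \<otimes>\<^bsub>homog_algebra H\<^esub> g') i (\<xi> i x) * w i x"
      unfolding ops(5)[OF i i g(3) g'(3)] ops(11)[OF i(1) i g(2) g'(2)] by (simp add: mult.assoc)
  qed
qed

text \<open>The function to be lifted is given on the closed sets \<open>Y l\<close>; an extension by Tietze's theorem is cut down by the
 unit of \<open>T\<close>, which does not change it on \<open>Y l\<close>.\<close>

lemma ex_pulls_back:
  assumes g: "g \<in> carrier (homog_algebra H)"
  shows "\<exists>f\<in>carrier (homog_algebra T). pulls_back g f"
proof -
  have "\<forall>l\<in>{..<summands T}. \<exists>G. continuous_map (spc T l) euclidean G \<and> (\<forall>x. fits (msize T l) (msize T l) (G x)) \<and>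
     (\<forall>i<summands H. \<kappa> i = l \<longrightarrow> (\<forall>x\<in>Y l. G x = star (w i x) * fval g i (\<xi> i x) * w i x))"
  proof
    fix l assume "l \<in> {..<summands T}"
    then have l: "l < summands T" by simp
    show "\<exists>G. continuous_map (spc T l) euclidean G \<and> (\<forall>x. fits (msize T l) (msize T l) (G x)) \<and>
     (\<forall>i<summands H. \<kappa> i = l \<longrightarrow> (\<forall>x\<in>Y l. G x = star (w i x) * fval g i (\<xi> i x) * w i x))"
    proof (cases "\<exists>i<summands H. \<kappa> i = l")
      case False
      then show ?thesis by (intro exI[of _ "\<lambda>_. 0"]) auto
    next
      case True
      then obtain i where i: "i < summands H" "\<kappa> i = l" by blast
      have uniq: "i' = i" if "i' < summands H" "\<kappa> i' = l" for i'
        using bij_betw_imp_inj_on[OF \<kappa>] that i by (auto simp: inj_on_def)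
      have "normal_space (spc T l)"
        using homogeneousD(2,3)[OF T l] by (intro compact_Hausdorff_or_regular_imp_normal_space) auto
      have c\<xi>: "continuous_map (subtopology (spc T l) (Y l)) euclidean (\<lambda>x. fval g i (\<xi> i x))"
        using continuous_map_compose[OF \<xi>(1)[OF i(1)] homog_carrierD(1)[OF H g i(1)]] i by (simp add: o_def)
      have cw: "continuous_map (subtopology (spc T l) (Y l)) euclidean (w i)" using w(1)[OF i(1)] i(2) by simp
      have cG: "continuous_map (subtopology (spc T l) (Y l)) euclidean (\<lambda>x. star (w i x) * fval g i (\<xi> i x) * w i x)"
        by (rule continuous_map_fmat(3)[OF continuous_map_fmat(3)[OF continuous_map_fmat(6)[OF cw] c\<xi>] cw])
      have fG: "fits (msize T l) (msize T l) (star (w i x) * fval g i (\<xi> i x) * w i x)" if "x \<in> Y l" for x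
      proof -
        have f: "fits (msize H i) (msize T l) (w i x)" using w(2)[OF i(1)] that i by simp
        then have f': "fits (msize T l) (msize H i) (star (w i x))" by simp
        have "fits (msize H i) (msize H i) (fval g i (\<xi> i x))" using homog_carrierD(2)[OF H g i(1) \<xi>_in[OF i(1)]] that i by simp
        then show ?thesis by (rule fits_times[OF fits_times[OF f'] f])
      qed
      obtain G where "continuous_map (spc T l) euclidean G" "\<forall>x. fits (msize T l) (msize T l) (G x)"
        "\<forall>x\<in>Y l. G x = star (w i x) * fval g i (\<xi> i x) * w i x"
        using fmat_Tietze[OF \<open>normal_space (spc T l)\<close> Y[OF l] cG fG] by blast
      then show ?thesis using uniq by (intro exI[of _ G]) auto
    qed
  qed
  from bchoice[OF this] obtain G where G': "\<forall>l\<in>{..<summands T}. continuous_map (spc T l) euclidean (G l) \<and>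
     (\<forall>x. fits (msize T l) (msize T l) (G l x)) \<and>
     (\<forall>i<summands H. \<kappa> i = l \<longrightarrow> (\<forall>x\<in>Y l. G l x = star (w i x) * fval g i (\<xi> i x) * w i x))" ..
  have G: "continuous_map (spc T l) euclidean (G l) \<and> (\<forall>x. fits (msize T l) (msize T l) (G l x)) \<and>
     (\<forall>i<summands H. \<kappa> i = l \<longrightarrow> (\<forall>x\<in>Y l. G l x = star (w i x) * fval g i (\<xi> i x) * w i x))" if "l < summands T" for l
    by (rule bspec[OF G']) (use that in simp)
  define f where "f = homog_mk T (\<lambda>l x. fval (prj T) l x * G l x * fval (prj T) l x)"
  note p = homogeneousD[OF T]
  have f: "f \<in> carrier (homog_algebra T)" and hf: "\<And>l x. l < summands T \<Longrightarrow> x \<in> topspace (spc T l) \<Longrightarrow>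
     fval f l x = fval (prj T) l x * G l x * fval (prj T) l x"
  proof -
    have 1: "continuous_map (spc T l) euclidean (\<lambda>x. fval (prj T) l x * G l x * fval (prj T) l x)" if "l < summands T" for l
      by (intro continuous_map_fmat(3) p(5)[OF that]) (use G that in auto)
    have 2: "fits (msize T l) (msize T l) (fval (prj T) l x * G l x * fval (prj T) l x)" if "l < summands T" "x \<in> topspace (spc T l)" for l x
      using G[OF that(1)] p(7)[OF that] by (intro fits_times) auto
    have 3: "fval (prj T) l x * (fval (prj T) l x * G l x * fval (prj T) l x) * fval (prj T) l x = fval (prj T) l x * G l x * fval (prj T) l x"
      if "l < summands T" "x \<in> topspace (spc T l)" for l x
    proof -
      have "fval (prj T) l x * (fval (prj T) l x * G l x * fval (prj T) l x) * fval (prj T) l x =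
        (fval (prj T) l x * fval (prj T) l x) * G l x * (fval (prj T) l x * fval (prj T) l x)" by (simp add: mult.assoc)
      then show ?thesis unfolding p(8)[OF that] .
    qed
    show "f \<in> carrier (homog_algebra T)" unfolding f_def by (rule homog_mk(1)[OF T 1 2 3])
    show "\<And>l x. l < summands T \<Longrightarrow> x \<in> topspace (spc T l) \<Longrightarrow> fval f l x = fval (prj T) l x * G l x * fval (prj T) l x"
      unfolding f_def by (rule homog_mk(2)[OF T 1 2 3])
  qed
  have "pulls_back g f"
    unfolding pulls_back_def
  proof (intro allI impI ballI)
    fix i x assume i: "i < summands H" "x \<in> Y (\<kappa> i)"
    have "fval f (\<kappa> i) x = fval (prj T) (\<kappa> i) x * G (\<kappa> i) x * fval (prj T) (\<kappa> i) x"
      by (rule hf[OF \<kappa>_less(1)[OF i(1)] Y_sub[OF \<kappa>_less(1)[OF i(1)] i(2)]])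
    also have "G (\<kappa> i) x = star (w i x) * fval g i (\<xi> i x) * w i x" using G[OF \<kappa>_less(1)[OF i(1)]] i by blast
    also have "fval (prj T) (\<kappa> i) x * (star (w i x) * fval g i (\<xi> i x) * w i x) * fval (prj T) (\<kappa> i) x
      = (fval (prj T) (\<kappa> i) x * star (w i x)) * fval g i (\<xi> i x) * (w i x * fval (prj T) (\<kappa> i) x)" by (simp add: mult.assoc)
    finally show "fval f (\<kappa> i) x = star (w i x) * fval g i (\<xi> i x) * w i x" unfolding w_absorb[OF i] .
  qed
  with f show ?thesis by blast
qed

lemma image_algebraI:
  "f \<in> carrier (homog_algebra T) \<Longrightarrow> g \<in> carrier (homog_algebra H) \<Longrightarrow> pulls_back g f \<Longrightarrow> \<psi> f \<in> image_algebra"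
  unfolding image_algebra_def by blast

lemma image_algebraE:
  assumes "c \<in> image_algebra"
  obtains f g where "c = \<psi> f" "f \<in> carrier (homog_algebra T)" "g \<in> carrier (homog_algebra H)" "pulls_back g f"
  using assms unfolding image_algebra_def by blast

text \<open>Since \<open>\<psi> f\<close> and \<open>g\<close> have the same norm when \<open>g\<close> pulls back to \<open>f\<close>, a limit of elements \<open>\<psi> f\<close>
 comes from a uniform limit of the corresponding \<open>g\<close>.\<close>

lemma norm_closed_image: "norm_closed A image_algebra"
  unfolding norm_closed_def
proof (intro ballI impI)
  note cdist = unital_cstar_algebra.cdist_triangle[OF A] unital_cstar_algebra.cdist_commute[OF A]
    unital_cstar_algebra.cdist_nonneg[OF A]
  fix a assume a: "a \<in> carrier A" and ap: "\<forall>e>0. \<exists>y\<in>image_algebra. cdist A a y < e"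
  define r where "r n = 1 / (real n + 1)" for n
  have r0: "0 < r n" for n by (simp add: r_def)
  have rlim: "r \<longlonglongrightarrow> 0" unfolding r_def
    using LIMSEQ_inverse_real_of_nat by (simp add: inverse_eq_divide add.commute)
  have "\<exists>f g. cdist A a (\<psi> f) < r n \<and> f \<in> carrier (homog_algebra T) \<and> g \<in> carrier (homog_algebra H) \<and> pulls_back g f" for n
  proof -
    obtain y where y: "y \<in> image_algebra" "cdist A a y < r n" using ap r0[of n] by blast
    from y(1) obtain f g where "y = \<psi> f" "f \<in> carrier (homog_algebra T)" "g \<in> carrier (homog_algebra H)" "pulls_back g f"
      by (rule image_algebraE)
    then show ?thesis using y(2) by blast
  qed
  then obtain f g where fg: "\<And>n. cdist A a (\<psi> (f n)) < r n" "\<And>n. f n \<in> carrier (homog_algebra T)"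
    "\<And>n. g n \<in> carrier (homog_algebra H)" "\<And>n. pulls_back (g n) (f n)" by metis
  have \<psi>f: "\<psi> (f n) \<in> carrier A" for n using \<psi>_hom(1) fg(2) .
  have diff: "norm (fval (g n) i y - fval (g k) i y) \<le> r n + r k" if "i < summands H" "y \<in> topspace (spc H i)" for n k i y
  proof -
    have "cdist A (\<psi> (f n)) (\<psi> (f k)) \<le> cdist A a (\<psi> (f n)) + cdist A a (\<psi> (f k))"
      using cdist(1)[OF \<psi>f a \<psi>f, of n k] cdist(2)[OF a \<psi>f, of n] by simp
    also have "\<dots> \<le> r n + r k" using fg(1)[of n] fg(1)[of k] by simp
    finally show ?thesis using cdist_pulls_back[OF fg(4) fg(4) fg(3) fg(3) fg(2) fg(2), of "r n + r k"] r0[of n] r0[of k] that by simp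
  qed
  have "\<exists>l. fits (msize H i) (msize H i) l \<and> (\<lambda>n. fval (g n) i y) \<longlonglongrightarrow> l" if i: "i < summands H" "y \<in> topspace (spc H i)" for i y
  proof (rule fmat_Cauchy_convergent)
    show "fits (msize H i) (msize H i) (fval (g n) i y)" for n by (rule homog_carrierD(2)[OF H fg(3) i])
    show "Cauchy (\<lambda>n. fval (g n) i y)"
    proof (rule metric_CauchyI)
      fix e :: real assume "0 < e"
      then obtain N where N: "\<And>n. n \<ge> N \<Longrightarrow> r n < e / 2"
        using order_tendstoD(2)[OF rlim, of "e / 2"] by (auto simp: eventually_sequentially)
      show "\<exists>M. \<forall>m\<ge>M. \<forall>n\<ge>M. dist (fval (g m) i y) (fval (g n) i y) < e"
      proof (intro exI[of _ N] allI impI)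
        fix k n assume "N \<le> k" "N \<le> n"
        then show "dist (fval (g k) i y) (fval (g n) i y) < e" using diff[OF i, of k n] N[of k] N[of n] by (simp add: dist_norm)
      qed
    qed
  qed
  then obtain G where G: "\<And>i y. i < summands H \<Longrightarrow> y \<in> topspace (spc H i) \<Longrightarrow>
    fits (msize H i) (msize H i) (G i y) \<and> (\<lambda>n. fval (g n) i y) \<longlonglongrightarrow> G i y" by metis
  have bd: "norm (fval (g n) i y - G i y) \<le> r n" if i: "i < summands H" "y \<in> topspace (spc H i)" for n i y
  proof (rule LIMSEQ_le)
    show "(\<lambda>k. norm (fval (g n) i y - fval (g k) i y)) \<longlonglongrightarrow> norm (fval (g n) i y - G i y)"
      using G[OF i] by (intro tendsto_intros) auto
    show "(\<lambda>k. r n + r k) \<longlonglongrightarrow> r n" using tendsto_add[OF tendsto_const rlim, of "r n"] by simp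
    show "\<exists>N. \<forall>k\<ge>N. norm (fval (g n) i y - fval (g k) i y) \<le> r n + r k" using diff[OF i] by blast
  qed
  have Gc: "continuous_map (spc H i) euclidean (G i)" if i: "i < summands H" for i
    by (rule continuous_map_fmat_uniform_limit[OF homog_carrierD(1)[OF H fg(3) i] bd[OF i] rlim])
  have Gcorner: "fval (prj H) i y * G i y * fval (prj H) i y = G i y" if i: "i < summands H" "y \<in> topspace (spc H i)" for i y
  proof (rule LIMSEQ_unique)
    show "(\<lambda>n. fval (prj H) i y * fval (g n) i y * fval (prj H) i y) \<longlonglongrightarrow> fval (prj H) i y * G i y * fval (prj H) i y"
      using G[OF i] by (intro tendsto_intros) auto
    show "(\<lambda>n. fval (prj H) i y * fval (g n) i y * fval (prj H) i y) \<longlonglongrightarrow> G i y"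
      using G[OF i] homog_carrierD(3,4)[OF H fg(3) i] by simp
  qed
  define g' where "g' = homog_mk H G"
  have Gfit: "fits (msize H i) (msize H i) (G i y)" if "i < summands H" "y \<in> topspace (spc H i)" for i y using G[OF that] by blast
  have g': "g' \<in> carrier (homog_algebra H)" unfolding g'_def by (rule homog_mk(1)[OF H Gc Gfit Gcorner])
  have hg': "fval g' i y = G i y" if "i < summands H" "y \<in> topspace (spc H i)" for i y
    unfolding g'_def by (rule homog_mk(2)[OF H Gc Gfit Gcorner that])
  obtain f' where f': "f' \<in> carrier (homog_algebra T)" "pulls_back g' f'" using ex_pulls_back[OF g'] by blast
  have \<psi>f': "\<psi> f' \<in> carrier A" by (rule \<psi>_hom(1)[OF f'(1)])
  have "cdist A a (\<psi> f') \<le> r n + r n" for n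
  proof -
    have "cdist A (\<psi> (f n)) (\<psi> f') \<le> r n"
      using cdist_pulls_back[OF fg(4) f'(2) fg(3) g' fg(2) f'(1), of "r n" n] bd hg' r0[of n] by simp
    then show ?thesis using cdist(1)[OF a \<psi>f \<psi>f', of n] fg(1)[of n] by simp
  qed
  moreover have "(\<lambda>n. r n + r n) \<longlonglongrightarrow> 0" using tendsto_add[OF rlim rlim] by simp
  ultimately have "cdist A a (\<psi> f') \<le> 0" using LIMSEQ_le_const[of "\<lambda>n. r n + r n" 0 "cdist A a (\<psi> f')"] by blast
  then have "a = \<psi> f'" using cdist(3)[OF a \<psi>f'] unital_cstar_algebra.cdist_eq_0[OF A a \<psi>f'] by simp
  then show "a \<in> image_algebra" using image_algebraI[OF f'(1) g' f'(2)] by simp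
qed

lemma unital_sub_cstar_image: "unital_sub_cstar image_algebra A"
  unfolding unital_sub_cstar_def
proof (intro conjI norm_closed_image ballI allI)
  interpret R: ring A by (rule unital_cstar_algebra.ring[OF A])
  note cT = homog_closed[OF T] and cH = homog_closed[OF H]
  have sc: "c \<odot>\<^bsub>A\<^esub> a \<in> image_algebra" if "a \<in> image_algebra" for a c
  proof -
    obtain f g where fg: "a = \<psi> f" "f \<in> carrier (homog_algebra T)" "g \<in> carrier (homog_algebra H)" "pulls_back g f"
      using \<open>a \<in> image_algebra\<close> by (rule image_algebraE)
    show ?thesis unfolding fg(1) \<psi>_hom(5)[OF fg(2), symmetric]
      by (rule image_algebraI[OF cT(3)[OF fg(2)] cH(3)[OF fg(3)] pulls_back_ops(2)[OF fg(4,3,2)]])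
  qed
  have car: "image_algebra \<subseteq> carrier A" unfolding image_algebra_def using \<psi>_hom(1) by blast
  show "c \<odot>\<^bsub>A\<^esub> a \<in> image_algebra" if "a \<in> image_algebra" for a c using sc that .
  show "adj A a \<in> image_algebra" if "a \<in> image_algebra" for a
  proof -
    obtain f g where fg: "a = \<psi> f" "f \<in> carrier (homog_algebra T)" "g \<in> carrier (homog_algebra H)" "pulls_back g f"
      using \<open>a \<in> image_algebra\<close> by (rule image_algebraE)
    show ?thesis unfolding fg(1) \<psi>_hom(6)[OF fg(2), symmetric]
      by (rule image_algebraI[OF cT(4)[OF fg(2)] cH(4)[OF fg(3)] pulls_back_ops(3)[OF fg(4,3,2)]])
  qed
  show "subring image_algebra A"
  proof (rule R.subringI[OF car])
    show "\<one>\<^bsub>A\<^esub> \<in> image_algebra" unfolding \<psi>_hom(4)[symmetric]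
      by (rule image_algebraI[OF cT(1) cH(1) pulls_back_ops(1)])
    show "\<ominus>\<^bsub>A\<^esub> a \<in> image_algebra" if "a \<in> image_algebra" for a
      using unital_cstar_algebra.minus_eq_smult[OF A, of a] sc[OF that] car that by auto
    fix a b assume "a \<in> image_algebra" "b \<in> image_algebra"
    obtain f g where fg: "a = \<psi> f" "f \<in> carrier (homog_algebra T)" "g \<in> carrier (homog_algebra H)" "pulls_back g f"
      using \<open>a \<in> image_algebra\<close> by (rule image_algebraE)
    obtain f' g' where fg': "b = \<psi> f'" "f' \<in> carrier (homog_algebra T)" "g' \<in> carrier (homog_algebra H)" "pulls_back g' f'"
      using \<open>b \<in> image_algebra\<close> by (rule image_algebraE)
    show "a \<otimes>\<^bsub>A\<^esub> b \<in> image_algebra" unfolding fg(1) fg'(1) \<psi>_hom(2)[OF fg(2) fg'(2), symmetric]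
      by (rule image_algebraI[OF cT(5)[OF fg(2) fg'(2)] cH(5)[OF fg(3) fg'(3)] pulls_back_ops(4)[OF fg(4) fg'(4) fg(3,2) fg'(3,2)]])
    show "a \<oplus>\<^bsub>A\<^esub> b \<in> image_algebra" unfolding fg(1) fg'(1) \<psi>_hom(3)[OF fg(2) fg'(2), symmetric]
      by (rule image_algebraI[OF cT(6)[OF fg(2) fg'(2)] cH(6)[OF fg(3) fg'(3)] pulls_back_ops(5)[OF fg(4) fg'(4) fg(3,2) fg'(3,2)]])
  qed
qed

text \<open>The isomorphism sends \<open>\<psi> f\<close> to the unique \<open>g\<close> that pulls back to \<open>f\<close>; by \<open>\<psi>_eq_iff\<close>
 it depends on \<open>\<psi> f\<close> only.\<close>

lemma star_isomorphic_image: "star_isomorphic (A\<lparr>carrier := image_algebra\<rparr>) (homog_algebra H)"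
proof -
  note cT = homog_closed[OF T] and cH = homog_closed[OF H]
  define \<Phi> where "\<Phi> a = (THE g. g \<in> carrier (homog_algebra H) \<and> (\<exists>f\<in>carrier (homog_algebra T). pulls_back g f \<and> \<psi> f = a))" for a
  have \<Phi>: "\<Phi> (\<psi> f) = g" if "f \<in> carrier (homog_algebra T)" "g \<in> carrier (homog_algebra H)" "pulls_back g f" for f g
    unfolding \<Phi>_def
  proof (rule the_equality)
    show "g \<in> carrier (homog_algebra H) \<and> (\<exists>f'\<in>carrier (homog_algebra T). pulls_back g f' \<and> \<psi> f' = \<psi> f)" using that by blast
    fix g' assume "g' \<in> carrier (homog_algebra H) \<and> (\<exists>f'\<in>carrier (homog_algebra T). pulls_back g' f' \<and> \<psi> f' = \<psi> f)"
    then obtain f' where "g' \<in> carrier (homog_algebra H)" "f' \<in> carrier (homog_algebra T)" "pulls_back g' f'" "\<psi> f' = \<psi> f" by blast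
    then show "g' = g" using \<psi>_eq_iff[of g' f' g f] that by blast
  qed
  let ?C = "A\<lparr>carrier := image_algebra\<rparr>"
  have hom: "\<Phi> \<in> Ring.ring_hom ?C (homog_algebra H)"
  proof (rule ring_hom_memI)
    fix a assume "a \<in> carrier ?C"
    then have "a \<in> image_algebra" by simp
    then obtain f g where fg: "a = \<psi> f" "f \<in> carrier (homog_algebra T)" "g \<in> carrier (homog_algebra H)" "pulls_back g f"
      by (rule image_algebraE)
    show "\<Phi> a \<in> carrier (homog_algebra H)" using \<Phi>[OF fg(2-4)] fg by simp
    fix b assume "b \<in> carrier ?C"
    then have "b \<in> image_algebra" by simp
    then obtain f' g' where fg': "b = \<psi> f'" "f' \<in> carrier (homog_algebra T)" "g' \<in> carrier (homog_algebra H)" "pulls_back g' f'"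
      by (rule image_algebraE)
    note eqs = \<Phi>[OF fg(2-4)] \<Phi>[OF fg'(2-4)]
    show "\<Phi> (a \<otimes>\<^bsub>?C\<^esub> b) = \<Phi> a \<otimes>\<^bsub>homog_algebra H\<^esub> \<Phi> b"
      using \<Phi>[OF cT(5)[OF fg(2) fg'(2)] cH(5)[OF fg(3) fg'(3)] pulls_back_ops(4)[OF fg(4) fg'(4) fg(3,2) fg'(3,2)]]
        \<psi>_hom(2)[OF fg(2) fg'(2)] eqs fg(1) fg'(1) by simp
    show "\<Phi> (a \<oplus>\<^bsub>?C\<^esub> b) = \<Phi> a \<oplus>\<^bsub>homog_algebra H\<^esub> \<Phi> b"
      using \<Phi>[OF cT(6)[OF fg(2) fg'(2)] cH(6)[OF fg(3) fg'(3)] pulls_back_ops(5)[OF fg(4) fg'(4) fg(3,2) fg'(3,2)]]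
        \<psi>_hom(3)[OF fg(2) fg'(2)] eqs fg(1) fg'(1) by simp
  next
    show "\<Phi> \<one>\<^bsub>?C\<^esub> = \<one>\<^bsub>homog_algebra H\<^esub>"
      using \<Phi>[OF cT(1) cH(1) pulls_back_ops(1)] \<psi>_hom(4) by simp
  qed
  have "\<Phi> \<in> star_hom ?C (homog_algebra H)"
    unfolding star_hom_def
  proof (intro CollectI conjI hom ballI allI)
    fix a assume "a \<in> carrier ?C"
    then have "a \<in> image_algebra" by simp
    then obtain f g where fg: "a = \<psi> f" "f \<in> carrier (homog_algebra T)" "g \<in> carrier (homog_algebra H)" "pulls_back g f"
      by (rule image_algebraE)
    show "\<Phi> (c \<odot>\<^bsub>?C\<^esub> a) = c \<odot>\<^bsub>homog_algebra H\<^esub> \<Phi> a" for c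
      using \<Phi>[OF cT(3)[OF fg(2)] cH(3)[OF fg(3)] pulls_back_ops(2)[OF fg(4,3,2)]] \<psi>_hom(5)[OF fg(2)] \<Phi>[OF fg(2-4)] fg(1) by simp
    show "\<Phi> (adj ?C a) = adj (homog_algebra H) (\<Phi> a)"
      using \<Phi>[OF cT(4)[OF fg(2)] cH(4)[OF fg(3)] pulls_back_ops(3)[OF fg(4,3,2)]] \<psi>_hom(6)[OF fg(2)] \<Phi>[OF fg(2-4)] fg(1) by simp
  qed
  moreover have "bij_betw \<Phi> (carrier ?C) (carrier (homog_algebra H))"
    unfolding bij_betw_def
  proof
    show "inj_on \<Phi> (carrier ?C)"
    proof (rule inj_onI)
      fix a b assume "a \<in> carrier ?C" "b \<in> carrier ?C" and eq: "\<Phi> a = \<Phi> b"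
      then have "a \<in> image_algebra" "b \<in> image_algebra" by simp_all
      obtain f g where fg: "a = \<psi> f" "f \<in> carrier (homog_algebra T)" "g \<in> carrier (homog_algebra H)" "pulls_back g f"
        using \<open>a \<in> image_algebra\<close> by (rule image_algebraE)
      obtain f' g' where fg': "b = \<psi> f'" "f' \<in> carrier (homog_algebra T)" "g' \<in> carrier (homog_algebra H)" "pulls_back g' f'"
        using \<open>b \<in> image_algebra\<close> by (rule image_algebraE)
      have "g = g'" using eq \<Phi>[OF fg(2-4)] \<Phi>[OF fg'(2-4)] fg(1) fg'(1) by simp
      then show "a = b" using \<psi>_eq_iff[OF fg(4) fg'(4) fg(3) fg'(3) fg(2) fg'(2)] fg(1) fg'(1) by simp
    qed
    show "\<Phi> ` carrier ?C = carrier (homog_algebra H)"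
    proof
      show "\<Phi> ` carrier ?C \<subseteq> carrier (homog_algebra H)" using ring_hom_closed[OF hom] by blast
      show "carrier (homog_algebra H) \<subseteq> \<Phi> ` carrier ?C"
      proof
        fix g assume g: "g \<in> carrier (homog_algebra H)"
        then obtain f where f: "f \<in> carrier (homog_algebra T)" "pulls_back g f" using ex_pulls_back by blast
        then have "\<psi> f \<in> carrier ?C" using image_algebraI[OF f(1) g f(2)] by simp
        then show "g \<in> \<Phi> ` carrier ?C" using \<Phi>[OF f(1) g f(2)] by (metis image_eqI)
      qed
    qed
  qed
  ultimately show ?thesis unfolding star_isomorphic_def by blast
qed

lemma image_algebra_approximates:
  assumes f: "f \<in> carrier (homog_algebra T)" and g: "g \<in> carrier (homog_algebra H)" and c: "0 \<le> c"
    and le: "\<And>i x. i < summands H \<Longrightarrow> x \<in> Y (\<kappa> i) \<Longrightarrow> norm (fval f (\<kappa> i) x - star (w i x) * fval g i (\<xi> i x) * w i x) \<le> c"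
  shows "\<exists>a\<in>image_algebra. cdist A (\<psi> f) a \<le> c"
proof -
  obtain f' where f': "f' \<in> carrier (homog_algebra T)" "pulls_back g f'" using ex_pulls_back[OF g] by blast
  have "cdist A (\<psi> f) (\<psi> f') \<le> c"
    unfolding cdist_\<psi>_le_iff[OF f f'(1) c] using le f'(2) by (simp add: pulls_back_def)
  then show ?thesis using image_algebraI[OF f'(1) g f'(2)] by blast
qed

end

section \<open>Local approximation\<close>

lemma cover_pushed:
  assumes \<alpha>: "\<alpha> \<in> component_covers (S i)"
    and Lc: "\<And>l s. l < summands (S i) \<Longrightarrow> s < m i j l k \<Longrightarrow> continuous_map (spc (S j) k) (spc (S i) l) (L i j l k s)"
  shows "finite_open_cover (spc (S j) k) (pushed_cover S m L i j k \<alpha>)"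
    and "\<And>V x y l s. V \<in> pushed_cover S m L i j k \<alpha> \<Longrightarrow> x \<in> V \<Longrightarrow> y \<in> V \<Longrightarrow> l < summands (S i) \<Longrightarrow> s < m i j l k \<Longrightarrow>
      \<exists>U\<in>\<alpha> l. L i j l k s x \<in> U \<and> L i j l k s y \<in> U"
proof -
  let ?X = "spc (S j) k"
  define I where "I = (SIGMA l:{..<summands (S i)}. {..<m i j l k})"
  have L: "L i j l k s x \<in> topspace (spc (S i) l)"
    if "l < summands (S i)" "s < m i j l k" "x \<in> topspace (spc (S j) k)" for l s x
    using continuous_map_funspace[OF Lc[OF that(1,2)]] that(3) by auto
  define C where "C = (\<lambda>(l, s). cover_pullback ?X (L i j l k s) (\<alpha> l))"
  have eq: "pushed_cover S m L i j k \<alpha> = (\<lambda>V. topspace ?X \<inter> (\<Inter>t\<in>I. V t)) ` (\<Pi>\<^sub>E t\<in>I. C t)"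
    by (simp add: pushed_cover_def cover_join_def I_def C_def)
  have fI: "finite I" by (simp add: I_def)
  have \<alpha>l: "finite (\<alpha> l)" "\<And>U. U \<in> \<alpha> l \<Longrightarrow> openin (spc (S i) l) U" "\<Union>(\<alpha> l) = topspace (spc (S i) l)" if "l < summands (S i)" for l
    using \<alpha> that by (auto simp: component_covers_def finite_open_cover_def)
  have fC: "finite (C t)" if "t \<in> I" for t
    using that \<alpha>l(1) by (auto simp: C_def I_def cover_pullback_def)
  have oC: "openin ?X U" if "t \<in> I" "U \<in> C t" for t U
    using that \<alpha>l(2) openin_continuous_map_preimage[OF Lc] by (auto simp: C_def I_def cover_pullback_def)
  have cC: "\<exists>U\<in>C t. x \<in> U" if "t \<in> I" "x \<in> topspace ?X" for t x
  proof -
    obtain l s where t: "t = (l, s)" "l < summands (S i)" "s < m i j l k" using \<open>t \<in> I\<close> by (auto simp: I_def)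
    have "L i j l k s x \<in> topspace (spc (S i) l)" by (rule L[OF t(2,3) that(2)])
    then obtain U where "U \<in> \<alpha> l" "L i j l k s x \<in> U" using \<alpha>l(3)[OF t(2)] by blast
    then show ?thesis using that(2) by (auto simp: C_def cover_pullback_def t(1))
  qed
  show "finite_open_cover ?X (pushed_cover S m L i j k \<alpha>)"
    unfolding finite_open_cover_def
  proof (intro conjI ballI)
    show "finite (pushed_cover S m L i j k \<alpha>)" unfolding eq using fI fC by (intro finite_imageI finite_PiE) auto
    fix U assume "U \<in> pushed_cover S m L i j k \<alpha>"
    then obtain V where V: "V \<in> (\<Pi>\<^sub>E t\<in>I. C t)" "U = topspace ?X \<inter> (\<Inter>t\<in>I. V t)" unfolding eq by blast
    have Vo: "openin ?X (V t)" if "t \<in> I" for t using oC[OF that] V(1) that by (auto simp: PiE_iff)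
    have "{z \<in> topspace ?X. z \<in> V t} = V t" if "t \<in> I" for t using openin_subset[OF Vo[OF that]] by blast
    then have "openin ?X {z \<in> topspace ?X. \<forall>t\<in>I. z \<in> V t}" using Vo by (intro openin_finite_Ball[OF fI]) simp
    moreover have "U = {z \<in> topspace ?X. \<forall>t\<in>I. z \<in> V t}" using V(2) by auto
    ultimately show "openin ?X U" by simp
  next
    show "\<Union>(pushed_cover S m L i j k \<alpha>) = topspace ?X"
    proof
      show "topspace ?X \<subseteq> \<Union>(pushed_cover S m L i j k \<alpha>)"
      proof
        fix x assume x: "x \<in> topspace ?X"
        have "\<forall>t\<in>I. \<exists>U. U \<in> C t \<and> x \<in> U" using cC x by blast
        from bchoice[OF this] obtain V where V: "\<forall>t\<in>I. V t \<in> C t \<and> x \<in> V t" ..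
        then have "restrict V I \<in> (\<Pi>\<^sub>E t\<in>I. C t)" by auto
        moreover have "x \<in> topspace ?X \<inter> (\<Inter>t\<in>I. restrict V I t)" using V x by auto
        ultimately show "x \<in> \<Union>(pushed_cover S m L i j k \<alpha>)" unfolding eq by blast
      qed
    qed (auto simp: eq)
  qed
  fix V x y l s
  assume V: "V \<in> pushed_cover S m L i j k \<alpha>" "x \<in> V" "y \<in> V" and ls: "l < summands (S i)" "s < m i j l k"
  obtain Z where Z: "Z \<in> (\<Pi>\<^sub>E t\<in>I. C t)" "V = topspace ?X \<inter> (\<Inter>t\<in>I. Z t)" using V(1) unfolding eq by blast
  have t: "(l, s) \<in> I" using ls by (simp add: I_def)
  then have "Z (l, s) \<in> C (l, s)" "x \<in> Z (l, s)" "y \<in> Z (l, s)" using Z V by (auto simp: PiE_iff)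
  then show "\<exists>U\<in>\<alpha> l. L i j l k s x \<in> U \<and> L i j l k s y \<in> U" by (auto simp: C_def cover_pullback_def)
qed

lemma cover_ratio_nonneg: assumes "homogeneous (S j)" shows "0 \<le> cover_ratio S m L i \<alpha> j"
proof -
  have "0 < summands (S j)" using assms by (simp add: homogeneous_def)
  then have "real (cover_D (spc (S j) 0) (pushed_cover S m L i j 0 \<alpha>)) / real (prank (S j) 0) \<le> cover_ratio S m L i \<alpha> j"
    unfolding cover_ratio_def by (intro Max_ge) auto
  then show ?thesis by (meson divide_nonneg_nonneg of_nat_0_le_iff order_trans)
qed

lemma mean_dimension_nonneg:
  assumes "\<And>i. homogeneous (S i)" shows "0 \<le> mean_dimension S m L"
  unfolding mean_dimension_def
proof (rule Liminf_bounded, rule always_eventually, rule allI)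
  fix i
  have "(\<lambda>l. {topspace (spc (S i) l)}) \<in> component_covers (S i)" by (simp add: component_covers_def finite_open_cover_def)
  moreover have "0 \<le> liminf (\<lambda>j. ereal (cover_ratio S m L i \<alpha> j))" for \<alpha>
    by (rule Liminf_bounded) (simp add: cover_ratio_nonneg assms)
  ultimately show "0 \<le> mean_dim_at S m L i" unfolding mean_dim_at_def by (meson SUP_upper2)
qed

text \<open>If the mean dimension is infinite, the strict inequality holds for every stage, as the ratios are real. Otherwise a lower limit
 below a bound means that the bound is undercut infinitely often.\<close>

lemma mean_dimension_witness:
  assumes S: "\<And>i. homogeneous (S i)" and \<epsilon>: "0 < \<epsilon>"
  shows "\<exists>i\<ge>N. \<forall>\<alpha>\<in>component_covers (S i). \<forall>M. \<exists>j\<ge>M. ereal (cover_ratio S m L i \<alpha> j) < mean_dimension S m L + ereal \<epsilon>"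
proof -
  define g where "g = mean_dimension S m L + ereal \<epsilon>"
  have freq: "\<exists>n\<ge>M. X n < c" if "liminf X < c" for X and c :: ereal and M
  proof (rule ccontr)
    assume "\<not> ?thesis"
    then have "eventually (\<lambda>n. c \<le> X n) sequentially" unfolding eventually_sequentially by (meson not_less)
    then have "c \<le> liminf X" by (rule Liminf_bounded)
    then show False using that by simp
  qed
  show ?thesis
  proof (cases "mean_dimension S m L = \<infinity>")
    case True
    then show ?thesis by auto
  next
    case False
    moreover have "mean_dimension S m L \<noteq> -\<infinity>" using mean_dimension_nonneg[OF S, where m = m and L = L] by auto
    ultimately have "mean_dimension S m L < g" using \<epsilon> unfolding g_def by (cases "mean_dimension S m L") auto
    then obtain i where i: "i \<ge> N" "mean_dim_at S m L i < g" using freq unfolding mean_dimension_def by blast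
    have "liminf (\<lambda>j. ereal (cover_ratio S m L i \<alpha> j)) < g" if "\<alpha> \<in> component_covers (S i)" for \<alpha>
    proof -
      have "liminf (\<lambda>j. ereal (cover_ratio S m L i \<alpha> j)) \<le> mean_dim_at S m L i"
        unfolding mean_dim_at_def using that by (rule SUP_upper)
      then show ?thesis using i by simp
    qed
    then show ?thesis using freq i(1) unfolding g_def by blast
  qed
qed

lemma AH_algebraD:
  assumes AH: "AH_algebra A S \<phi> \<psi>"
  shows "homogeneous (S i)" and "unital_cstar_algebra A"
    and "i \<le> j \<Longrightarrow> \<phi> i j \<in> star_hom (homog_algebra (S i)) (homog_algebra (S j))"
    and "\<psi> i \<in> star_hom (homog_algebra (S i)) A"
    and "i \<le> j \<Longrightarrow> f \<in> carrier (homog_algebra (S i)) \<Longrightarrow> \<psi> j (\<phi> i j f) = \<psi> i f"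
    and "a \<in> carrier A \<Longrightarrow> 0 < \<epsilon> \<Longrightarrow> \<exists>i. \<exists>x\<in>carrier (homog_algebra (S i)). cdist A a (\<psi> i x) < \<epsilon>"
proof -
  have lim: "inductive_limit A (\<lambda>i. homog_algebra (S i)) \<phi> \<psi>" and "\<forall>i. homogeneous (S i)" using AH by (simp_all add: AH_algebra_def)
  then show "homogeneous (S i)" by simp
  note c = lim[unfolded inductive_limit_def]
  note c5 = c[THEN conjunct2, THEN conjunct2, THEN conjunct2, THEN conjunct2]
  note 1 = c[THEN conjunct1] c[THEN conjunct2, THEN conjunct1] c5[THEN conjunct1] c5[THEN conjunct2, THEN conjunct1]
    c5[THEN conjunct2, THEN conjunct2, THEN conjunct2]
  show "unital_cstar_algebra A" by (rule 1(1))
  show "i \<le> j \<Longrightarrow> \<phi> i j \<in> star_hom (homog_algebra (S i)) (homog_algebra (S j))" using 1(2) by simp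
  show "\<psi> i \<in> star_hom (homog_algebra (S i)) A" using 1(3) by simp
  show "i \<le> j \<Longrightarrow> f \<in> carrier (homog_algebra (S i)) \<Longrightarrow> \<psi> j (\<phi> i j f) = \<psi> i f" using 1(4) by simp
  show "a \<in> carrier A \<Longrightarrow> 0 < \<epsilon> \<Longrightarrow> \<exists>i. \<exists>x\<in>carrier (homog_algebra (S i)). cdist A a (\<psi> i x) < \<epsilon>" using 1(5) by simp
qed

text \<open>An approximation found at some stage can be pushed forward to all later ones.\<close>

lemma approximate_at_stage:
  assumes AH: "AH_algebra A S \<phi> \<psi>" and F: "finite F" "F \<subseteq> carrier A" and \<epsilon>: "0 < \<epsilon>"
  shows "\<exists>N. \<forall>i\<ge>N. \<forall>a\<in>F. \<exists>x\<in>carrier (homog_algebra (S i)). cdist A a (\<psi> i x) < \<epsilon>"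
proof -
  have "\<forall>a\<in>F. \<exists>i. \<exists>x\<in>carrier (homog_algebra (S i)). cdist A a (\<psi> i x) < \<epsilon>"
    using AH_algebraD(6)[OF AH _ \<epsilon>] F by blast
  from bchoice[OF this] obtain n where n: "\<forall>a\<in>F. \<exists>x\<in>carrier (homog_algebra (S (n a))). cdist A a (\<psi> (n a) x) < \<epsilon>" ..
  show ?thesis
  proof (intro exI[of _ "sum n F"] allI impI ballI)
    fix i a assume i: "sum n F \<le> i" and a: "a \<in> F"
    have ni: "n a \<le> i" using member_le_sum[of a F n] F a i by simp
    obtain x where x: "x \<in> carrier (homog_algebra (S (n a)))" "cdist A a (\<psi> (n a) x) < \<epsilon>" using n a by blast
    have "\<phi> (n a) i \<in> star_hom (homog_algebra (S (n a))) (homog_algebra (S i))"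
      by (rule AH_algebraD(3)[OF AH ni])
    then have "\<phi> (n a) i x \<in> carrier (homog_algebra (S i))" using x(1) by (auto simp: star_hom_def Ring.ring_hom_def)
    moreover have "\<psi> i (\<phi> (n a) i x) = \<psi> (n a) x" by (rule AH_algebraD(5)[OF AH ni x(1)])
    ultimately show "\<exists>x\<in>carrier (homog_algebra (S i)). cdist A a (\<psi> i x) < \<epsilon>" using x(2) by metis
  qed
qed

lemma restrict_cover:
  assumes \<beta>: "finite_open_cover X \<beta>" and Y: "Y \<subseteq> topspace X"
  defines "\<beta>' \<equiv> (\<lambda>V. V \<inter> Y) ` \<beta>"
  shows "finite_open_cover (subtopology X Y) \<beta>'"
    and "\<And>x. x \<in> Y \<Longrightarrow> card {V \<in> \<beta>'. x \<in> V} \<le> card {V \<in> \<beta>. x \<in> V}"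
proof -
  show "finite_open_cover (subtopology X Y) \<beta>'"
    using \<beta> Y unfolding finite_open_cover_def \<beta>'_def by (auto simp: openin_subtopology)
  fix x assume x: "x \<in> Y"
  have "{V \<in> \<beta>'. x \<in> V} \<subseteq> (\<lambda>V. V \<inter> Y) ` {V \<in> \<beta>. x \<in> V}" unfolding \<beta>'_def by auto
  moreover have "finite {V \<in> \<beta>. x \<in> V}" using \<beta> by (simp add: finite_open_cover_def)
  ultimately show "card {V \<in> \<beta>'. x \<in> V} \<le> card {V \<in> \<beta>. x \<in> V}" by (rule surj_card_le[rotated])
qed

text \<open>A refinement of the pushed cover that realises its \<open>cover_D\<close>, restricted to the closed set \<open>Y\<close>, is the cover
 whose nerve is used. On its members the block diagonal matrices vary little, because the eigenvalue maps send each of them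
 into members of \<open>\<alpha>\<close>.\<close>

lemma summand_model:
  fixes S :: "nat \<Rightarrow> 'x homog_data"
  assumes inf: "infinite (UNIV :: 'a set)"
    and AH: "AH_algebra A S \<phi> \<psi>" and diag: "diagonal_maps S \<phi> m L" and ij: "i < j" and k: "k < summands (S j)"
    and Y: "closedin (spc (S j) k) Y" "Y \<noteq> {}" and \<alpha>: "\<alpha> \<in> component_covers (S i)"
    and F: "F \<subseteq> carrier (homog_algebra (S i))" "\<one>\<^bsub>homog_algebra (S i)\<^esub> \<in> F"
    and osc: "\<And>f l U x y. f \<in> F \<Longrightarrow> l < summands (S i) \<Longrightarrow> U \<in> \<alpha> l \<Longrightarrow> x \<in> U \<Longrightarrow> y \<in> U \<Longrightarrow> norm (fval f l x - fval f l y) \<le> \<delta>"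
    and bound: "\<And>f l x. f \<in> F \<Longrightarrow> l < summands (S i) \<Longrightarrow> x \<in> topspace (spc (S i) l) \<Longrightarrow> norm (fval f l x) \<le> K"
    and \<delta>: "0 \<le> \<delta>" "\<delta> \<le> 1/100" and K: "1 \<le> K"
  shows "\<exists>R (\<Omega> :: ('a \<Rightarrow> complex) topology) \<xi> q w G. nerve_approximation (subtopology (spc (S j) k) Y) (msize (S j) k) (fval (prj (S j)) k) F
     (\<lambda>f. fval (\<phi> i j f) k) (cover_D (spc (S j) k) (pushed_cover S m L i j k \<alpha>)) (43 * K * \<delta>) R \<Omega> \<xi> q w G"
proof -
  have Si: "homogeneous (S i)" and Sj: "homogeneous (S j)" using AH unfolding AH_algebra_def by auto
  define B where "B = (SIGMA l:{..<summands (S i)}. {..<m i j l k})"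
  define D where "D J f x = block_diag B J (\<lambda>b. fval f (fst b) (L i j (fst b) k (snd b) x))" for J f x
  note rep = AH_diagonal_representation[OF AH diag ij k]
  have Lin: "L i j l k s x \<in> topspace (spc (S i) l)" if "l < summands (S i)" "s < m i j l k" "x \<in> topspace (spc (S j) k)" for l s x
    using continuous_map_funspace[OF rep(2)[OF that(1,2)]] that(3) by auto
  obtain R J W where J: "block_system B (\<lambda>b. msize (S i) (fst b)) J" "\<forall>b\<in>B. fits R (msize (S i) (fst b)) (J b)"
    and Wc: "continuous_map (spc (S j) k) euclidean W"
    and W: "\<forall>x\<in>topspace (spc (S j) k). fits R (msize (S j) k) (W x) \<and>
       star (W x) * W x = fval (prj (S j)) k x \<and> W x * star (W x) = D J (prj (S i)) x \<and>
       (\<forall>f\<in>carrier (homog_algebra (S i)). fval (\<phi> i j f) k x = star (W x) * D J f x * W x)"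
    using rep(1) unfolding B_def D_def by blast
  have Ysub: "Y \<subseteq> topspace (spc (S j) k)" by (rule closedin_subset[OF Y(1)])
  let ?X = "subtopology (spc (S j) k) Y"
  let ?p = "pushed_cover S m L i j k \<alpha>"
  have topX: "topspace ?X = Y" using Ysub by auto
  have push1: "finite_open_cover (spc (S j) k) ?p"
    using cover_pushed(1)[of \<alpha> S i m j k L] \<alpha> rep(2) by simp
  have push2: "\<exists>U\<in>\<alpha> l. L i j l k s x \<in> U \<and> L i j l k s y \<in> U"
    if "V \<in> ?p" "x \<in> V" "y \<in> V" "l < summands (S i)" "s < m i j l k" for V x y l s
    using cover_pushed(2)[of \<alpha> S i m j k L V x y l s] \<alpha> rep(2) that by simp
  obtain \<beta> where \<beta>: "finite_open_cover (spc (S j) k) \<beta>" "refines \<beta> ?p" "cover_D (spc (S j) k) ?p = cover_ord (spc (S j) k) \<beta>"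
    using cover_D_attained[OF push1] by blast
  \<comment> \<open>Restriction to \<open>Y\<close> may identify members of \<open>\<beta>\<close>, which can only lower the order.\<close>
  define \<beta>' where "\<beta>' = (\<lambda>V. V \<inter> Y) ` \<beta>"
  have f\<beta>: "finite \<beta>" using \<beta>(1) by (simp add: finite_open_cover_def)
  have bB: "fst b < summands (S i)" "snd b < m i j (fst b) k" if "b \<in> B" for b using that by (auto simp: B_def)
  have fitD: "fits (msize (S i) (fst b)) (msize (S i) (fst b)) (fval f (fst b) (L i j (fst b) k (snd b) x))"
    if "f \<in> F" "b \<in> B" "x \<in> topspace (spc (S j) k)" for f b x
    using homog_carrierD(2)[OF Si _ bB(1)[OF that(2)] Lin[OF bB[OF that(2)] that(3)]] F(1) that(1) by blast
  have "\<exists>(\<Omega> :: ('a \<Rightarrow> complex) topology) \<xi> q w G. nerve_approximation ?X (msize (S j) k) (\<lambda>x. star (W x) * W x) F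
     (\<lambda>f x. star (W x) * D J f x * W x) (cover_ord (spc (S j) k) \<beta>) (43 * K * \<delta>) R \<Omega> \<xi> q w G"
  proof (rule nerve_model[OF inf, where \<beta> = \<beta>' and ?f0.0 = "\<one>\<^bsub>homog_algebra (S i)\<^esub>"])
    show "compact_space ?X" using closedin_compact_space[OF homogeneousD(2)[OF Sj k] Y(1)] by (rule compact_space_subtopology)
    show "Hausdorff_space ?X" by (rule Hausdorff_space_subtopology[OF homogeneousD(3)[OF Sj k]])
    show "topspace ?X \<noteq> {}" unfolding topX by (rule Y(2))
    show "finite_open_cover ?X \<beta>'" unfolding \<beta>'_def by (rule restrict_cover(1)[OF \<beta>(1) Ysub])
    show "card {V \<in> \<beta>'. x \<in> V} \<le> cover_ord (spc (S j) k) \<beta> + 1" if "x \<in> topspace ?X" for x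
    proof -
      have x: "x \<in> Y" using that topX by simp
      have "card {V \<in> \<beta>'. x \<in> V} \<le> card {V \<in> \<beta>. x \<in> V}" unfolding \<beta>'_def by (rule restrict_cover(2)[OF \<beta>(1) Ysub x])
      also have "\<dots> \<le> cover_ord (spc (S j) k) \<beta> + 1" using card_le_cover_ord[OF f\<beta>] x Ysub by blast
      finally show ?thesis .
    qed
    show "continuous_map ?X euclidean W" by (rule continuous_map_from_subtopology[OF Wc])
    fix x assume "x \<in> topspace ?X"
    then have x: "x \<in> topspace (spc (S j) k)" using topX Ysub by auto
    show "fits R (msize (S j) k) (W x) \<and> star (W x) * W x * (star (W x) * W x) = star (W x) * W x"
      using W x homogeneousD(8)[OF Sj k x] by simp
    have "D J (prj (S i)) x = D J \<one>\<^bsub>homog_algebra (S i)\<^esub> x"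
      unfolding D_def block_diag_def
      by (intro sum.cong refl) (simp add: homog_fval_ops(1)[OF Si bB(1) Lin[OF bB x]])
    then show "W x * star (W x) = D J \<one>\<^bsub>homog_algebra (S i)\<^esub> x" using W x by simp
  next
    fix f x assume f: "f \<in> F" and "x \<in> topspace ?X"
    then have x: "x \<in> topspace (spc (S j) k)" using topX Ysub by auto
    have "fits R R (D J f x)" unfolding D_def
      by (rule fits_block_diag[where r = "\<lambda>b. msize (S i) (fst b)"]) (use J(2) fitD[OF f _ x] in auto)
    moreover have "norm (D J f x) \<le> K" unfolding D_def
      by (rule norm_block_diag_le[OF J(1) fitD[OF f _ x]]) (use bound[OF f bB(1) Lin[OF bB x]] K in auto)
    ultimately show "fits R R (D J f x) \<and> norm (D J f x) \<le> K" ..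
  next
    fix f V x y assume f: "f \<in> F" and V: "V \<in> \<beta>'" "x \<in> V" "y \<in> V"
    obtain V' where V': "V' \<in> \<beta>" "V = V' \<inter> Y" using V(1) by (auto simp: \<beta>'_def)
    obtain U where U: "U \<in> ?p" "V' \<subseteq> U" using \<beta>(2) V'(1) unfolding refines_def by blast
    have xy: "x \<in> U" "y \<in> U" "x \<in> topspace (spc (S j) k)" "y \<in> topspace (spc (S j) k)" using V V' U Ysub by auto
    have "norm (fval f (fst b) (L i j (fst b) k (snd b) x) - fval f (fst b) (L i j (fst b) k (snd b) y)) \<le> \<delta>" if b: "b \<in> B" for b
      using push2[OF U(1) xy(1,2) bB[OF b]] osc[OF f bB(1)[OF b]] by blast
    then show "norm (D J f x - D J f y) \<le> \<delta>"
      unfolding D_def block_diag_diff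
      by (intro norm_block_diag_le[OF J(1)] fits_simps(3) fitD[OF f] xy \<delta>)
  qed (use F(2) \<delta> K in auto)
  then obtain \<Omega> :: "('a \<Rightarrow> complex) topology" and \<xi> q w G where *: "nerve_approximation ?X (msize (S j) k)
     (\<lambda>x. star (W x) * W x) F (\<lambda>f x. star (W x) * D J f x * W x) (cover_ord (spc (S j) k) \<beta>) (43 * K * \<delta>) R \<Omega> \<xi> q w G"
    by blast
  have Wx: "star (W x) * W x = fval (prj (S j)) k x" "f \<in> F \<Longrightarrow> star (W x) * D J f x * W x = fval (\<phi> i j f) k x" if "x \<in> Y" for x f
    using W Ysub that F(1) by (blast, metis subsetD)
  show ?thesis
    unfolding \<beta>(3) nerve_approximation_def topX using *[unfolded nerve_approximation_def topX] Wx
    by (intro exI[of _ R] exI[of _ \<Omega>] exI[of _ \<xi>] exI[of _ q] exI[of _ w] exI[of _ G]) simp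
qed

text \<open>The rank of \<open>q\<close> agrees with that of the unit of \<open>T\<close>, because \<open>w\<close> is an equivalence between them.\<close>

lemma homogeneous_model:
  assumes T: "homogeneous T" and n: "0 < n" and \<kappa>: "\<And>i. i < n \<Longrightarrow> \<kappa> i < summands T"
    and Y: "\<And>i. i < n \<Longrightarrow> Y i \<subseteq> topspace (spc T (\<kappa> i))" "\<And>i. i < n \<Longrightarrow> Y i \<noteq> {}"
    and \<Omega>: "\<And>i. i < n \<Longrightarrow> compact_space (\<Omega> i) \<and> Hausdorff_space (\<Omega> i) \<and> \<xi> i ` Y i = topspace (\<Omega> i)"
    and q: "\<And>i. i < n \<Longrightarrow> continuous_map (\<Omega> i) euclidean (q i)"
      "\<And>i y. i < n \<Longrightarrow> y \<in> topspace (\<Omega> i) \<Longrightarrow> fits (R i) (R i) (q i y) \<and> q i y * q i y = q i y \<and> star (q i y) = q i y"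
    and w: "\<And>i x. i < n \<Longrightarrow> x \<in> Y i \<Longrightarrow> fits (R i) (msize T (\<kappa> i)) (w i x) \<and>
       star (w i x) * w i x = fval (prj T) (\<kappa> i) x \<and> w i x * star (w i x) = q i (\<xi> i x)"
  shows "homogeneous \<lparr>summands = n, spc = \<Omega>, msize = R, prj = (\<lambda>i y. of_fm (R i) (R i) (q i y)), prank = (\<lambda>i. prank T (\<kappa> i))\<rparr>"
proof -
  have "topspace (\<Omega> i) \<noteq> {}" "mat_projection (\<Omega> i) (R i) (\<lambda>y. of_fm (R i) (R i) (q i y))"
    "\<And>y. y \<in> topspace (\<Omega> i) \<Longrightarrow> vec_space.rank (R i) (of_fm (R i) (R i) (q i y)) = prank T (\<kappa> i)" if i: "i < n" for i
  proof -
    show "topspace (\<Omega> i) \<noteq> {}" using \<Omega>[OF i] Y(2)[OF i] by blast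
    have "continuous_map (\<Omega> i) euclidean (\<lambda>y. to_fm (of_fm (R i) (R i) (q i y)))"
      by (rule continuous_map_eq[OF q(1)[OF i]]) (use q(2)[OF i] in simp)
    then have "cont_mat (\<Omega> i) (R i) (R i) (\<lambda>y. of_fm (R i) (R i) (q i y))" unfolding cont_mat_iff by simp
    moreover have "of_fm (R i) (R i) (q i y) * of_fm (R i) (R i) (q i y) = of_fm (R i) (R i) (q i y) \<and>
        mat_adjoint (of_fm (R i) (R i) (q i y)) = of_fm (R i) (R i) (q i y)" if y: "y \<in> topspace (\<Omega> i)" for y
    proof -
      let ?Q = "of_fm (R i) (R i) (q i y)"
      have "to_fm (?Q * ?Q) = to_fm ?Q" using q(2)[OF i y] by (simp add: to_fm_mult[of _ "R i" "R i" _ "R i"])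
      moreover have "to_fm (mat_adjoint ?Q) = to_fm ?Q" using q(2)[OF i y] by (simp add: to_fm_adjoint[of _ "R i" "R i"])
      ultimately show ?thesis
        using to_fm_inject[OF mult_carrier_mat[OF of_fm_carrier of_fm_carrier] of_fm_carrier]
          to_fm_inject[OF mat_adjoint_carrier[OF of_fm_carrier] of_fm_carrier] by blast
    qed
    ultimately show "mat_projection (\<Omega> i) (R i) (\<lambda>y. of_fm (R i) (R i) (q i y))" unfolding mat_projection_def by blast
    fix y assume y: "y \<in> topspace (\<Omega> i)"
    then obtain x where x: "x \<in> Y i" "y = \<xi> i x" using \<Omega>[OF i] by blast
    have xt: "x \<in> topspace (spc T (\<kappa> i))" using Y(1)[OF i] x by blast
    note p = homogeneousD[OF T \<kappa>[OF i]]
    have "vec_space.rank (R i) (of_fm (R i) (R i) (q i y)) = vec_space.rank (msize T (\<kappa> i)) (of_fm (msize T (\<kappa> i)) (msize T (\<kappa> i)) (fval (prj T) (\<kappa> i) x))"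
      using w[OF i x(1)] q(2)[OF i y] x(2) p(7,8)[OF xt] by (intro rank_of_fm_equivalent[of _ _ "w i x"]) auto
    also have "of_fm (msize T (\<kappa> i)) (msize T (\<kappa> i)) (fval (prj T) (\<kappa> i) x) = prj T (\<kappa> i) x"
      unfolding fval_def by (rule of_fm_to_fm[OF p(6)[OF xt]])
    finally show "vec_space.rank (R i) (of_fm (R i) (R i) (q i y)) = prank T (\<kappa> i)" using p(10)[OF xt] by simp
  qed
  then show ?thesis using n \<Omega> homogeneousD(4)[OF T \<kappa>] unfolding homogeneous_def by simp
qed

text \<open>The choices are made in this order: the stage \<open>i\<close> such that the given elements come from it up to \<open>\<epsilon>1 / 2\<close> and its
 share of the mean dimension is small enough; the tolerance \<open>\<delta>\<close>, depending on the norms of these elements; the cover \<open>\<alpha>\<close> for \<open>\<delta>\<close>;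
 and then the stage \<open>j\<close>, for which the orders of refinements of the pushed cover are small compared to the ranks.\<close>

theorem locally_approximable_mean_dimension:
  fixes A :: "'a cstar_algebra" and S :: "nat \<Rightarrow> 'x homog_data"
  assumes AH: "AH_algebra A S \<phi> \<psi>" and diag: "diagonal_maps S \<phi> m L" and nonzero: "carrier A \<noteq> {\<zero>\<^bsub>A\<^esub>}"
  shows "locally_approximable A (mean_dimension S m L)"
  unfolding locally_approximable_def
proof (intro allI impI)
  fix F and \<epsilon>1 \<epsilon>2 :: real
  assume "finite F \<and> F \<subseteq> carrier A \<and> 0 < \<epsilon>1 \<and> 0 < \<epsilon>2"
  then have F: "finite F" "F \<subseteq> carrier A" and \<epsilon>: "0 < \<epsilon>1" "0 < \<epsilon>2" by auto
  define \<gamma> where "\<gamma> = mean_dimension S m L"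
  have S: "homogeneous (S i)" and A: "unital_cstar_algebra A" and \<psi>: "\<psi> i \<in> star_hom (homog_algebra (S i)) A" for i
    by (rule AH_algebraD[OF AH])+
  interpret A: unital_cstar_algebra A by (rule A)
  have inf: "infinite (UNIV :: 'a set)" by (rule infinite_super[OF subset_UNIV A.infinite_carrier(1)[OF nonzero]])
  obtain N where N: "\<forall>i\<ge>N. \<forall>a\<in>F. \<exists>x\<in>carrier (homog_algebra (S i)). cdist A a (\<psi> i x) < \<epsilon>1 / 2"
    using approximate_at_stage[OF AH F, of "\<epsilon>1 / 2"] \<epsilon> by auto
  obtain i where i: "i \<ge> N" and wit: "\<And>\<alpha> M. \<alpha> \<in> component_covers (S i) \<Longrightarrow> \<exists>j\<ge>M. ereal (cover_ratio S m L i \<alpha> j) < \<gamma> + ereal \<epsilon>2"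
    using mean_dimension_witness[of S \<epsilon>2 N m L] S \<epsilon>(2) unfolding \<gamma>_def by blast
  let ?Ai = "homog_algebra (S i)"
  have "\<forall>a\<in>F. \<exists>x. x \<in> carrier ?Ai \<and> cdist A a (\<psi> i x) < \<epsilon>1 / 2" using N i by blast
  from bchoice[OF this] obtain e where e: "\<forall>a\<in>F. e a \<in> carrier ?Ai \<and> cdist A a (\<psi> i (e a)) < \<epsilon>1 / 2" ..
  define F' where "F' = insert \<one>\<^bsub>?Ai\<^esub> (e ` F)"
  have F': "finite F'" "F' \<subseteq> carrier ?Ai" "\<one>\<^bsub>?Ai\<^esub> \<in> F'"
    using F(1) e homog_closed(1)[OF S] by (auto simp: F'_def)
  define K where "K = 1 + (\<Sum>f\<in>F'. \<bar>cnorm ?Ai f\<bar>)"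
  have K1: "1 \<le> K" unfolding K_def by (simp add: sum_nonneg)
  have bound: "norm (fval f l x) \<le> K" if "f \<in> F'" "l < summands (S i)" "x \<in> topspace (spc (S i) l)" for f l x
  proof -
    have "norm (fval f l x) \<le> cnorm ?Ai f" using homog_cnorm_le_iff[OF S, of f i "cnorm ?Ai f"] F'(2) that by auto
    also have "\<dots> \<le> \<bar>cnorm ?Ai f\<bar>" by simp
    also have "\<dots> \<le> K" unfolding K_def using member_le_sum[of f F' "\<lambda>f. \<bar>cnorm ?Ai f\<bar>"] F'(1) that(1) by simp
    finally show ?thesis .
  qed
  \<comment> \<open>The total error of the model is \<open>43 K \<delta>\<close>, which has to be below \<open>\<epsilon>1 / 2\<close>.\<close>
  define \<delta> where "\<delta> = min (1/100) (\<epsilon>1 / (100 * K))"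
  have \<delta>: "0 < \<delta>" "\<delta> \<le> 1/100" using \<epsilon> K1 by (auto simp: \<delta>_def)
  have "43 * K * \<delta> \<le> 43 * K * (\<epsilon>1 / (100 * K))" using K1 by (intro mult_left_mono) (auto simp: \<delta>_def)
  also have "\<dots> < \<epsilon>1 / 2" using K1 \<epsilon> by simp
  finally have K\<delta>: "43 * K * \<delta> < \<epsilon>1 / 2" .
  have K\<delta>0: "0 \<le> 43 * K * \<delta>" using K1 \<delta> by simp
  obtain \<alpha> where \<alpha>: "\<alpha> \<in> component_covers (S i)" and osc: "\<forall>l<summands (S i). \<forall>U\<in>\<alpha> l. \<forall>x\<in>U. \<forall>y\<in>U. \<forall>f\<in>F'. norm (fval f l x - fval f l y) \<le> \<delta>"
    using small_oscillation_cover[OF S F'(1,2) \<delta>(1)] by blast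
  obtain j where j: "Suc i \<le> j" and ratio: "ereal (cover_ratio S m L i \<alpha> j) < \<gamma> + ereal \<epsilon>2" using wit[OF \<alpha>] by blast
  have ij: "i < j" using j by simp
  define Y where "Y = limit_set S m L j"
  have Yc: "closedin (spc (S j) k) (Y k)" for k unfolding Y_def by (rule closedin_limit_set)
  have norm\<psi>: "cnorm A (\<psi> j f) \<le> c \<longleftrightarrow> (\<forall>k<summands (S j). \<forall>x\<in>Y k. norm (fval f k x) \<le> c)"
    if "f \<in> carrier (homog_algebra (S j))" "0 \<le> c" for f c
    unfolding Y_def by (rule limit_norm_le_iff[OF AH diag that])
  define I where "I = {k. k < summands (S j) \<and> Y k \<noteq> {}}"
  define P where "P k R (\<Omega> :: ('a \<Rightarrow> complex) topology) \<xi> q w G \<longleftrightarrow>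
     nerve_approximation (subtopology (spc (S j) k) (Y k)) (msize (S j) k) (fval (prj (S j)) k) F'
     (\<lambda>f. fval (\<phi> i j f) k) (cover_D (spc (S j) k) (pushed_cover S m L i j k \<alpha>)) (43 * K * \<delta>) R \<Omega> \<xi> q w G"
    for k R \<Omega> \<xi> q w G
  have "\<exists>R \<Omega> \<xi> q w G. P k R \<Omega> \<xi> q w G" if "k \<in> I" for k
    unfolding P_def
    by (rule summand_model[OF inf AH diag ij _ Yc _ \<alpha> F'(2,3)])
       (use that osc bound \<delta> K1 in \<open>auto simp: I_def\<close>)
  then obtain R \<Omega> \<xi> q w G where P: "\<And>k. k \<in> I \<Longrightarrow> P k (R k) (\<Omega> k) (\<xi> k) (q k) (w k) (G k)" by metis
  have topY: "topspace (subtopology (spc (S j) k) (Y k)) = Y k" for k using closedin_subset[OF Yc] by auto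
  note P = P[unfolded P_def nerve_approximation_def topY]
  have finI: "finite I" by (simp add: I_def)
  define n where "n = card I"
  obtain \<kappa> where \<kappa>: "bij_betw \<kappa> {..<n} I" using ex_bij_betw_nat_finite[OF finI] by (auto simp: n_def atLeast0LessThan)
  have \<kappa>I: "\<kappa> a \<in> I" if "a < n" for a using bij_betwE[OF \<kappa>] that by simp
  have \<kappa>': "\<kappa> a < summands (S j)" "Y (\<kappa> a) \<noteq> {}" if "a < n" for a using \<kappa>I[OF that] by (auto simp: I_def)
  \<comment> \<open>If all limit sets were empty, the unit of \<open>A\<close> would have norm \<open>0\<close>.\<close>
  have n0: "0 < n"
  proof (rule ccontr)
    assume "\<not> 0 < n"
    then have "I = {}" using finI by (simp add: n_def)
    then have "cnorm A (\<psi> j \<one>\<^bsub>homog_algebra (S j)\<^esub>) \<le> 0"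
      unfolding norm\<psi>[OF homog_closed(1)[OF S] order_refl] by (auto simp: I_def)
    moreover have "\<psi> j \<one>\<^bsub>homog_algebra (S j)\<^esub> = \<one>\<^bsub>A\<^esub>" using \<psi>[of j] by (auto simp: star_hom_def Ring.ring_hom_def)
    ultimately show False using A.infinite_carrier(2)[OF nonzero] by simp
  qed
  define H where "H = \<lparr>summands = n, spc = (\<lambda>a. \<Omega> (\<kappa> a)), msize = (\<lambda>a. R (\<kappa> a)),
    prj = (\<lambda>a y. of_fm (R (\<kappa> a)) (R (\<kappa> a)) (q (\<kappa> a) y)), prank = (\<lambda>a. prank (S j) (\<kappa> a))\<rparr>"
  have Hsel: "summands H = n" "spc H a = \<Omega> (\<kappa> a)" "msize H a = R (\<kappa> a)" "prank H a = prank (S j) (\<kappa> a)" for a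
    by (simp_all add: H_def)
  have H: "homogeneous H"
    unfolding H_def
    by (rule homogeneous_model[OF S n0, where Y = "\<lambda>a. Y (\<kappa> a)" and \<xi> = "\<lambda>a. \<xi> (\<kappa> a)" and w = "\<lambda>a. w (\<kappa> a)"])
       (use \<kappa>' closedin_subset[OF Yc] P[OF \<kappa>I] in auto)
  have hvH: "fval (prj H) a y = q (\<kappa> a) y" if "a < n" "y \<in> topspace (\<Omega> (\<kappa> a))" for a y
    using P[OF \<kappa>I[OF that(1)]] that(2) by (simp add: fval_def H_def)
  interpret pullback_model A "S j" "\<psi> j" Y H \<kappa> "\<lambda>a. \<xi> (\<kappa> a)" "\<lambda>a. w (\<kappa> a)"
  proof
    show "bij_betw \<kappa> {..<summands H} {l. l < summands (S j) \<and> Y l \<noteq> {}}" using \<kappa> by (simp add: Hsel I_def)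
    show "w (\<kappa> a) x * star (w (\<kappa> a) x) = fval (prj H) a (\<xi> (\<kappa> a) x)" if "a < summands H" "x \<in> Y (\<kappa> a)" for a x
    proof -
      have a: "a < n" using that by (simp add: Hsel)
      then have "\<xi> (\<kappa> a) x \<in> topspace (\<Omega> (\<kappa> a))" using P[OF \<kappa>I[OF a]] that(2) by blast
      then show ?thesis using P[OF \<kappa>I[OF a]] that(2) hvH[OF a] by simp
    qed
  qed (use A.ring A S H \<psi> Yc norm\<psi> P[OF \<kappa>I] in \<open>auto simp: Hsel\<close>)
  show "\<exists>C (H :: ('a \<Rightarrow> complex) homog_data). unital_sub_cstar C A \<and> homogeneous H \<and>
     star_isomorphic (A\<lparr>carrier := C\<rparr>) (homog_algebra H) \<and> (\<forall>a\<in>F. \<exists>c\<in>C. cdist A a c < \<epsilon>1) \<and>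
     (\<forall>l<summands H. ereal_of_enat (covering_dim (spc H l)) / ereal (real (prank H l)) < mean_dimension S m L + ereal \<epsilon>2)"
  proof (intro exI[of _ image_algebra] exI[of _ H] conjI unital_sub_cstar_image H star_isomorphic_image ballI allI impI)
    fix a assume a: "a \<in> F"
    define f where "f = e a"
    have f: "f \<in> F'" "f \<in> carrier ?Ai" "cdist A a (\<psi> i f) < \<epsilon>1 / 2" using a e by (auto simp: f_def F'_def)
    have \<phi>f: "\<phi> i j f \<in> carrier (homog_algebra (S j))"
      using AH_algebraD(3)[OF AH less_imp_le[OF ij]] f(2) by (auto simp: star_hom_def Ring.ring_hom_def)
    have \<psi>\<phi>: "\<psi> j (\<phi> i j f) = \<psi> i f" by (rule AH_algebraD(5)[OF AH less_imp_le[OF ij] f(2)])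
    define g where "g = homog_mk H (\<lambda>b. G (\<kappa> b) f)"
    have g: "g \<in> carrier (homog_algebra H)" and hg: "\<And>b y. b < n \<Longrightarrow> y \<in> topspace (\<Omega> (\<kappa> b)) \<Longrightarrow> fval g b y = G (\<kappa> b) f y"
      unfolding g_def using P[OF \<kappa>I] f(1) by (intro homog_mk[OF H]; simp add: Hsel hvH)+
    obtain c where c: "c \<in> image_algebra" "cdist A (\<psi> j (\<phi> i j f)) c \<le> 43 * K * \<delta>"
    proof -
      have "\<exists>c\<in>image_algebra. cdist A (\<psi> j (\<phi> i j f)) c \<le> 43 * K * \<delta>"
      proof (rule image_algebra_approximates[OF \<phi>f g K\<delta>0])
        fix b x assume b: "b < summands H" and x: "x \<in> Y (\<kappa> b)"
        then have bn: "b < n" by (simp add: Hsel)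
        have "\<xi> (\<kappa> b) x \<in> topspace (\<Omega> (\<kappa> b))" using P[OF \<kappa>I[OF bn]] x by blast
        then show "norm (fval (\<phi> i j f) (\<kappa> b) x - star (w (\<kappa> b) x) * fval g b (\<xi> (\<kappa> b) x) * w (\<kappa> b) x) \<le> 43 * K * \<delta>"
          using P[OF \<kappa>I[OF bn]] f(1) x hg[OF bn] by simp
      qed
      then show ?thesis using that by blast
    qed
    have "c \<in> carrier A" using c(1) \<psi>_hom(1) by (auto elim: image_algebraE)
    then have "cdist A a c \<le> cdist A a (\<psi> i f) + cdist A (\<psi> i f) c"
      using A.cdist_triangle[of a "\<psi> i f" c] a F(2) \<psi>_hom(1)[OF \<phi>f] \<psi>\<phi> by auto
    also have "\<dots> < \<epsilon>1" using f(3) c(2) K\<delta> \<psi>\<phi> by simp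
    finally show "\<exists>c\<in>image_algebra. cdist A a c < \<epsilon>1" using c(1) by blast
  next
    fix b assume "b < summands H"
    then have b: "b < n" by (simp add: Hsel)
    let ?d = "cover_D (spc (S j) (\<kappa> b)) (pushed_cover S m L i j (\<kappa> b) \<alpha>)" and ?r = "prank (S j) (\<kappa> b)"
    have r: "0 < ?r" by (rule homogeneousD(4)[OF S \<kappa>'(1)[OF b]])
    have "ereal_of_enat (covering_dim (spc H b)) \<le> ereal_of_enat (enat ?d)"
      unfolding ereal_of_enat_le_iff Hsel using P[OF \<kappa>I[OF b]] by blast
    then have "ereal_of_enat (covering_dim (spc H b)) / ereal (real (prank H b)) \<le> ereal (real ?d) / ereal (real ?r)"
      unfolding Hsel(4) using r by (intro ereal_divide_right_mono) simp_all
    also have "\<dots> = ereal (real ?d / real ?r)" using r by simp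
    also have "\<dots> \<le> ereal (cover_ratio S m L i \<alpha> j)"
      unfolding cover_ratio_def using \<kappa>'(1)[OF b] by (simp only: ereal_less_eq, intro Max_ge) auto
    also have "\<dots> < mean_dimension S m L + ereal \<epsilon>2" using ratio by (simp add: \<gamma>_def)
    finally show "ereal_of_enat (covering_dim (spc H b)) / ereal (real (prank H b)) < mean_dimension S m L + ereal \<epsilon>2" .
  qed
qed

theorem theorem1p2:
  fixes A :: "'a cstar_algebra"
    and S :: "nat \<Rightarrow> 'x homog_data"
    and \<phi> :: "nat \<Rightarrow> nat \<Rightarrow> (nat \<Rightarrow> 'x \<Rightarrow> complex mat) \<Rightarrow> (nat \<Rightarrow> 'x \<Rightarrow> complex mat)"
    and \<psi> :: "nat \<Rightarrow> (nat \<Rightarrow> 'x \<Rightarrow> complex mat) \<Rightarrow> 'a"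
    and m :: "nat \<Rightarrow> nat \<Rightarrow> nat \<Rightarrow> nat \<Rightarrow> nat"
    and L :: "nat \<Rightarrow> nat \<Rightarrow> nat \<Rightarrow> nat \<Rightarrow> nat \<Rightarrow> 'x \<Rightarrow> 'x"
  assumes "AH_algebra A S \<phi> \<psi>"
    and "diagonal_maps S \<phi> m L"
    and "simple_cstar A"
  shows "locally_approximable A (mean_dimension S m L) \<and>
    (mean_dimension S m L = 0 \<longrightarrow> local_slow_dimension_growth A)"
proof -
  have "locally_approximable A (mean_dimension S m L)"
    using assms by (intro locally_approximable_mean_dimension) (auto simp: simple_cstar_def)
  then show ?thesis by (auto simp: local_slow_dimension_growth_def)
qed

end
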